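(* Let $k=\mathbb{F}_q$ with $q$ a power of $2$. There are $q^6-q^5+q^4-3q^3+5q^2-6q+7$ $\mathbb{F}_q$-isomorphism classes of ordinary non-hyperelliptic curves of genus three defined over $\mathbb{F}_q$. According to the minimum field of definition of their bitangents they are distributed as follows: $|\mathcal{C}_1|=\frac{1}{168}(q^6-7q^5+42q^4-140q^3+343q^2-462q+328)$, $|\mathcal{C}_2|=\frac18(q^6-3q^5+6q^4-12q^3+15q^2-6q)$, $|\mathcal{C}_3|=\frac13(q^6-q^5-2q^3+4q^2-6q+7)$, $|\mathcal{C}_4|=\frac14(q^6-q^5-q^2-2q+4)$, $|\mathcal{C}_{7,0}|=|\mathcal{C}_{7,1}|=\frac17(q^6+6)$.
   Context: Non-hyperelliptic genus-3 curves are the non-singular plane quartics; such a curve is ordinary if its Jacobian has $2$-rank $3$, equivalently it has exactly seven bitangents. Let $\sigma$ be the $q$-Frobenius acting on coefficients; for $C$ defined over $k$, $\sigma$ permutes the seven bitangents. For $d\in\{1,2,3,4\}$, $\mathcal{C}_d$ is the set of $k$-isomorphism classes of ordinary non-singular quartics over $k$ for which the smallest extension $K$ of $k$ over which all seven bitangents are defined has $[K:k]=d$. When $[K:k]=7$, $\sigma$ permutes the seven bitangents cyclically; $\mathcal{C}_{7,0}$ (resp. $\mathcal{C}_{7,1}$) is the set of $k$-isomorphism classes of such curves for which, for a bitangent $\ell$, the three lines $\ell,\sigma(\ell),\sigma^3(\ell)$ (resp. $\ell,\sigma^2(\ell),\sigma^3(\ell)$) are concurrent. (The degree $[K:k]$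 always lies in $\{1,2,3,4,7\}$, and in degree $7$ exactly one of the two concurrency conditions holds.) *)

theory Defs
  imports "HOL-Algebra.Algebraic_Closure_Type" "HOL-Library.Cardinality"
begin

type_synonym 'a pt = "'a \<times> 'a \<times> 'a"

text \<open>Ternary quartic forms over k: coefficient functions on exponent triples,
  supported on the monomials of degree 4.\<close>

definition mon4 :: "(nat \<times> nat \<times> nat) set" where
  "mon4 = {(i, j, l). i + j + l = 4}"

definition is_quartic_form :: "(nat \<times> nat \<times> nat \<Rightarrow> 'a::field) \<Rightarrow> bool" where
  "is_quartic_form F \<longleftrightarrow> (\<forall>m. m \<notin> mon4 \<longrightarrow> F m = 0)"

definition evalF :: "(nat \<times> nat \<times> nat \<Rightarrow> 'a::field) \<Rightarrow> 'a alg_closure pt \<Rightarrow> 'a alg_closure" where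
  "evalF F p = (case p of (x, y, z) \<Rightarrow>
     (\<Sum>(i, j, l)\<in>mon4. to_ac (F (i, j, l)) * x ^ i * y ^ j * z ^ l))"

definition dX :: "(nat \<times> nat \<times> nat \<Rightarrow> 'a::field) \<Rightarrow> 'a alg_closure pt \<Rightarrow> 'a alg_closure" where
  "dX F p = (case p of (x, y, z) \<Rightarrow>
     (\<Sum>(i, j, l)\<in>mon4. of_nat i * to_ac (F (i, j, l)) * x ^ (i - 1) * y ^ j * z ^ l))"

definition dY :: "(nat \<times> nat \<times> nat \<Rightarrow> 'a::field) \<Rightarrow> 'a alg_closure pt \<Rightarrow> 'a alg_closure" where
  "dY F p = (case p of (x, y, z) \<Rightarrow>
     (\<Sum>(i, j, l)\<in>mon4. of_nat j * to_ac (F (i, j, l)) * x ^ i * y ^ (j - 1) * z ^ l))"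

definition dZ :: "(nat \<times> nat \<times> nat \<Rightarrow> 'a::field) \<Rightarrow> 'a alg_closure pt \<Rightarrow> 'a alg_closure" where
  "dZ F p = (case p of (x, y, z) \<Rightarrow>
     (\<Sum>(i, j, l)\<in>mon4. of_nat l * to_ac (F (i, j, l)) * x ^ i * y ^ j * z ^ (l - 1)))"

definition gradF :: "(nat \<times> nat \<times> nat \<Rightarrow> 'a::field) \<Rightarrow> 'a alg_closure pt \<Rightarrow> 'a alg_closure pt" where
  "gradF F p = (dX F p, dY F p, dZ F p)"

definition nonsingular_quartic :: "(nat \<times> nat \<times> nat \<Rightarrow> 'a::field) \<Rightarrow> bool" where
  "nonsingular_quartic F \<longleftrightarrow> is_quartic_form F \<and>
     (\<forall>p. p \<noteq> (0, 0, 0) \<longrightarrow> \<not> (evalF F p = 0 \<and> gradF F p = (0, 0, 0)))"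

definition dot3 :: "'b::comm_ring_1 pt \<Rightarrow> 'b pt \<Rightarrow> 'b" where
  "dot3 u v = (case u of (a, b, c) \<Rightarrow> case v of (x, y, z) \<Rightarrow> a * x + b * y + c * z)"

definition cross3 :: "'b::comm_ring_1 pt \<Rightarrow> 'b pt \<Rightarrow> 'b pt" where
  "cross3 u v = (case u of (a, b, c) \<Rightarrow> case v of (x, y, z) \<Rightarrow>
     (b * z - c * y, c * x - a * z, a * y - b * x))"

text \<open>Lines of the projective plane over the algebraic closure, given by a normalized
  coefficient vector (a,b,c) (first nonzero coordinate equal to 1); the line is
  a x + b y + c z = 0.\<close>

definition normalized_line :: "'b::field pt \<Rightarrow> bool" where
  "normalized_line L \<longleftrightarrow> (case L of (a, b, c) \<Rightarrow>
     a = 1 \<or> (a = 0 \<and> b = 1) \<or> (a = 0 \<and> b = 0 \<and> c = 1))"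

text \<open>A bitangent: a line that is tangent to the curve at every point of intersection,
  i.e. at each intersection point p the line coincides with the tangent line
  (grad F (p)) . v = 0, i.e. the two coefficient vectors are proportional.\<close>

definition bitangents :: "(nat \<times> nat \<times> nat \<Rightarrow> 'a::field) \<Rightarrow> 'a alg_closure pt set" where
  "bitangents F = {L. normalized_line L \<and>
     (\<forall>p. p \<noteq> (0, 0, 0) \<and> dot3 L p = 0 \<and> evalF F p = 0 \<longrightarrow>
          cross3 (gradF F p) L = (0, 0, 0))}"

definition frob :: "nat \<Rightarrow> 'a::{finite,field} alg_closure pt \<Rightarrow> 'a alg_closure pt" where
  "frob d L = (case L of (a, b, c) \<Rightarrow>
     (a ^ (CARD('a) ^ d), b ^ (CARD('a) ^ d), c ^ (CARD('a) ^ d)))"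

text \<open>[K:k] for the smallest extension K of k over which all bitangents are defined:
  the least d \<ge> 1 such that all bitangents are defined over F_{q^d}.\<close>

definition bitangent_degree :: "(nat \<times> nat \<times> nat \<Rightarrow> 'a::{finite,field}) \<Rightarrow> nat" where
  "bitangent_degree F = (LEAST d. d \<ge> 1 \<and> (\<forall>L\<in>bitangents F. frob d L = L))"

definition concurrent3 :: "'b::comm_ring_1 pt \<Rightarrow> 'b pt \<Rightarrow> 'b pt \<Rightarrow> bool" where
  "concurrent3 u v w \<longleftrightarrow> dot3 u (cross3 v w) = 0"

definition ordinary_quartics :: "(nat \<times> nat \<times> nat \<Rightarrow> 'a::{finite,field}) set" where
  "ordinary_quartics = {F. nonsingular_quartic F \<and> card (bitangents F) = 7}"

definition det3 :: "(nat \<Rightarrow> nat \<Rightarrow> 'b::comm_ring_1) \<Rightarrow> 'b" where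
  "det3 A = A 0 0 * (A 1 1 * A 2 2 - A 1 2 * A 2 1)
          - A 0 1 * (A 1 0 * A 2 2 - A 1 2 * A 2 0)
          + A 0 2 * (A 1 0 * A 2 1 - A 1 1 * A 2 0)"

definition applyA :: "(nat \<Rightarrow> nat \<Rightarrow> 'a::field) \<Rightarrow> 'a alg_closure pt \<Rightarrow> 'a alg_closure pt" where
  "applyA A p = (case p of (x, y, z) \<Rightarrow>
     (to_ac (A 0 0) * x + to_ac (A 0 1) * y + to_ac (A 0 2) * z,
      to_ac (A 1 0) * x + to_ac (A 1 1) * y + to_ac (A 1 2) * z,
      to_ac (A 2 0) * x + to_ac (A 2 1) * y + to_ac (A 2 2) * z))"

definition k_isomorphic :: "(nat \<times> nat \<times> nat \<Rightarrow> 'a::field) \<Rightarrow> (nat \<times> nat \<times> nat \<Rightarrow> 'a) \<Rightarrow> bool" where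
  "k_isomorphic F G \<longleftrightarrow> (\<exists>A c. det3 A \<noteq> 0 \<and> c \<noteq> 0 \<and>
     (\<forall>p. evalF G p = to_ac c * evalF F (applyA A p)))"

definition iso_classes :: "(nat \<times> nat \<times> nat \<Rightarrow> 'a::{finite,field}) set set" where
  "iso_classes = ordinary_quartics //
     {(F, G). F \<in> ordinary_quartics \<and> G \<in> ordinary_quartics \<and> k_isomorphic F G}"

definition C_deg :: "nat \<Rightarrow> (nat \<times> nat \<times> nat \<Rightarrow> 'a::{finite,field}) set set" where
  "C_deg d = {Cl. Cl \<in> iso_classes \<and> (\<exists>F\<in>Cl. bitangent_degree F = d)}"

definition C_7_0 :: "(nat \<times> nat \<times> nat \<Rightarrow> 'a::{finite,field}) set set" where
  "C_7_0 = {Cl. Cl \<in> iso_classes \<and> (\<exists>F\<in>Cl. bitangent_degree F = 7 \<and>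
     (\<exists>L\<in>bitangents F. concurrent3 L (frob 1 L) (frob 3 L)))}"

definition C_7_1 :: "(nat \<times> nat \<times> nat \<Rightarrow> 'a::{finite,field}) set set" where
  "C_7_1 = {Cl. Cl \<in> iso_classes \<and> (\<exists>F\<in>Cl. bitangent_degree F = 7 \<and>
     (\<exists>L\<in>bitangents F. concurrent3 L (frob 2 L) (frob 3 L)))}"

end

theory Submission
  imports Defs "HOL-Library.Z2" "HOL-Combinatorics.Cycles" "HOL-Algebra.Group_Action"
begin

text \<open>
  In characteristic 2 a ternary quartic is the square of a quadratic form (over the algebraic
  closure \<open>K\<close>) plus \<open>\<Sum> M\<^sub>i\<^sub>j x\<^sub>i\<^sup>2 x\<^sub>k x\<^sub>l\<close> with \<open>{j, k, l} = {0, 1, 2}\<close>. The matrix \<open>M\<close> carries all the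
  tangency data: a line \<open>L\<close> is a bitangent iff \<open>M L\<close> is proportional to the vector \<open>L\<^sup>(\<^sup>2\<^sup>)\<close> of squares.
  The equation \<open>M L = L\<^sup>(\<^sup>2\<^sup>)\<close> is semilinear over \<open>\<bbbF>\<^sub>2\<close>, so there are exactly seven bitangents iff \<open>M\<close> is
  invertible, and then they form a Fano plane and a change of coordinates turns \<open>M\<close> into the identity:
  the quartic becomes \<open>Q\<^sup>2 + xyz(x + y + z)\<close>. It is singular only where it vanishes at one of the seven
  points of the Fano plane, and it is determined by its seven values \<open>w\<close> there, which sum to \<open>1\<close>.
  The coordinates are unique up to \<open>GL\<^sub>3(\<bbbF>\<^sub>2)\<close>.

  Over \<open>k = \<bbbF>\<^sub>q\<close> the Frobenius acts on such a frame through some \<open>g \<in> GL\<^sub>3(\<bbbF>\<^sub>2)\<close>, determined up to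
  conjugacy, with \<open>w(g v) = w(v)\<^sup>q\<close>; every \<open>g\<close> and \<open>w\<close> occur by Lang's theorem. Hence the isomorphism
  classes belonging to the class of \<open>g\<close> are the orbits of the centraliser of \<open>g\<close> on these functions \<open>w\<close>,
  and Burnside's lemma reduces the theorem to counting, for commuting \<open>g, h\<close>, the nowhere zero \<open>w\<close>
  with sum \<open>1\<close>, \<open>w \<circ> g = w\<^sup>q\<close> and \<open>w \<circ> h = w\<close>. Orbit by orbit this is a count of elements of
  \<open>\<bbbF>\<^bsub>q^d\<^esub>\<close> with prescribed trace.
\<close>

subsection \<open>Vectors and matrices of size three\<close>

text \<open>The matrix M is the right invariant because a substitution A turns it into transp(A^(2))
  M cof(A), where A^(2) has the squared entries: points enter through their squares, lines through
  cofactors, and the square part of the quartic never interferes. The gradient at p is (M^T p^(2)) x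
  p, so singularities and tangency are both semilinear conditions; for M = I both are solved exactly
  by the vectors proportional to their own squares, that is, by multiples of F_2-vectors. The
  stabiliser of I is given by transp(A^(2)) cof(A) = I, which forces determinant 1 and entries in
  F_2; this is where GL_3(F_2) comes from. The obstacle in the count is that q is arbitrary. Every
  count that is needed has the form \<alpha> + \<beta>[s = 0] as a function of the prescribed sum s,
  and such pairs are closed under convolution over F_q. What remains are the cycle shapes of
  commuting pairs on seven points; they do not involve q and are found by evaluation. The two
  families of degree 7 come from the two classes of elements of order 7, with characteristic
  polynomials x^3 + x + 1 and x^3 + x^2 + 1.\<close>

type_synonym 'b quartic = "nat \<times> nat \<times> nat \<Rightarrow> 'b"

type_synonym 'b mat3 = "'b pt \<times> 'b pt \<times> 'b pt"

fun mv :: "'b::comm_ring_1 mat3 \<Rightarrow> 'b pt \<Rightarrow> 'b pt" where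
  "mv ((a,b,c),(d,e,f),(g,h,i)) (x,y,z) = (a*x+b*y+c*z, d*x+e*y+f*z, g*x+h*y+i*z)"

fun mm :: "'b::comm_ring_1 mat3 \<Rightarrow> 'b mat3 \<Rightarrow> 'b mat3" where
  "mm ((a,b,c),(d,e,f),(g,h,i)) ((a',b',c'),(d',e',f'),(g',h',i')) =
   ((a*a'+b*d'+c*g', a*b'+b*e'+c*h', a*c'+b*f'+c*i'),
    (d*a'+e*d'+f*g', d*b'+e*e'+f*h', d*c'+e*f'+f*i'),
    (g*a'+h*d'+i*g', g*b'+h*e'+i*h', g*c'+h*f'+i*i'))"

fun mdet :: "'b::comm_ring_1 mat3 \<Rightarrow> 'b" where
  "mdet ((a,b,c),(d,e,f),(g,h,i)) = a*(e*i-f*h) - b*(d*i-f*g) + c*(d*h-e*g)"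

fun transp :: "'b mat3 \<Rightarrow> 'b mat3" where
  "transp ((a,b,c),(d,e,f),(g,h,i)) = ((a,d,g),(b,e,h),(c,f,i))"

text \<open>The action on line coordinates that belongs to a matrix acting on points
  (\<open>cross3_mv\<close>). Unlike an inverse transpose it is polynomial in the entries, so it
  commutes with ring maps and makes sense for singular matrices.\<close>

fun cof :: "'b::comm_ring_1 mat3 \<Rightarrow> 'b mat3" where
  "cof ((a,b,c),(d,e,f),(g,h,i)) =
    ((e*i-f*h, f*g-d*i, d*h-e*g), (h*c-i*b, i*a-g*c, g*b-h*a), (b*f-c*e, c*d-a*f, a*e-b*d))"

definition mI :: "'b::comm_ring_1 mat3" where "mI = ((1,0,0),(0,1,0),(0,0,1))"

fun vscale :: "'b::comm_ring_1 \<Rightarrow> 'b pt \<Rightarrow> 'b pt" where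
  "vscale s (x,y,z) = (s*x, s*y, s*z)"

fun mscale :: "'b::comm_ring_1 \<Rightarrow> 'b mat3 \<Rightarrow> 'b mat3" where
  "mscale s (u,v,w) = (vscale s u, vscale s v, vscale s w)"

fun vadd :: "'b::comm_ring_1 pt \<Rightarrow> 'b pt \<Rightarrow> 'b pt" where
  "vadd (a,b,c) (x,y,z) = (a+x, b+y, c+z)"

fun madd :: "'b::comm_ring_1 mat3 \<Rightarrow> 'b mat3 \<Rightarrow> 'b mat3" where
  "madd (u,v,w) (u',v',w') = (vadd u u', vadd v v', vadd w w')"

fun pmap :: "('b \<Rightarrow> 'c) \<Rightarrow> 'b pt \<Rightarrow> 'c pt" where
  "pmap f (x,y,z) = (f x, f y, f z)"

fun mmap :: "('b \<Rightarrow> 'c) \<Rightarrow> 'b mat3 \<Rightarrow> 'c mat3" where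
  "mmap f (u,v,w) = (pmap f u, pmap f v, pmap f w)"

abbreviation pw :: "nat \<Rightarrow> 'b::comm_ring_1 pt \<Rightarrow> 'b pt" where "pw n \<equiv> pmap (\<lambda>x. x ^ n)"
abbreviation mpw :: "nat \<Rightarrow> 'b::comm_ring_1 mat3 \<Rightarrow> 'b mat3" where "mpw n \<equiv> mmap (\<lambda>x. x ^ n)"

fun outer3 :: "'b::comm_ring_1 pt \<Rightarrow> 'b pt \<Rightarrow> 'b mat3" where
  "outer3 (a,b,c) v = (vscale a v, vscale b v, vscale c v)"

lemma mat3_cases [cases type]:
  obtains a b c d e f g h i where "A = ((a,b,c),(d,e,f),(g,h,i))"
  by (cases A) auto

lemma dot3_simp [simp]: "dot3 (a,b,c) (x,y,z) = a*x+b*y+c*z"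
  and cross3_simp [simp]: "cross3 (a,b,c) (x,y,z) = (b*z-c*y, c*x-a*z, a*y-b*x)"
  by (simp_all add: dot3_def cross3_def)

lemma mv_mm: "mv (mm A B) v = mv A (mv B v)"
  by (cases A rule: mat3_cases; cases B rule: mat3_cases; cases v) (simp add: algebra_simps)

lemma mm_assoc: "mm (mm A B) C = mm A (mm B C)"
  by (cases A rule: mat3_cases; cases B rule: mat3_cases; cases C rule: mat3_cases) (simp add: algebra_simps)

lemma mm_mI [simp]: "mm A mI = A" "mm mI A = A"
  by (cases A rule: mat3_cases; simp add: mI_def)+

lemma mv_mI [simp]: "mv mI v = v"
  by (cases v) (simp add: mI_def)

lemma mdet_mI [simp]: "mdet mI = 1" and cof_mI [simp]: "cof mI = mI" and transp_mI [simp]: "transp mI = mI"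
  by (simp_all add: mI_def)

lemma mdet_mm: "mdet (mm A B) = mdet A * mdet B"
  by (cases A rule: mat3_cases; cases B rule: mat3_cases) (simp add: algebra_simps)

lemma mdet_transp [simp]: "mdet (transp A) = mdet A"
  by (cases A rule: mat3_cases) (simp add: algebra_simps)

lemma transp_transp [simp]: "transp (transp A) = A"
  by (cases A rule: mat3_cases) simp

lemma transp_mm: "transp (mm A B) = mm (transp B) (transp A)"
  by (cases A rule: mat3_cases; cases B rule: mat3_cases) (simp add: algebra_simps)

lemma cof_transp: "cof (transp A) = transp (cof A)"
  by (cases A rule: mat3_cases) (simp add: algebra_simps)

lemma cof_mm: "cof (mm A B) = mm (cof A) (cof B)"
  by (cases A rule: mat3_cases; cases B rule: mat3_cases) (simp add: algebra_simps)

lemma mm_transp_cof: "mm (transp A) (cof A) = mscale (mdet A) mI"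
  by (cases A rule: mat3_cases) (simp add: algebra_simps mI_def)

lemma mm_cof_transp: "mm (cof A) (transp A) = mscale (mdet A) mI"
  by (cases A rule: mat3_cases) (simp add: algebra_simps mI_def)

lemma mdet_cof: "mdet (cof A) = mdet A ^ 2"
  by (cases A rule: mat3_cases) (simp add: algebra_simps power2_eq_square)

lemma cross3_mv: "cross3 (mv A u) (mv A v) = mv (cof A) (cross3 u v)"
  by (cases A rule: mat3_cases; cases u; cases v) (simp add: algebra_simps)

lemma dot3_mv: "dot3 (mv A u) v = dot3 u (mv (transp A) v)"
  by (cases A rule: mat3_cases; cases u; cases v) (simp add: algebra_simps)

lemma mscale_mm: "mm (mscale s A) B = mscale s (mm A B)" "mm A (mscale s B) = mscale s (mm A B)"
  by (cases A rule: mat3_cases; cases B rule: mat3_cases; simp add: algebra_simps)+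

lemma vscale_vscale [simp]: "vscale s (vscale t v) = vscale (s * t) v"
  by (cases v) (simp add: algebra_simps)

lemma mscale_mscale [simp]: "mscale s (mscale t A) = mscale (s * t) A"
  by (cases A) simp

lemma vscale_1 [simp]: "vscale 1 v = v" by (cases v) simp
lemma mscale_1 [simp]: "mscale 1 A = A" by (cases A) simp

lemma vscale_eq_0_iff: "vscale s v = (0,0,0) \<longleftrightarrow> s = 0 \<or> v = (0,0,0)" for s :: "'b::idom"
  by (cases v) auto

lemma mv_vscale: "mv A (vscale s v) = vscale s (mv A v)"
  by (cases A rule: mat3_cases; cases v) (simp add: algebra_simps)

lemma mv_mscale: "mv (mscale s A) v = vscale s (mv A v)"
  by (cases A rule: mat3_cases; cases v) (simp add: algebra_simps)

lemma mv_vadd: "mv A (vadd u v) = vadd (mv A u) (mv A v)"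
  by (cases A rule: mat3_cases; cases u; cases v) (simp add: algebra_simps)

lemma mv_0 [simp]: "mv A (0,0,0) = (0,0,0)"
  by (cases A rule: mat3_cases) simp

lemma cof_mscale: "cof (mscale s A) = mscale (s^2) (cof A)"
  by (cases A rule: mat3_cases) (simp add: algebra_simps power2_eq_square)

lemma mdet_mscale: "mdet (mscale s A) = s^3 * mdet A"
  by (cases A rule: mat3_cases) (simp add: algebra_simps power3_eq_cube)

lemma transp_mscale: "transp (mscale s A) = mscale s (transp A)"
  by (cases A rule: mat3_cases) simp

lemma cross3_vscale: "cross3 (vscale s u) v = vscale s (cross3 u v)" "cross3 u (vscale s v) = vscale s (cross3 u v)"
  by (cases u; cases v; simp add: algebra_simps)+

lemma mdet_rows: "mdet (u, v, w) = dot3 u (cross3 v w)"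
  by (cases u; cases v; cases w) (simp add: algebra_simps)

lemma mat3_eqI: "(\<And>v. mv A v = mv B v) \<Longrightarrow> A = B"
proof -
  assume h: "\<And>v. mv A v = mv B v"
  show "A = B"
    using h[of "(1,0,0)"] h[of "(0,1,0)"] h[of "(0,0,1)"]
    by (cases A rule: mat3_cases; cases B rule: mat3_cases) simp
qed

definition minv :: "'b::field mat3 \<Rightarrow> 'b mat3" where
  "minv A = mscale (inverse (mdet A)) (transp (cof A))"

lemma mm_minv: assumes "mdet A \<noteq> 0" shows "mm A (minv A) = mI" "mm (minv A) A = mI"
proof -
  have "mm A (transp (cof A)) = mscale (mdet A) mI" "mm (transp (cof A)) A = mscale (mdet A) mI"
    using mm_transp_cof[of "transp A"] mm_cof_transp[of "transp A"] by (simp_all add: cof_transp)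
  thus "mm A (minv A) = mI" "mm (minv A) A = mI"
    using assms by (simp_all add: minv_def mscale_mm)
qed

lemma mv_minv: assumes "mdet A \<noteq> 0" shows "mv A (mv (minv A) v) = v" "mv (minv A) (mv A v) = v"
  using assms by (simp_all flip: mv_mm add: mm_minv)

lemma mdet_minv: "mdet A \<noteq> 0 \<Longrightarrow> mdet (minv A) \<noteq> 0" for A :: "'b::field mat3"
  using mdet_mm[of A "minv A"] by (auto simp: mm_minv)

lemma mv_inj: "mdet A \<noteq> 0 \<Longrightarrow> mv A u = mv A v \<Longrightarrow> u = v" for A :: "'b::field mat3"
  by (metis mv_minv(2))

lemma mv_eq_0_iff: "mdet A \<noteq> 0 \<Longrightarrow> mv A u = (0,0,0) \<longleftrightarrow> u = (0,0,0)" for A :: "'b::field mat3"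
  by (metis mv_inj mv_0)

subsection \<open>Quartic forms and their odd part\<close>

fun qf :: "'b::field quartic \<Rightarrow> 'b pt \<Rightarrow> 'b" where
  "qf c (x,y,z) = c (4,0,0) * x^4 + c (0,4,0) * y^4 + c (0,0,4) * z^4
     + c (2,2,0) * x^2*y^2 + c (2,0,2) * x^2*z^2 + c (0,2,2) * y^2*z^2
     + c (3,1,0) * x^3*y + c (3,0,1) * x^3*z + c (1,3,0) * x*y^3
     + c (0,3,1) * y^3*z + c (1,0,3) * x*z^3 + c (0,1,3) * y*z^3
     + c (2,1,1) * x^2*y*z + c (1,2,1) * x*y^2*z + c (1,1,2) * x*y*z^2"

text \<open>Row \<open>i\<close>, column \<open>j\<close> holds the coefficient of \<open>x\<^sub>i\<^sup>2\<close> times the product of the two coordinates other than \<open>x\<^sub>j\<close>.\<close>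

definition oddm :: "'b quartic \<Rightarrow> 'b mat3" where
  "oddm c = ((c (2,1,1), c (3,0,1), c (3,1,0)), (c (0,3,1), c (1,2,1), c (1,3,0)), (c (0,1,3), c (1,0,3), c (1,1,2)))"

lemma mon4_eq: "mon4 = {(4,0,0),(0,4,0),(0,0,4),(2,2,0),(2,0,2),(0,2,2),(3,1,0),(3,0,1),(1,3,0),
    (0,3,1),(1,0,3),(0,1,3),(2,1,1),(1,2,1),(1,1,2)}" (is "_ = ?S")
proof -
  have le: "(i,j,l) \<in> ?S" if "i + j + l = 4" for i j l :: nat
  proof -
    have l: "l = 4 - i - j" and ij: "i \<in> {0,1,2,3,4}" "j \<in> {0,1,2,3,4}" "i + j \<le> 4"
      using that by (simp_all; linarith)+
    from ij(1,2) show ?thesis unfolding l by (elim insertE emptyE; use ij(3) in simp)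
  qed
  have "mon4 \<subseteq> ?S"
  proof
    fix m assume m: "m \<in> mon4"
    obtain i j l where ijl: "m = (i,j,l)" by (cases m)
    from m have "i + j + l = 4" unfolding ijl mon4_def by simp
    thus "m \<in> ?S" unfolding ijl by (rule le)
  qed
  moreover have "?S \<subseteq> mon4" by (simp add: mon4_def)
  ultimately show ?thesis by (rule equalityI)
qed

lemma sum_mon4: "sum f mon4 = f (4,0,0) + f (0,4,0) + f (0,0,4) + f (2,2,0) + f (2,0,2) + f (0,2,2)
   + f (3,1,0) + f (3,0,1) + f (1,3,0) + f (0,3,1) + f (1,0,3) + f (0,1,3) + f (2,1,1) + f (1,2,1) + f (1,1,2)"
  for f :: "_ \<Rightarrow> 'b::comm_monoid_add"
  by (simp add: mon4_eq add.assoc)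

lemma evalF_qf: "evalF F = qf (to_ac \<circ> F)"
  by (rule ext) (auto simp: evalF_def sum_mon4)

lemma poly4_zero:
  fixes a0 :: "'b::field"
  assumes inf: "infinite (UNIV :: 'b set)" and z: "\<And>t. a0 + a1*t + a2*t^2 + a3*t^3 + a4*t^4 = 0"
  shows "a0 = 0 \<and> a1 = 0 \<and> a2 = 0 \<and> a3 = 0 \<and> a4 = 0"
proof -
  have "poly [:a0,a1,a2,a3,a4:] t = 0" for t
    using z[of t] by (simp add: algebra_simps power2_eq_square power3_eq_cube power4_eq_xxxx)
  hence "{t. poly [:a0,a1,a2,a3,a4:] t = 0} = UNIV" by auto
  hence "[:a0,a1,a2,a3,a4:] = 0"
    using poly_roots_finite[of "[:a0,a1,a2,a3,a4:]"] inf by metis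
  thus ?thesis by simp
qed

lemma qf_zero:
  fixes c :: "_ \<Rightarrow> 'b::field"
  assumes inf: "infinite (UNIV :: 'b set)" and z: "\<And>p. qf c p = 0" and m: "m \<in> mon4"
  shows "c m = 0"
proof -
  \<comment> \<open>By homogeneity the chart x = 1 suffices: all fifteen coefficients survive in it.
    The five polynomials in y are the coefficients of 1, z, ..., z^4.\<close>
  have *: "(c (4,0,0) + c (3,1,0) * y + c (2,2,0) * y^2 + c (1,3,0) * y^3 + c (0,4,0) * y^4) = 0 \<and>
     (c (3,0,1) + c (2,1,1) * y + c (1,2,1) * y^2 + c (0,3,1) * y^3) = 0 \<and>
     (c (2,0,2) + c (1,1,2) * y + c (0,2,2) * y^2) = 0 \<and> (c (1,0,3) + c (0,1,3) * y) = 0 \<and> c (0,0,4) = 0" for y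
    by (rule poly4_zero[OF inf]) (use z[of "(1,y,_)"] in \<open>simp add: algebra_simps\<close>)
  have 0: "c (4,0,0) = 0 \<and> c (3,1,0) = 0 \<and> c (2,2,0) = 0 \<and> c (1,3,0) = 0 \<and> c (0,4,0) = 0"
    by (rule poly4_zero[OF inf]) (use * in blast)
  have 1: "c (3,0,1) = 0 \<and> c (2,1,1) = 0 \<and> c (1,2,1) = 0 \<and> c (0,3,1) = 0 \<and> (0::'b) = 0"
    by (rule poly4_zero[OF inf]) (use * in simp)
  have 2: "c (2,0,2) = 0 \<and> c (1,1,2) = 0 \<and> c (0,2,2) = 0 \<and> (0::'b) = 0 \<and> (0::'b) = 0"
    by (rule poly4_zero[OF inf]) (use * in simp)
  have 3: "c (1,0,3) = 0 \<and> c (0,1,3) = 0 \<and> (0::'b) = 0 \<and> (0::'b) = 0 \<and> (0::'b) = 0"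
    by (rule poly4_zero[OF inf]) (use * in simp)
  show ?thesis using m 0 1 2 3 * by (auto simp: mon4_eq)
qed

lemma qf_diff: "qf (\<lambda>m. c m - c' m) p = qf c p - qf c' p"
  by (cases p) (simp add: algebra_simps)

lemma qf_unique:
  fixes c :: "_ \<Rightarrow> 'b::field"
  assumes inf: "infinite (UNIV :: 'b set)" and "\<And>p. qf c p = qf c' p" and "m \<in> mon4"
  shows "c m = c' m"
  using qf_zero[OF inf, of "\<lambda>m. c m - c' m" m] assms by (simp add: qf_diff)

lemma oddm_unique:
  fixes c :: "_ \<Rightarrow> 'b::field"
  assumes inf: "infinite (UNIV :: 'b set)" and "\<And>p. qf c p = qf c' p"
  shows "oddm c = oddm c'"
  using qf_unique[OF inf, of c c'] assms(2) by (simp add: oddm_def mon4_eq)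

text \<open>Only the odd part is named and the even coefficients are hidden by the quantifier. The
  resulting condition is closed under sums and scalars, so it can be checked monomial by
  monomial.\<close>

definition quartic_with :: "('b::field pt \<Rightarrow> 'b) \<Rightarrow> 'b mat3 \<Rightarrow> bool" where
  "quartic_with f M \<longleftrightarrow> (\<exists>c. (\<forall>x. f x = qf c x) \<and> oddm c = M)"

lemma quartic_with_add: "quartic_with f M \<Longrightarrow> quartic_with g N \<Longrightarrow> quartic_with (\<lambda>x. f x + g x) (madd M N)"
  unfolding quartic_with_def
proof (elim exE conjE)
  fix c c' assume "\<forall>x. f x = qf c x" "\<forall>x. g x = qf c' x" "oddm c = M" "oddm c' = N"
  thus "\<exists>c. (\<forall>x. f x + g x = qf c x) \<and> oddm c = madd M N"
    by (intro exI[of _ "\<lambda>m. c m + c' m"]) (auto simp: oddm_def algebra_simps)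
qed

lemma quartic_with_scale: "quartic_with f M \<Longrightarrow> quartic_with (\<lambda>x. s * f x) (mscale s M)"
  unfolding quartic_with_def
proof (elim exE conjE)
  fix c assume "\<forall>x. f x = qf c x" "oddm c = M"
  thus "\<exists>c. (\<forall>x. s * f x = qf c x) \<and> oddm c = mscale s M"
    by (intro exI[of _ "\<lambda>m. s * c m"]) (auto simp: oddm_def algebra_simps)
qed

lemma char2_add_self: assumes "(2::'b::field) = 0" shows "(x::'b) + x = 0"
  using assms by (metis mult_2 mult_zero_left)

lemma char2_minus: assumes "(2::'b::field) = 0" shows "- x = (x::'b)"
  using char2_add_self[OF assms, of x] by (simp add: add_eq_0_iff)

lemma char2_diff: assumes "(2::'b::field) = 0" shows "x - y = x + (y::'b)"
  using char2_minus[OF assms, of y] by (metis diff_conv_add_uminus)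

lemma char2_square_add: assumes "(2::'b::field) = 0" shows "(x + y) ^ 2 = x ^ 2 + (y::'b) ^ 2"
  using assms by (simp add: power2_sum)

text \<open>Every monomial is of this shape, and in characteristic 2 the odd part of \<open>u\<^sup>2 v w\<close> is \<open>u\<^sup>(\<^sup>2\<^sup>) \<otimes> (v \<times> w)\<close>;
  this gives the transformation law of \<open>oddm\<close> under linear substitutions.\<close>

lemma quartic_with_prod:
  assumes c2: "(2::'b::field) = 0"
  shows "quartic_with (\<lambda>x::'b pt. dot3 u x ^ 2 * dot3 v x * dot3 w x) (outer3 (pw 2 u) (cross3 v w))"
proof -
  obtain u1 u2 u3 v1 v2 v3 w1 w2 w3 where uvw: "u = (u1,u2,u3)" "v = (v1,v2,v3)" "w = (w1,w2,w3)"
    by (metis prod_cases3)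
  define c where "c = (\<lambda>_::nat \<times> nat \<times> nat. 0::'b)((4,0,0) := u1^2*(v1*w1), (0,4,0) := u2^2*(v2*w2), (0,0,4) := u3^2*(v3*w3),
    (2,2,0) := u1^2*(v2*w2) + u2^2*(v1*w1), (2,0,2) := u1^2*(v3*w3) + u3^2*(v1*w1), (0,2,2) := u2^2*(v3*w3) + u3^2*(v2*w2),
    (3,1,0) := u1^2*(v1*w2+v2*w1), (1,3,0) := u2^2*(v1*w2+v2*w1), (1,1,2) := u3^2*(v1*w2+v2*w1),
    (3,0,1) := u1^2*(v1*w3+v3*w1), (1,2,1) := u2^2*(v1*w3+v3*w1), (1,0,3) := u3^2*(v1*w3+v3*w1),
    (2,1,1) := u1^2*(v2*w3+v3*w2), (0,3,1) := u2^2*(v2*w3+v3*w2), (0,1,3) := u3^2*(v2*w3+v3*w2))"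
  have "dot3 u x ^ 2 * dot3 v x * dot3 w x = qf c x" for x
  proof (cases x)
    case (fields x y z)
    have "dot3 u (x,y,z) ^ 2 = u1^2*x^2 + u2^2*y^2 + u3^2*z^2"
      by (simp add: uvw char2_square_add[OF c2] power_mult_distrib)
    thus ?thesis unfolding fields
      by (simp add: uvw c_def algebra_simps power2_eq_square power3_eq_cube power4_eq_xxxx)
  qed
  moreover have "oddm c = outer3 (pw 2 u) (cross3 v w)"
    by (simp add: c_def oddm_def uvw char2_diff[OF c2] algebra_simps)
  ultimately show ?thesis unfolding quartic_with_def by blast
qed

text \<open>The rows of \<open>A\<close> are the linear forms substituted for the coordinates, so
  the claim is a sum of fifteen instances of \<open>quartic_with_prod\<close>. Stated with
  \<open>cof A\<close> rather than an inverse it also covers singular \<open>A\<close>: in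
  \<open>bitangents_eq\<close> a matrix of rank two restricts the quartic to a line.\<close>

lemma quartic_with_comp:
  fixes c :: "_ \<Rightarrow> 'b::field"
  assumes c2: "(2::'b::field) = 0"
  shows "quartic_with (\<lambda>x. qf c (mv A x)) (mm (mm (transp (mpw 2 A)) (oddm c)) (cof A))"
proof -
  obtain r1 r2 r3 where A: "A = (r1,r2,r3)" by (cases A)
  note qs = quartic_with_add quartic_with_scale quartic_with_prod[OF c2]
  have "quartic_with (\<lambda>x. c (4,0,0) * (dot3 r1 x ^ 2 * dot3 r1 x * dot3 r1 x) + (c (0,4,0) * (dot3 r2 x ^ 2 * dot3 r2 x * dot3 r2 x) + (c (0,0,4) * (dot3 r3 x ^ 2 * dot3 r3 x * dot3 r3 x) + (c (2,2,0) * (dot3 r1 x ^ 2 * dot3 r2 x * dot3 r2 x) + (c (2,0,2) * (dot3 r1 x ^ 2 * dot3 r3 x * dot3 r3 x) + (c (0,2,2) * (dot3 r2 x ^ 2 * dot3 r3 x * dot3 r3 x) + (c (3,1,0) * (dot3 r1 x ^ 2 * dot3 r1 x * dot3 r2 x) + (c (3,0,1) * (dot3 r1 x ^ 2 * dot3 r1 x * dot3 r3 x) + (c (1,3,0) * (dot3 r2 x ^ 2 * dot3 r2 x * dot3 r1 x) + (c (0,3,1) * (dot3 r2 x ^ 2 * dot3 r2 x * dot3 r3 x) + (c (1,0,3) * (dot3 r3 x ^ 2 * dot3 r3 x * dot3 r1 x) + (c (0,1,3) * (dot3 r3 x ^ 2 * dot3 r3 x * dot3 r2 x) + (c (2,1,1)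 * (dot3 r1 x ^ 2 * dot3 r2 x * dot3 r3 x) + (c (1,2,1) * (dot3 r2 x ^ 2 * dot3 r1 x * dot3 r3 x) + (c (1,1,2) * (dot3 r3 x ^ 2 * dot3 r1 x * dot3 r2 x)))))))))))))))) (madd (mscale (c (4,0,0)) (outer3 (pw 2 r1) (cross3 r1 r1))) (madd (mscale (c (0,4,0)) (outer3 (pw 2 r2) (cross3 r2 r2))) (madd (mscale (c (0,0,4)) (outer3 (pw 2 r3) (cross3 r3 r3))) (madd (mscale (c (2,2,0)) (outer3 (pw 2 r1) (cross3 r2 r2))) (madd (mscale (c (2,0,2)) (outer3 (pw 2 r1) (cross3 r3 r3))) (madd (mscale (c (0,2,2)) (outer3 (pw 2 r2) (cross3 r3 r3))) (madd (mscale (c (3,1,0)) (outer3 (pw 2 r1) (cross3 r1 r2))) (madd (mscale (c (3,0,1)) (outer3 (pw 2 r1) (cross3 r1 r3))) (madd (mscale (c (1,3,0)) (outer3 (pw 2 r2) (cross3 r2 r1))) (madd (mscale (c (0,3,1)) (outer3 (pw 2 r2) (cross3 r2 r3))) (madd (mscale (c (1,0,3)) (outer3 (pw 2 r3) (cross3 r3 r1))) (madd (mscale (c (0,1,3)) (outer3 (pw 2 r3) (cross3 r3 r2))) (madd (mscale (c (2,1,1)) (outer3 (pw 2 r1) (cross3 r2 r3))) (madd (mscale (c (1,2,1)) (outer3 (pw 2 r2) (cross3 r1 r3))) (mscale (c (1,1,2)) (outer3 (pw 2 r3) (cross3 r1 r2)))))))))))))))))"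
    by (intro qs)
  moreover have "(c (4,0,0) * (dot3 r1 x ^ 2 * dot3 r1 x * dot3 r1 x) + (c (0,4,0) * (dot3 r2 x ^ 2 * dot3 r2 x * dot3 r2 x) + (c (0,0,4) * (dot3 r3 x ^ 2 * dot3 r3 x * dot3 r3 x) + (c (2,2,0) * (dot3 r1 x ^ 2 * dot3 r2 x * dot3 r2 x) + (c (2,0,2) * (dot3 r1 x ^ 2 * dot3 r3 x * dot3 r3 x) + (c (0,2,2) * (dot3 r2 x ^ 2 * dot3 r3 x * dot3 r3 x) + (c (3,1,0) * (dot3 r1 x ^ 2 * dot3 r1 x * dot3 r2 x) + (c (3,0,1) * (dot3 r1 x ^ 2 * dot3 r1 x * dot3 r3 x) + (c (1,3,0) * (dot3 r2 x ^ 2 * dot3 r2 x * dot3 r1 x) + (c (0,3,1) * (dot3 r2 x ^ 2 * dot3 r2 x * dot3 r3 x) + (c (1,0,3) * (dot3 r3 x ^ 2 * dot3 r3 x * dot3 r1 x) + (c (0,1,3) * (dot3 r3 x ^ 2 * dot3 r3 x * dot3 r2 x) + (c (2,1,1) * (dot3 r1 x ^ 2 * dot3 r2 x * dot3 r3 x) + (c (1,2,1) * (dot3 r2 x ^ 2 * dot3 r1 x * dot3 r3 x) + (c (1,1,2) * (dot3 r3 x ^ 2 * dot3 r1 x * dot3 r2 x)))))))))))))))) = qf c (mv A x)" for x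
    by (cases r1; cases r2; cases r3; cases x) (simp add: A power2_eq_square power3_eq_cube power4_eq_xxxx mult.assoc add.assoc)
  \<comment> \<open>The six monomials that are squares drop out since \<open>cross3 r r\<close> is
    zero; the other nine supply the entries of \<open>oddm c\<close>.\<close>
  moreover have "(madd (mscale (c (4,0,0)) (outer3 (pw 2 r1) (cross3 r1 r1))) (madd (mscale (c (0,4,0)) (outer3 (pw 2 r2) (cross3 r2 r2))) (madd (mscale (c (0,0,4)) (outer3 (pw 2 r3) (cross3 r3 r3))) (madd (mscale (c (2,2,0)) (outer3 (pw 2 r1) (cross3 r2 r2))) (madd (mscale (c (2,0,2)) (outer3 (pw 2 r1) (cross3 r3 r3))) (madd (mscale (c (0,2,2)) (outer3 (pw 2 r2) (cross3 r3 r3))) (madd (mscale (c (3,1,0)) (outer3 (pw 2 r1) (cross3 r1 r2))) (madd (mscale (c (3,0,1)) (outer3 (pw 2 r1) (cross3 r1 r3))) (madd (mscale (c (1,3,0)) (outer3 (pw 2 r2) (cross3 r2 r1))) (madd (mscale (c (0,3,1)) (outer3 (pw 2 r2) (cross3 r2 r3))) (madd (mscale (c (1,0,3)) (outer3 (pw 2 r3) (cross3 r3 r1))) (madd (mscale (c (0,1,3)) (outer3 (pw 2 r3) (cross3 r3 r2))) (madd (mscale (c (2,1,1)) (outer3 (pw 2 r1) (cross3 r2 r3))) (madd (mscale (c (1,2,1)) (outer3 (pw 2 r2) (cross3 r1 r3))) (mscale (c (1,1,2)) (outer3 (pw 2 r3) (cross3 r1 r2)))))))))))))))))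
      = mm (mm (transp (mpw 2 A)) (oddm c)) (cof A)"
    by (cases r1; cases r2; cases r3) (simp add: A oddm_def algebra_simps c2)
  ultimately show ?thesis by simp
qed

subsection \<open>Fields of characteristic 2\<close>

text \<open>A linear factor occurring twice in the factorization would give a common root of
  \<open>p\<close> and its derivative.\<close>

lemma card_distinct_roots:
  fixes p :: "'b::alg_closed_field poly"
  assumes "p \<noteq> 0" and sep: "\<And>x. poly p x = 0 \<Longrightarrow> poly (pderiv p) x \<noteq> 0"
  shows "card {x. poly p x = 0} = Polynomial.degree p"
proof -
  obtain A where A: "size A = Polynomial.degree p" "p = smult (Polynomial.lead_coeff p) (\<Prod>x\<in>#A. [:-x, 1:])"
    using alg_closed_imp_factorization[OF assms(1)] by blast
  have roots: "{x. poly p x = 0} = set_mset A"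
  proof -
    have "poly p x = Polynomial.lead_coeff p * (\<Prod>y\<in>#A. x - y)" for x
      by (subst A(2)) (simp add: poly_prod_mset)
    moreover have "Polynomial.lead_coeff p \<noteq> 0" using assms(1) by simp
    ultimately show ?thesis by auto
  qed
  have "count A x \<le> 1" for x
  proof (rule ccontr)
    assume *: "\<not> count A x \<le> 1"
    hence "x \<in># A" by (metis not_in_iff zero_le_one)
    then obtain B' where B': "A = add_mset x B'" by (metis multi_member_split)
    with * have "x \<in># B'" by (auto simp: not_in_iff)
    then obtain B where B: "A = add_mset x (add_mset x B)" using B' by (metis multi_member_split)
    have "p = [:-x,1:] * ([:-x,1:] * smult (Polynomial.lead_coeff p) (\<Prod>x\<in>#B. [:-x, 1:]))"
      by (subst A(2), subst B) (simp add: mult_ac)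
    then obtain r where r: "p = [:-x,1:] * ([:-x,1:] * r)" by blast
    have "poly p x = 0" "poly (pderiv p) x = 0"
      unfolding r pderiv_mult poly_add poly_mult by simp_all
    thus False using sep by blast
  qed
  hence "count A x = 1" if "x \<in># A" for x using that by (simp add: le_antisym)
  hence "size A = card (set_mset A)" by (simp add: size_multiset_overloaded_eq)
  thus ?thesis using roots A(1) by simp
qed

text \<open>The derivative of x^(2^e) - x is the constant -1, so the roots are distinct. The fixed
  set is the subfield with 2^e elements.\<close>

lemma card_power_fixed:
  assumes c2: "(2::'b::alg_closed_field) = 0" and e: "e > 0"
  shows "card {x::'b. x ^ (2^e) = x} = 2 ^ e"
proof -
  define p :: "'b poly" where "p = monom 1 (2^e) - [:0,1:]"
  have e1: "(2::nat)^e > 1" using e by (intro one_less_power) auto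
  have deg: "Polynomial.degree p = 2^e"
  proof -
    have "Polynomial.degree (monom (1::'b) (2^e) + - [:0,1:]) = 2^e"
      using e1 by (subst degree_add_eq_left) (simp_all add: degree_monom_eq)
    thus ?thesis unfolding p_def diff_conv_add_uminus .
  qed
  have "pderiv p = [:-1:]"
    using c2 e by (simp add: p_def pderiv_diff pderiv_monom pderiv_pCons zero_power)
  hence "card {x. poly p x = 0} = 2^e"
    using deg e1 by (subst card_distinct_roots) auto
  moreover have "{x. poly p x = 0} = {x::'b. x ^ (2^e) = x}"
    by (auto simp: p_def poly_monom)
  ultimately show ?thesis by simp
qed

lemma infinite_char2: assumes c2: "(2::'b::alg_closed_field) = 0" shows "infinite (UNIV :: 'b set)"
proof
  assume fin: "finite (UNIV :: 'b set)"
  obtain e :: nat where e: "card (UNIV :: 'b set) < 2 ^ e" using less_exp by blast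
  have e0: "e > 0" using e fin by (cases e) (auto simp: card_gt_0_iff)
  have "card {x::'b. x ^ (2^e) = x} \<le> card (UNIV :: 'b set)" by (rule card_mono[OF fin]) simp
  thus False using card_power_fixed[OF c2 e0] e by simp
qed

lemma power_card_self: "(x::'a::{finite,field}) ^ CARD('a) = x"
proof (cases "x = 0")
  case False
  have eq: "Suc (CARD('a) - 1) = CARD('a)" using finite_UNIV_card_ge_0[where ?'a = 'a] by simp
  have "(\<Prod>y\<in>UNIV-{0}. x * y) = (\<Prod>y\<in>UNIV-{0}. y)"
    by (rule prod.reindex_bij_witness[of _ "\<lambda>y. y / x" "\<lambda>y. x * y"]) (use False in auto)
  hence "x ^ (CARD('a) - 1) * \<Prod>(UNIV-{0::'a}) = \<Prod>(UNIV-{0})" by (simp add: prod.distrib)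
  hence "x ^ (CARD('a) - 1) = 1" by simp
  thus ?thesis by (metis eq power_Suc mult_1_right)
qed (simp add: zero_power)

text \<open>Translation by 1 permutes the field; comparing sums over all elements gives |k| = 0 in
  k, and |k| is a power of 2.\<close>

lemma two_eq_0_k: assumes "\<exists>n. CARD('a::{finite,field}) = 2 ^ n" shows "(2::'a) = 0"
proof -
  obtain n where n: "CARD('a) = 2 ^ n" using assms by blast
  have "(\<Sum>x\<in>UNIV. x + 1) = (\<Sum>x\<in>(UNIV::'a set). x)"
    by (rule sum.reindex_bij_witness[of _ "\<lambda>y. y - 1" "\<lambda>y. y + 1"]) auto
  hence "of_nat CARD('a) = (0::'a)" by (simp add: sum.distrib)
  thus ?thesis by (simp add: n)
qed

lemma two_eq_0: assumes "\<exists>n. CARD('a::{finite,field}) = 2 ^ n" shows "(2::'a alg_closure) = 0"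
  using two_eq_0_k[OF assms] by (metis to_ac_0 to_ac_numeral)

lemma char2_power_add:
  assumes c2: "(2::'b::field) = 0" shows "(x + y :: 'b) ^ (2^n) = x ^ (2^n) + y ^ (2^n)"
proof (induction n)
  case (Suc n)
  show ?case
    by (simp only: power_Suc2 power_mult Suc char2_square_add[OF c2])
qed simp

lemma char2_power_inj:
  assumes c2: "(2::'b::field) = 0" and "(x::'b) ^ (2^n) = y ^ (2^n)" shows "x = y"
proof -
  have "(x + y) ^ (2^n) = 0" using assms(2) by (simp add: char2_power_add[OF c2] char2_add_self[OF c2])
  hence "x + y = 0" by simp
  thus ?thesis by (metis char2_minus[OF c2] add_eq_0_iff)
qed

lemma card_gt_1_field: "CARD('a::{finite,field}) > 1"
proof -
  have "card {0::'a, 1} \<le> CARD('a)" by (rule card_mono) auto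
  thus ?thesis by simp
qed

text \<open>The image of k lies among the roots of x^q = x, and both sets have q elements. This is
  the criterion by which matrices and coefficients descend from the closure to k.\<close>

lemma range_to_ac: assumes hq: "\<exists>n. CARD('a::{finite,field}) = 2 ^ n"
  shows "range (to_ac :: 'a \<Rightarrow> _) = {x. x ^ CARD('a) = x}"
proof -
  obtain n where n: "CARD('a) = 2 ^ n" using hq by blast
  have n0: "n > 0" using card_gt_1_field[where ?'a='a] n by (cases n) auto
  have "card {x::'a alg_closure. x ^ CARD('a) = x} = CARD('a)"
    unfolding n by (rule card_power_fixed[OF two_eq_0[OF hq] n0])
  moreover have "card (range (to_ac :: 'a \<Rightarrow> _)) = CARD('a)"
    by (simp add: card_image inj_to_ac)
  moreover have "range (to_ac :: 'a \<Rightarrow> _) \<subseteq> {x. x ^ CARD('a) = x}"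
    using power_card_self by (metis (mono_tags, lifting) image_subsetI mem_Collect_eq to_ac_power)
  moreover have "finite {x::'a alg_closure. x ^ CARD('a) = x}"
    using calculation(1) card_gt_1_field[where ?'a='a] by (metis card.infinite not_one_less_zero)
  ultimately show ?thesis by (metis card_subset_eq)
qed

subsection \<open>Bitangents in characteristic 2\<close>

text \<open>Squares have derivative 0, so in each odd term only the product of two coordinates is
  differentiated. Its gradient is the cross product of a unit vector with \<open>p\<close>, signs
  being immaterial in characteristic 2.\<close>

lemma gradF_eq:
  assumes c2: "(2::'a::field alg_closure) = 0"
  shows "gradF F p = cross3 (mv (transp (oddm (to_ac \<circ> (F :: _ \<Rightarrow> 'a)))) (pw 2 p)) p"
proof (cases p)
  case (fields x y z)
  have c4: "(4::'a alg_closure) = 0" using c2 by (metis mult_2 numeral_Bit0 mult_zero_left numeral_code(2))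
  have c3: "(3::'a alg_closure) = 1" using c2 by (metis add_0 numeral_One numeral_plus_one semiring_norm(5))
  show ?thesis
    by (simp add: fields gradF_def dX_def dY_def dZ_def sum_mon4 oddm_def c2 c3 c4 char2_diff[OF c2]
        algebra_simps power2_eq_square power3_eq_cube)
qed

lemma cross3_zero_iff:
  fixes u v :: "'b::field pt" assumes "v \<noteq> (0,0,0)"
  shows "cross3 u v = (0,0,0) \<longleftrightarrow> (\<exists>s. u = vscale s v)"
proof
  assume h: "cross3 u v = (0,0,0)"
  obtain a b c x y z where uv: "u = (a,b,c)" "v = (x,y,z)" by (metis prod_cases3)
  consider "x \<noteq> 0" | "y \<noteq> 0" | "z \<noteq> 0" using assms uv by auto
  thus "\<exists>s. u = vscale s v"
  proof cases
    case 1 thus ?thesis using h uv by (intro exI[of _ "a/x"]) (auto simp: field_simps)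
  next
    case 2 thus ?thesis using h uv by (intro exI[of _ "b/y"]) (auto simp: field_simps)
  next
    case 3 thus ?thesis using h uv by (intro exI[of _ "c/z"]) (auto simp: field_simps)
  qed
qed (cases v, auto simp: algebra_simps)

lemma pw2_linear:
  assumes c2: "(2::'b::field) = 0"
  shows "pw 2 (vadd (vscale s u) (vscale t v)) = vadd (vscale (s^2) (pw 2 u)) (vscale (t^2) (pw 2 (v::'b pt)))"
  by (cases u; cases v) (simp add: char2_square_add[OF c2] power_mult_distrib)

lemma dot3_pw2:
  assumes c2: "(2::'b::field) = 0"
  shows "dot3 (pw 2 u) (pw 2 v) = (dot3 u (v::'b pt)) ^ 2"
  by (cases u; cases v) (simp add: char2_square_add[OF c2] power_mult_distrib)

lemma cross3_pw2:
  assumes c2: "(2::'b::field) = 0"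
  shows "cross3 (pw 2 u) (pw 2 v) = pw 2 (cross3 u (v::'b pt))"
  by (cases u; cases v) (simp add: char2_square_add[OF c2] char2_diff[OF c2] power_mult_distrib)

lemma cross3_cross3: "cross3 (cross3 a p) L = vadd (vscale (dot3 a L) p) (vscale (- dot3 p L) a)"
  by (cases a; cases p; cases L) (simp add: algebra_simps)

lemma dot3_linear: "dot3 L (vadd (vscale s u) (vscale t v)) = s * dot3 L u + t * dot3 L v"
  by (cases L; cases u; cases v) (simp add: algebra_simps)

text \<open>Both partial derivatives of the binary form are multiples of h3 s^2 + h1 t^2, so the
  assumption says that every root is multiple. That expression is a constant times the square of a
  linear form, so unless it is zero it vanishes at one point only. If h3 is nonzero, all four roots
  coincide there and the form is a constant times a fourth power, which has no s^3 t term in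
  characteristic 2. If only h1 is nonzero, the point is t = 0, but there is also a root with t =
  1.\<close>

lemma binary_quartic_all_roots_double:
  fixes h4 h3 h2 h1 h0 :: "'b::alg_closed_field"
  assumes c2: "(2::'b) = 0"
    and roots: "\<And>s t. (s,t) \<noteq> (0,0) \<Longrightarrow> h4*s^4 + h3*s^3*t + h2*s^2*t^2 + h1*s*t^3 + h0*t^4 = 0
           \<Longrightarrow> h3*s^2 + h1*t^2 = 0"
  shows "h3 = 0 \<and> h1 = 0"
proof (cases "h3 = 0")
  case True
  have "h1 = 0"
  proof (rule ccontr)
    assume h1: "h1 \<noteq> 0"
    have "Polynomial.degree [:h0,h1,h2,h3,h4:] > 0" using h1 by simp
    then obtain s where "poly [:h0,h1,h2,h3,h4:] s = 0" using alg_closed_imp_poly_has_root by blast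
    hence "h4*s^4 + h3*s^3*1 + h2*s^2*1^2 + h1*s*1^3 + h0*1^4 = 0"
      by (simp add: algebra_simps power2_eq_square power3_eq_cube power4_eq_xxxx)
    from roots[OF _ this] show False using h1 True by simp
  qed
  thus ?thesis using True by simp
next
  case False
  have h4: "h4 \<noteq> 0" using roots[of 1 0] False by auto
  define p where "p = [:h0,h1,h2,h3,h4:]"
  have pn: "p \<noteq> 0" "Polynomial.degree p = 4" "Polynomial.lead_coeff p = h4" using h4 by (auto simp: p_def)
  obtain A where A: "size A = 4" "p = smult h4 (\<Prod>x\<in>#A. [:-x, 1:])"
    using alg_closed_imp_factorization[OF pn(1)] pn by auto
  obtain r where r: "r ^ 2 = h1 / h3" using nth_root_exists[of 2] by auto
  have "x = r" if "x \<in># A" for x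
  proof -
    have "poly p x = 0" using that by (subst A(2)) (auto simp: poly_prod_mset)
    hence "h4*x^4 + h3*x^3*1 + h2*x^2*1^2 + h1*x*1^3 + h0*1^4 = 0"
      by (simp add: p_def algebra_simps power2_eq_square power3_eq_cube power4_eq_xxxx)
    from roots[OF _ this] have "h3 * x^2 + h1 = 0" by simp
    hence "x^2 = r^2" using False unfolding r
      by (simp add: field_simps char2_minus[OF c2] add_eq_0_iff2)
    thus ?thesis using char2_power_inj[OF c2, of x 1 r] by simp
  qed
  hence "A = replicate_mset 4 r" using A(1) by (metis set_mset_subset_singletonD subsetI singletonI)
  hence "p = smult h4 ([:-r,1:]^4)" using A(2) by simp
  hence "Polynomial.coeff p 3 = h4 * Polynomial.coeff ([:-r,1:]^4) 3" by simp
  moreover have "Polynomial.coeff ([:-r,1:]^4) 3 = 0"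
  proof -
    have "[:-r,1:]^4 = [:r^4, 0, 0, 0, 1:]"
      by (simp add: power4_eq_xxxx char2_minus[OF c2] char2_add_self[OF c2])
    thus ?thesis by (simp add: eval_nat_numeral)
  qed
  ultimately have "h3 = 0" by (simp add: p_def eval_nat_numeral)
  thus ?thesis using False by simp
qed

lemma normalized_line_span:
  fixes L :: "'b::field pt"
  assumes c2: "(2::'b) = 0" and "normalized_line L"
  obtains u v where "cross3 u v = L" "dot3 L u = 0" "dot3 L v = 0"
proof -
  obtain a b c where L: "L = (a,b,c)" by (metis prod_cases3)
  consider "a = 1" | "a = 0" "b = 1" | "a = 0" "b = 0" "c = 1"
    using assms(2) by (auto simp: normalized_line_def L)
  thus ?thesis
  proof cases
    case 1 show ?thesis by (rule that[of "(b,1,0)" "(c,0,1)"]) (simp_all add: L 1 char2_minus[OF c2] char2_add_self[OF c2])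
  next
    case 2 show ?thesis by (rule that[of "(1,0,0)" "(0,c,1)"]) (simp_all add: L 2 char2_minus[OF c2] char2_add_self[OF c2])
  next
    case 3 show ?thesis by (rule that[of "(1,0,0)" "(0,1,0)"]) (simp_all add: L 3)
  qed
qed

lemma normalized_line_nonzero: "normalized_line L \<Longrightarrow> L \<noteq> (0,0,0)"
  by (auto simp: normalized_line_def)

text \<open>On the line spanned by \<open>u, v\<close> the form becomes a binary quartic in which \<open>s\<^sup>3 t\<close> and \<open>s t\<^sup>3\<close> have the
  coefficients \<open>u\<^sup>(\<^sup>2\<^sup>) \<bullet> M L\<close> and \<open>v\<^sup>(\<^sup>2\<^sup>) \<bullet> M L\<close>; all its roots are multiple iff both vanish.\<close>

lemma bitangents_eq:
  fixes F :: "_ \<Rightarrow> 'a::{finite,field}"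
  assumes hq: "\<exists>n. CARD('a) = 2 ^ n"
  shows "bitangents F = {L. normalized_line L \<and> cross3 (mv (oddm (to_ac \<circ> F)) L) (pw 2 L) = (0,0,0)}"
proof -
  note c2 = two_eq_0[OF hq]
  let ?M = "oddm (to_ac \<circ> F)"
  have grad: "cross3 (gradF F p) L = vscale (dot3 (pw 2 p) (mv ?M L)) p" if "dot3 L p = 0" for p L
  proof -
    have "dot3 p L = 0" using that by (cases p; cases L) (simp add: algebra_simps)
    moreover have "vadd v (vscale 0 w) = v" for v w :: "'a alg_closure pt" by (cases v; cases w) simp
    ultimately show ?thesis by (simp add: gradF_eq[OF c2] cross3_cross3 dot3_mv)
  qed
  have "cross3 (mv ?M L) (pw 2 L) = (0,0,0) \<longleftrightarrow>
     (\<forall>p. p \<noteq> (0, 0, 0) \<and> dot3 L p = 0 \<and> evalF F p = 0 \<longrightarrow> cross3 (gradF F p) L = (0, 0, 0))"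
    (is "?l \<longleftrightarrow> ?r") if L: "normalized_line L" for L
  proof
    assume ?l
    moreover have "pw 2 L \<noteq> (0,0,0)" using normalized_line_nonzero[OF L] by (cases L) auto
    ultimately obtain s where s: "mv ?M L = vscale s (pw 2 L)" using cross3_zero_iff by blast
    have "dot3 (pw 2 p) (mv ?M L) = 0" if "dot3 L p = 0" for p
    proof -
      have "dot3 (pw 2 p) (mv ?M L) = s * dot3 (pw 2 L) (pw 2 p)"
        unfolding s by (cases p; cases L) (simp add: algebra_simps)
      thus ?thesis using that by (simp add: dot3_pw2[OF c2])
    qed
    thus ?r by (auto simp: grad)
  next
    assume r: ?r
    obtain u v where uv: "cross3 u v = L" "dot3 L u = 0" "dot3 L v = 0" using normalized_line_span[OF c2 L] .
    obtain u1 u2 u3 v1 v2 v3 where u: "u = (u1,u2,u3)" and v: "v = (v1,v2,v3)" by (metis prod_cases3)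
    \<comment> \<open>The first two coordinates parametrise the line, so restriction to it is an
      instance of the transformation law of \<open>oddm\<close>.\<close>
    define A :: "'a alg_closure mat3" where "A = ((u1,v1,0),(u2,v2,0),(u3,v3,0))"
    define h3 where "h3 = dot3 (pw 2 u) (mv ?M L)"
    define h1 where "h1 = dot3 (pw 2 v) (mv ?M L)"
    have mvA: "mv A (s,t,0) = vadd (vscale s u) (vscale t v)" for s t by (simp add: A_def u v algebra_simps)
    obtain c where c: "\<And>x. qf (to_ac \<circ> F) (mv A x) = qf c x"
        and cM: "oddm c = mm (mm (transp (mpw 2 A)) ?M) (cof A)"
      using quartic_with_comp[OF c2, of "to_ac \<circ> F" A] unfolding quartic_with_def by metis
    have "snd (snd (fst (oddm c))) = h3 \<and> snd (snd (fst (snd (oddm c)))) = h1"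
      unfolding cM h3_def h1_def uv(1)[symmetric]
      by (cases "?M" rule: mat3_cases) (simp add: A_def u v algebra_simps)
    hence c3: "c (3,1,0) = h3" "c (1,3,0) = h1" by (simp_all add: oddm_def)
    have "h3 = 0 \<and> h1 = 0"
    proof (rule binary_quartic_all_roots_double[OF c2])
      fix s t assume st: "(s,t) \<noteq> (0,0)"
        and z: "c (4,0,0)*s^4 + h3*s^3*t + c (2,2,0)*s^2*t^2 + h1*s*t^3 + c (0,4,0)*t^4 = 0"
      let ?p = "mv A (s,t,0)"
      have "evalF F ?p = 0" using z by (simp add: evalF_qf c c3[unfolded One_nat_def] algebra_simps)
      moreover have "dot3 L ?p = 0"
        unfolding mvA dot3_linear using uv(2,3) by simp
      moreover have "?p \<noteq> (0,0,0)"
      proof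
        assume 0: "?p = (0,0,0)"
        \<comment> \<open>Crossing s u + t v with u and v recovers t and s as multiples of
          \<open>L\<close>, so a nonzero pair gives a nonzero point.\<close>
        have "vscale t L = cross3 (vadd (vscale s u) (vscale t v)) (vscale (-1) u)"
          "vscale s L = cross3 (vadd (vscale s u) (vscale t v)) v"
          unfolding uv(1)[symmetric] by (simp_all add: u v algebra_simps)
        hence "vscale t L = (0,0,0)" "vscale s L = (0,0,0)" using 0 unfolding mvA by (simp_all add: u v)
        thus False using st normalized_line_nonzero[OF L] by (simp add: vscale_eq_0_iff)
      qed
      ultimately have "vscale (dot3 (pw 2 ?p) (mv ?M L)) ?p = (0,0,0)" "?p \<noteq> (0,0,0)" using r grad by metis+
      hence "dot3 (pw 2 ?p) (mv ?M L) = 0" by (simp add: vscale_eq_0_iff)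
      moreover have "dot3 (vadd (vscale a x) (vscale b y)) w = a * dot3 x w + b * dot3 y w" for a b x y and w :: "'a alg_closure pt"
        by (cases x; cases y; cases w) (simp add: algebra_simps)
      ultimately show "h3*s^2 + h1*t^2 = 0"
        unfolding mvA by (simp add: pw2_linear[OF c2] h3_def h1_def algebra_simps)
    qed
    hence 0: "dot3 (pw 2 u) (mv ?M L) = 0" "dot3 (pw 2 v) (mv ?M L) = 0" by (simp_all add: h3_def h1_def)
    \<comment> \<open>A vector orthogonal to the squares of u and v is parallel to their cross
      product, which is the square of \<open>cross3 u v = L\<close>.\<close>
    have triple: "cross3 w (cross3 x y) = vadd (vscale (dot3 y w) x) (vscale (- dot3 x w) y)" for w x y :: "'a alg_closure pt"
      by (cases w; cases x; cases y) (simp add: algebra_simps)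
    have "cross3 (mv ?M L) (cross3 (pw 2 u) (pw 2 v)) = (0,0,0)" unfolding triple 0 by (simp add: u v)
    thus ?l using uv(1) by (simp add: cross3_pw2[OF c2])
  qed
  thus ?thesis unfolding bitangents_def by blast
qed

subsection \<open>The normal form\<close>

text \<open>One notion for the powers x^q, the inclusion \<open>eb\<close> of F_2 and
  \<open>to_ac\<close>: matrix identities pass through all of them entrywise.\<close>

definition ring_map :: "('b::comm_ring_1 \<Rightarrow> 'c::comm_ring_1) \<Rightarrow> bool" where
  "ring_map f \<longleftrightarrow> (\<forall>x y. f (x + y) = f x + f y \<and> f (x * y) = f x * f y \<and> f (x - y) = f x - f y)"

lemma ring_mapD: "ring_map f \<Longrightarrow> f (x + y) = f x + f y" "ring_map f \<Longrightarrow> f (x * y) = f x * f y"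
  "ring_map f \<Longrightarrow> f (x - y) = f x - f y" "ring_map f \<Longrightarrow> f 0 = 0"
  by (auto simp: ring_map_def) (metis diff_self)

lemma pmap_mv: "ring_map f \<Longrightarrow> pmap f (mv A v) = mv (mmap f A) (pmap f v)"
  by (cases A rule: mat3_cases; cases v) (simp add: ring_mapD)

lemma mmap_mm: "ring_map f \<Longrightarrow> mmap f (mm A B) = mm (mmap f A) (mmap f B)"
  by (cases A rule: mat3_cases; cases B rule: mat3_cases) (simp add: ring_mapD)

lemma mdet_mmap: "ring_map f \<Longrightarrow> mdet (mmap f A) = f (mdet A)"
  by (cases A rule: mat3_cases) (simp add: ring_mapD)

lemma cof_mmap: "ring_map f \<Longrightarrow> cof (mmap f A) = mmap f (cof A)"
  by (cases A rule: mat3_cases) (simp add: ring_mapD)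

lemma mmap_transp: "mmap f (transp A) = transp (mmap f A)"
  by (cases A rule: mat3_cases) simp

lemma pmap_vscale: "ring_map f \<Longrightarrow> pmap f (vscale s v) = vscale (f s) (pmap f v)"
  by (cases v) (simp add: ring_mapD)

lemma mmap_mscale: "ring_map f \<Longrightarrow> mmap f (mscale s A) = mscale (f s) (mmap f A)"
  by (cases A) (simp add: pmap_vscale ring_mapD)

lemma mmap_mI: "f 0 = 0 \<Longrightarrow> f 1 = 1 \<Longrightarrow> mmap f mI = mI" by (simp add: mI_def)

lemma ring_map_power2: assumes "(2::'b::field) = 0" shows "ring_map (\<lambda>x::'b. x ^ (2^n))"
  unfolding ring_map_def by (simp add: char2_power_add[OF assms] power_mult_distrib char2_diff[OF assms])

lemma ring_map_sq: assumes "(2::'b::field) = 0" shows "ring_map (\<lambda>x::'b. x ^ 2)"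
  using ring_map_power2[OF assms, of 1] by simp

section \<open>The inclusion of F_2 and the points of the Fano plane\<close>

definition eb :: "bit \<Rightarrow> 'b::field" where "eb b = (if b = 0 then 0 else 1)"

lemma eb_simps [simp]: "eb 0 = 0" "eb 1 = 1" by (simp_all add: eb_def)

lemma eb_eq_iff [simp]: "eb x = eb y \<longleftrightarrow> x = y" by (cases x; cases y) auto
lemma eb_eq_0_iff [simp]: "eb x = 0 \<longleftrightarrow> x = 0" by (cases x) auto

lemma eb_power [simp]: "n > 0 \<Longrightarrow> eb x ^ n = eb x" by (cases x) auto

lemma ring_map_eb: assumes c2: "(2::'b::field) = 0" shows "ring_map (eb :: bit \<Rightarrow> 'b)"
proof -
  have "(1::'b) + 1 = 0" using c2 by simp
  hence "eb (x + y) = (eb x + eb y :: 'b) \<and> eb (x * y) = (eb x * eb y :: 'b) \<and> eb (x - y) = (eb x - eb y :: 'b)" for x y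
    by (cases x; cases y) (auto simp: char2_minus[OF c2])
  thus ?thesis unfolding ring_map_def by blast
qed

abbreviation bv :: "bit pt \<Rightarrow> 'b::field pt" where "bv \<equiv> pmap eb"
abbreviation bm :: "bit mat3 \<Rightarrow> 'b::field mat3" where "bm \<equiv> mmap eb"

lemma bv_eq_iff [simp]: "bv u = (bv v :: 'b::field pt) \<longleftrightarrow> u = v"
  by (cases u; cases v) auto
lemma bv_eq_0_iff [simp]: "bv u = ((0,0,0) :: 'b::field pt) \<longleftrightarrow> u = (0,0,0)"
  by (cases u) auto
lemma bm_eq_iff [simp]: "bm u = (bm v :: 'b::field mat3) \<longleftrightarrow> u = v"
  by (cases u rule: mat3_cases; cases v rule: mat3_cases) simp

lemma pw_bv [simp]: "n > 0 \<Longrightarrow> pw n (bv v) = bv v" by (cases v) simp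
lemma mpw_bm [simp]: "n > 0 \<Longrightarrow> mpw n (bm g) = bm g" by (cases g) simp

definition npts :: "bit pt list" where
  "npts = [(1,0,0),(0,1,0),(0,0,1),(1,1,0),(1,0,1),(0,1,1),(1,1,1)]"

lemma set_npts: "set npts = {v. v \<noteq> (0,0,0)}"
proof -
  have "v \<in> set npts \<longleftrightarrow> v \<noteq> (0,0,0)" for v
  proof (cases v)
    case (fields a b c)
    show ?thesis unfolding fields by (cases a; cases b; cases c; simp add: npts_def)
  qed
  thus ?thesis by blast
qed

lemma finite_bit_pt: "finite (UNIV :: bit pt set)"
proof -
  have "(UNIV :: bit pt set) = insert (0,0,0) (set npts)" by (auto simp: set_npts)
  thus ?thesis by (metis finite_insert finite_set)
qed

lemma sum_npts: "sum f (set npts) = f (1,0,0) + f (0,1,0) + f (0,0,1) + f (1,1,0) + f (1,0,1) + f (0,1,1) + f (1,1,1)"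
  by (simp add: npts_def add.assoc)

text \<open>The quartic \<open>Q\<^sup>2 + xyz(x + y + z)\<close> taking the value \<open>w v\<close> at each point \<open>v\<close> of the Fano plane. Only six
  values enter; the seventh is right because they sum to \<open>1\<close>.\<close>

definition nfc :: "(bit pt \<Rightarrow> 'b::field) \<Rightarrow> nat \<times> nat \<times> nat \<Rightarrow> 'b" where
  "nfc w = (\<lambda>_. 0)((4,0,0) := w (1,0,0), (0,4,0) := w (0,1,0), (0,0,4) := w (0,0,1),
     (2,2,0) := w (1,1,0) + w (1,0,0) + w (0,1,0), (2,0,2) := w (1,0,1) + w (1,0,0) + w (0,0,1),
     (0,2,2) := w (0,1,1) + w (0,1,0) + w (0,0,1), (2,1,1) := 1, (1,2,1) := 1, (1,1,2) := 1)"

lemma oddm_nfc [simp]: "oddm (nfc w) = mI"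
  by (simp add: oddm_def nfc_def mI_def)

text \<open>The value 0 at the zero vector makes \<open>qf (nfc w) (bv v) = w v\<close> true for
  every v, so that weights can be composed with matrices freely.\<close>

definition weight :: "(bit pt \<Rightarrow> 'b::field) \<Rightarrow> bool" where
  "weight w \<longleftrightarrow> w (0,0,0) = 0 \<and> sum w (set npts) = 1"

text \<open>Nonvanishing at the seven points encodes nonsingularity: these are the projective points
  at which the gradient of the normal form is zero.\<close>

definition admissible :: "(bit pt \<Rightarrow> 'b::field) \<Rightarrow> bool" where
  "admissible w \<longleftrightarrow> weight w \<and> (\<forall>v. v \<noteq> (0,0,0) \<longrightarrow> w v \<noteq> 0)"

lemma qf_nfc_bv:
  assumes c2: "(2::'b::field) = 0" and w: "weight (w :: bit pt \<Rightarrow> 'b)"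
  shows "qf (nfc w) (bv v) = w v"
proof -
  have [simp]: "x + (x + y) = y" "x + x = 0" for x y :: 'b
    using char2_add_self[OF c2, of x] by (simp_all flip: add.assoc)
  define S where "S = w (1,0,0) + w (0,1,0) + w (0,0,1) + w (1,1,0) + w (1,0,1) + w (0,1,1)"
  have w0: "w (0,0,0) = 0" and S: "S + w (1,1,1) = 1"
    using w by (simp_all add: weight_def sum_npts S_def)
  have "S + (S + w (1,1,1)) = w (1,1,1)" by simp
  hence w7: "w (1,1,1) = w (1,0,0) + w (0,1,0) + w (0,0,1) + w (1,1,0) + w (1,0,1) + w (0,1,1) + 1"
    unfolding S by (simp add: S_def)
  obtain a b c where v: "v = (a,b,c)" by (metis prod_cases3)
  have 3: "(1::'b) + 1 + 1 = 1" by simp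
  show ?thesis unfolding v
    by (cases a; cases b; cases c) (simp_all add: nfc_def w0 w7 add_ac 3)
qed

text \<open>Each of the six square monomials equals 1 at an even number of Fano points (four or
  two), while the three mixed monomials are nonzero at (1,1,1) only. Hence the seven values sum to 3
  = 1, and six of them give back the even coefficients.\<close>

lemma nfc_of_odd:
  fixes c :: "_ \<Rightarrow> 'b::field"
  assumes c2: "(2::'b) = 0" and c: "oddm c = mI"
  defines "w \<equiv> (\<lambda>v. qf c (bv v))"
  shows "weight w" and "qf (nfc w) x = qf c x"
proof -
  have [simp]: "x + (x + y) = y" "x + x = 0" for x y :: 'b
    using char2_add_self[OF c2, of x] by (simp_all flip: add.assoc)
  have [simp]: "c (2,Suc 0,Suc 0) = 1" "c (Suc 0,2,Suc 0) = 1" "c (Suc 0,Suc 0,2) = 1" "c (3,Suc 0,0) = 0" "c (3,0,Suc 0) = 0" "c (Suc 0,3,0) = 0"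
     "c (0,3,Suc 0) = 0" "c (0,Suc 0,3) = 0" "c (Suc 0,0,3) = 0"
    using c by (simp_all add: oddm_def mI_def)
  show "weight w" by (simp add: weight_def w_def sum_npts add_ac)
  show "qf (nfc w) x = qf c x"
    by (cases x) (simp add: nfc_def w_def add_ac)
qed

text \<open>Multiplying by the transpose of \<open>A\<close> turns the equation into det(A) A^(2) =
  A. Determinants then give d^5 = d, so d^4 = 1 and d = 1, fourth powers being injective in
  characteristic 2; all entries are now idempotent.\<close>

lemma fixed_matrix:
  fixes A :: "'b::field mat3"
  assumes c2: "(2::'b) = 0" and h: "mm (transp (mpw 2 A)) (cof A) = mI"
  obtains g where "A = bm g" "mdet g = 1"
proof -
  have "mm (mm (transp (mpw 2 A)) (cof A)) (transp A) = transp A" unfolding h by simp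
  hence "mscale (mdet A) (transp (mpw 2 A)) = transp A"
    by (simp add: mm_assoc mm_cof_transp mscale_mm)
  hence e: "mscale (mdet A) (mpw 2 A) = A" by (metis transp_mscale transp_transp)
  have d0: "mdet A \<noteq> 0"
  proof
    assume "mdet A = 0"
    hence "mdet (mm (transp (mpw 2 A)) (cof A)) = 0" by (simp add: mdet_mm mdet_cof)
    thus False unfolding h by simp
  qed
  have "mdet A ^ 3 * mdet A ^ 2 = mdet A"
    using arg_cong[OF e, of mdet] by (simp add: mdet_mscale mdet_mmap[OF ring_map_sq[OF c2]])
  hence "mdet A * mdet A ^ 4 = mdet A * 1" by (simp add: eval_nat_numeral algebra_simps)
  hence "mdet A ^ (2^2) = 1 ^ (2^2)" using d0 by simp
  hence d1: "mdet A = 1" by (rule char2_power_inj[OF c2])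
  hence e2: "mpw 2 A = A" using e by simp
  have bit: "eb (if x = 0 then 0 else 1) = x" if "x ^ 2 = x" for x :: 'b
    using that by (auto simp: power2_eq_square)
  define g :: "bit mat3" where "g = mmap (\<lambda>x. if x = 0 then 0 else 1) A"
  have "A = bm g" using e2 unfolding g_def by (cases A rule: mat3_cases) (simp add: bit)
  moreover have "eb (mdet g) = (1::'b)" using d1 calculation mdet_mmap[OF ring_map_eb[OF c2], of g] by simp
  ultimately show ?thesis using that by (metis eb_eq_iff eb_simps(2))
qed

text \<open>A substitution between two normal forms preserves the identity as odd part, so
  \<open>fixed_matrix\<close> applies; the values at the F_2-points then show its effect on
  weights.\<close>

lemma nfc_transform:
  fixes w :: "bit pt \<Rightarrow> 'b::alg_closed_field"
  assumes c2: "(2::'b) = 0" and w: "weight w" "weight w'"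
    and e: "\<And>x. qf (nfc w') x = qf (nfc w) (mv A x)"
  obtains g where "A = bm g" "mdet g = 1" "w' = w \<circ> mv g"
proof -
  obtain c where c: "\<And>x. qf (nfc w) (mv A x) = qf c x"
        and cM: "oddm c = mm (mm (transp (mpw 2 A)) mI) (cof A)"
      using quartic_with_comp[OF c2, of "nfc w" A] unfolding quartic_with_def by (metis oddm_nfc)
  have "oddm c = oddm (nfc w')" by (rule oddm_unique[OF infinite_char2[OF c2]]) (simp add: e c)
  hence "mm (transp (mpw 2 A)) (cof A) = mI" using cM by simp
  then obtain g where g: "A = bm g" "mdet g = 1" using fixed_matrix[OF c2] by blast
  have "w' v = w (mv g v)" for v
    using e[of "bv v"] by (simp add: g qf_nfc_bv[OF c2] w flip: pmap_mv[OF ring_map_eb[OF c2]])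
  thus ?thesis using that g by (simp add: fun_eq_iff)
qed

lemma nfc_transform_conv:
  fixes w :: "bit pt \<Rightarrow> 'b::field"
  assumes c2: "(2::'b) = 0" and w: "weight w" and g: "mdet g = 1"
  shows "weight (w \<circ> mv g)" "qf (nfc w) (mv (bm g) x) = qf (nfc (w \<circ> mv g)) x"
proof -
  obtain c where c: "\<And>x. qf (nfc w) (mv (bm g) x) = qf c x"
        and cM: "oddm c = mm (mm (transp (mpw 2 (bm g))) mI) (cof (bm g))"
      using quartic_with_comp[OF c2, of "nfc w" "bm g"] unfolding quartic_with_def by (metis oddm_nfc)
  have "oddm c = mI" unfolding cM using g
    by (simp add: mm_transp_cof mdet_mmap[OF ring_map_eb[OF c2]])
  moreover have "(\<lambda>v. qf c (bv v)) = w \<circ> mv g"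
    by (rule ext) (simp add: qf_nfc_bv[OF c2 w] flip: c pmap_mv[OF ring_map_eb[OF c2]])
  ultimately show "weight (w \<circ> mv g)" "qf (nfc w) (mv (bm g) x) = qf (nfc (w \<circ> mv g)) x"
    using nfc_of_odd[OF c2, of c] c by simp_all
qed

lemma bit_mv_eq_0: "mdet g = 1 \<Longrightarrow> mv g v = (0,0,0) \<longleftrightarrow> v = (0,0,0)" for g :: "bit mat3"
  by (rule mv_eq_0_iff) simp

lemma admissible_comp:
  assumes c2: "(2::'b::field) = 0" and w: "admissible (w :: _ \<Rightarrow> 'b)" and g: "mdet g = 1"
  shows "admissible (w \<circ> mv g)"
  using w nfc_transform_conv(1)[OF c2 _ g, of w] bit_mv_eq_0[OF g]
  unfolding admissible_def comp_def by metis

text \<open>Parallelism with the square gives x z^2 = z x^2 for any two coordinates, so all nonzero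
  coordinates are equal.\<close>

lemma cross3_pw2_self:
  fixes y :: "'b::field pt"
  assumes "y \<noteq> (0,0,0)" "cross3 y (pw 2 y) = (0,0,0)"
  obtains s e where "s \<noteq> 0" "e \<noteq> (0,0,0)" "y = vscale s (bv e)"
proof -
  obtain a b c where y: "y = (a,b,c)" by (metis prod_cases3)
  have *: "x = 0 \<or> z = 0 \<or> x = z" if "x * z ^ 2 = z * x ^ 2" for x z :: 'b
    using that by (auto simp: power2_eq_square)
  have h: "a = 0 \<or> b = 0 \<or> a = b" "b = 0 \<or> c = 0 \<or> b = c" "a = 0 \<or> c = 0 \<or> a = c"
    using assms(2) by (auto simp: y intro!: *)
  define i :: "'b \<Rightarrow> bit" where "i = (\<lambda>x. if x = 0 then 0 else 1)"
  have i: "t = s * eb (i t)" if "t = 0 \<or> t = s" for s t using that by (auto simp: i_def)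
  consider "a \<noteq> 0" | "a = 0" "b \<noteq> 0" | "a = 0" "b = 0" "c \<noteq> 0" using assms(1) y by auto
  thus ?thesis
  proof cases
    case 1
    have "b = a * eb (i b)" "c = a * eb (i c)" using i h 1 by metis+
    thus ?thesis using 1 by (intro that[of a "(1, i b, i c)"]) (simp_all add: y)
  next
    case 2
    have "c = b * eb (i c)" using i h 2 by metis
    thus ?thesis using 2 by (intro that[of b "(0, 1, i c)"]) (simp_all add: y)
  next
    case 3 show ?thesis by (rule that[of c "(0, 0, 1)"]) (use 3 in \<open>simp_all add: y\<close>)
  qed
qed

lemma cross3_bv_self: "cross3 (bv e) (pw 2 (bv e)) = ((0,0,0) :: 'b::field pt)"
  by (cases e) (simp add: algebra_simps)

lemma bv_proportional: assumes "vscale s (bv e) = (bv e' :: 'b::field pt)" "e' \<noteq> (0,0,0)"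
  shows "e = e'"
proof -
  obtain a b c a' b' c' where e: "e = (a,b,c)" "e' = (a',b',c')" by (metis prod_cases3)
  have "s \<noteq> 0" using assms by (auto simp: e)
  moreover have "s * eb a = (eb a' :: 'b)" "s * eb b = (eb b' :: 'b)" "s * eb c = (eb c' :: 'b)"
    using assms(1) by (simp_all add: e)
  ultimately have *: "a = 0 \<longleftrightarrow> a' = 0" "b = 0 \<longleftrightarrow> b' = 0" "c = 0 \<longleftrightarrow> c' = 0"
    by (metis eb_eq_0_iff mult_eq_0_iff)+
  have eq: "x = y" if "x = 0 \<longleftrightarrow> y = 0" for x y :: bit using that by (cases x; cases y) simp_all
  show ?thesis unfolding e eq[OF *(1)] eq[OF *(2)] eq[OF *(3)] ..
qed

section \<open>Normalized representatives, and the gradient and tangency conditions in a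
  frame\<close>

fun nrm :: "'b::field pt \<Rightarrow> 'b pt" where
  "nrm (a,b,c) = vscale (inverse (if a \<noteq> 0 then a else if b \<noteq> 0 then b else c)) (a,b,c)"

lemma nrm_normalized: "v \<noteq> (0,0,0) \<Longrightarrow> normalized_line (nrm v)"
  by (cases v) (auto simp: normalized_line_def)

lemma nrm_scale: "v \<noteq> (0,0,0) \<Longrightarrow> \<exists>s. s \<noteq> 0 \<and> nrm v = vscale s v"
  by (cases v) (auto intro!: exI[of _ "inverse _"])

lemma nrm_vscale: "s \<noteq> 0 \<Longrightarrow> nrm (vscale s v) = nrm v"
  by (cases v) (auto simp: field_simps)

lemma nrm_of_normalized: "normalized_line L \<Longrightarrow> nrm L = L"
  by (cases L) (auto simp: normalized_line_def)

declare split_paired_All [simp del] split_paired_Ex [simp del] qf.simps [simp del]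

lemma qf_vscale: "qf c (vscale s x) = s^4 * qf c x"
  by (cases x) (simp add: qf.simps algebra_simps eval_nat_numeral)

lemma cof_cof: "cof (cof A) = mscale (mdet A) A"
  by (cases A rule: mat3_cases) (simp add: algebra_simps)

lemma cross3_self [simp]: "cross3 u u = (0,0,0)" by (cases u) (simp add: algebra_simps)

lemma mm_columns: "mm A (transp (u,v,w)) = transp (mv A u, mv A v, mv A w)"
  by (cases A rule: mat3_cases; cases u; cases v; cases w) simp

lemma pw2_vscale: "pw 2 (vscale s v) = vscale (s^2) (pw 2 v)"
  by (cases v) (simp add: power_mult_distrib)

lemma pw_eq_0_iff: "n > 0 \<Longrightarrow> pw n v = (0,0,0) \<longleftrightarrow> v = (0,0,0)" for v :: "'b::idom pt"
  by (cases v) simp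

lemma cross3_zero_swap: "cross3 u v = (0,0,0) \<longleftrightarrow> cross3 v u = (0,0,0)"
  by (cases u; cases v) (auto simp: algebra_simps)

text \<open>Applying the adjugate \<open>C\<close> of \<open>B\<close> to both factors of the cross
  product in \<open>gradF_eq\<close> turns them into x^(2) and a multiple of x.\<close>

lemma gradF_frame:
  fixes F :: "_ \<Rightarrow> 'a::{finite,field}"
  assumes c2: "(2::'a alg_closure) = 0"
    and B: "mdet B \<noteq> 0" "mm (mm (transp (mpw 2 B)) (oddm (to_ac \<circ> F))) (cof B) = mI"
  shows "gradF F (mv B x) = (0,0,0) \<longleftrightarrow> cross3 x (pw 2 x) = (0,0,0)"
proof -
  let ?M = "oddm (to_ac \<circ> F)"
  define C where "C = transp (cof B)"
  have dC: "mdet (cof C) \<noteq> 0" using B(1) by (simp add: C_def mdet_cof)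
  have "mm C (mm (transp ?M) (mpw 2 B)) = mI"
    using arg_cong[OF B(2), of transp] by (simp add: transp_mm C_def)
  hence 1: "mv C (mv (transp ?M) (pw 2 (mv B x))) = pw 2 x"
    by (simp add: pmap_mv[OF ring_map_sq[OF c2]] flip: mv_mm)
  have "mm C B = mscale (mdet B) mI"
    using arg_cong[OF mm_transp_cof[of B], of transp] by (simp add: transp_mm C_def transp_mscale)
  hence 2: "mv C (mv B x) = vscale (mdet B) x" by (simp add: mv_mscale flip: mv_mm)
  have "gradF F (mv B x) = (0,0,0) \<longleftrightarrow> mv (cof C) (gradF F (mv B x)) = (0,0,0)"
    by (simp add: mv_eq_0_iff[OF dC])
  also have "mv (cof C) (gradF F (mv B x)) = vscale (mdet B) (cross3 (pw 2 x) x)"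
    by (simp add: gradF_eq[OF c2] cross3_mv[symmetric] 1 2 cross3_vscale)
  finally show ?thesis using B(1) by (simp add: vscale_eq_0_iff cross3_zero_swap[of x])
qed

text \<open>Lines move by \<open>cof B\<close>. The hypothesis says that
  \<open>transp (mpw 2 B)\<close> takes the image under \<open>M\<close> of the moved line back to
  y, while the cofactor identity makes it take the square of the moved line to a multiple of
  y^(2).\<close>

lemma line_frame:
  fixes M :: "'b::field mat3"
  assumes c2: "(2::'b) = 0" and B: "mdet B \<noteq> 0" "mm (mm (transp (mpw 2 B)) M) (cof B) = mI"
  shows "cross3 (mv M (mv (cof B) y)) (pw 2 (mv (cof B) y)) = (0,0,0) \<longleftrightarrow> cross3 y (pw 2 y) = (0,0,0)"
proof -
  note sq = ring_map_sq[OF c2]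
  define C where "C = transp (mpw 2 B)"
  have dC: "mdet (cof C) \<noteq> 0" using B(1) by (simp add: C_def mdet_cof mdet_mmap[OF sq])
  have 1: "mv C (mv M (mv (cof B) y)) = y" using B(2) by (simp add: C_def flip: mv_mm mm_assoc)
  have "mm C (mpw 2 (cof B)) = mscale (mdet B ^ 2) mI"
    using mm_transp_cof[of "mpw 2 B"] by (simp add: C_def cof_mmap[OF sq] mdet_mmap[OF sq])
  hence 2: "mv C (pw 2 (mv (cof B) y)) = vscale (mdet B ^ 2) (pw 2 y)"
    by (simp add: pmap_mv[OF sq] mv_mscale flip: mv_mm)
  have "cross3 (mv M (mv (cof B) y)) (pw 2 (mv (cof B) y)) = (0,0,0) \<longleftrightarrow>
    mv (cof C) (cross3 (mv M (mv (cof B) y)) (pw 2 (mv (cof B) y))) = (0,0,0)"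
    by (simp add: mv_eq_0_iff[OF dC])
  also have "mv (cof C) (cross3 (mv M (mv (cof B) y)) (pw 2 (mv (cof B) y))) = vscale (mdet B ^ 2) (cross3 y (pw 2 y))"
    by (simp add: cross3_mv[symmetric] 1 2 cross3_vscale)
  finally show ?thesis using B(1) by (simp add: vscale_eq_0_iff)
qed

subsection \<open>Frames of ordinary quartics\<close>

definition framed :: "'a::field quartic \<Rightarrow> 'a alg_closure mat3 \<Rightarrow> (bit pt \<Rightarrow> 'a alg_closure) \<Rightarrow> bool" where
  "framed F B w \<longleftrightarrow> mdet B \<noteq> 0 \<and> admissible w \<and> (\<forall>x. evalF F (mv B x) = qf (nfc w) x)"

lemma framedD:
  assumes "framed F B w"
  shows "mdet B \<noteq> 0" "admissible w" "evalF F (mv B x) = qf (nfc w) x"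
  using assms unfolding framed_def by blast+

lemma framed_oddm:
  assumes c2: "(2::'a::field alg_closure) = 0" and f: "framed (F :: _ \<Rightarrow> 'a) B w"
  shows "mm (mm (transp (mpw 2 B)) (oddm (to_ac \<circ> F))) (cof B) = mI"
proof -
  obtain c where c: "\<And>x. qf (to_ac \<circ> F) (mv B x) = qf c x"
     and cM: "oddm c = mm (mm (transp (mpw 2 B)) (oddm (to_ac \<circ> F))) (cof B)"
    using quartic_with_comp[OF c2, of "to_ac \<circ> F" B] unfolding quartic_with_def by metis
  have "oddm c = oddm (nfc w)"
    by (rule oddm_unique[OF infinite_char2[OF c2]]) (use framedD(3)[OF f] in \<open>simp add: evalF_qf flip: c\<close>)
  thus ?thesis using cM by simp
qed

text \<open>The bitangents of the normal form are the seven F_2-lines e; \<open>cof B\<close>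
  carries them to the original coordinates and \<open>nrm\<close> selects the representative that
  occurs in \<open>bitangents\<close>.\<close>

definition bline :: "'b::field mat3 \<Rightarrow> bit pt \<Rightarrow> 'b pt" where
  "bline B e = nrm (mv (cof B) (bv e))"

lemma bline_inj:
  assumes B: "mdet (B :: 'b::field mat3) \<noteq> 0" and e: "e \<noteq> (0,0,0)" "e' \<noteq> (0,0,0)" and eq: "bline B e = bline B e'"
  shows "e = e'"
proof -
  have dC: "mdet (cof B) \<noteq> 0" using B by (simp add: mdet_cof)
  have "mv (cof B) (bv e) \<noteq> (0,0,0)" "mv (cof B) (bv e') \<noteq> (0,0,0)"
    using e by (simp_all add: mv_eq_0_iff[OF dC])
  then obtain s s' where s: "s \<noteq> 0" "bline B e = vscale s (mv (cof B) (bv e))"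
    and s': "s' \<noteq> 0" "bline B e' = vscale s' (mv (cof B) (bv e'))" unfolding bline_def using nrm_scale by metis
  have "mv (cof B) (vscale s (bv e)) = mv (cof B) (vscale s' (bv e'))"
    using eq s s' by (simp add: mv_vscale)
  hence "vscale s (bv e) = vscale s' (bv e')" by (rule mv_inj[OF dC])
  hence "vscale (inverse s') (vscale s (bv e)) = (bv e' :: 'b pt)" using s'(1) by (simp del: pmap.simps)
  thus ?thesis using bv_proportional e by (metis vscale_vscale)
qed

lemma framed_bitangents:
  fixes F :: "_ \<Rightarrow> 'a::{finite,field}"
  assumes hq: "\<exists>n. CARD('a) = 2 ^ n" and f: "framed F B w"
  shows "bitangents F = bline B ` set npts"
proof -
  note c2 = two_eq_0[OF hq]
  have B: "mdet B \<noteq> 0" by (rule framedD(1)[OF f])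
  hence dC: "mdet (cof B) \<noteq> 0" by (simp add: mdet_cof)
  note lf = line_frame[OF c2 B framed_oddm[OF c2 f]]
  show ?thesis
  proof (intro equalityI subsetI)
    fix L assume "L \<in> bitangents F"
    hence L: "normalized_line L" "cross3 (mv (oddm (to_ac \<circ> F)) L) (pw 2 L) = (0,0,0)" by (simp_all add: bitangents_eq[OF hq])
    define y where "y = mv (minv (cof B)) L"
    have y: "L = mv (cof B) y" by (simp add: y_def mv_minv dC)
    have "y \<noteq> (0,0,0)" using y normalized_line_nonzero[OF L(1)] by auto
    moreover have "cross3 y (pw 2 y) = (0,0,0)" using L(2) lf by (simp add: y)
    ultimately obtain s e where se: "s \<noteq> 0" "e \<noteq> (0,0,0)" "y = vscale s (bv e)" by (rule cross3_pw2_self)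
    have "L = nrm L" using L(1) by (simp add: nrm_of_normalized)
    also have "\<dots> = bline B e" by (simp add: y se mv_vscale nrm_vscale bline_def)
    finally show "L \<in> bline B ` set npts" using se by (simp add: set_npts)
  next
    fix L assume "L \<in> bline B ` set npts"
    then obtain e where e: "e \<noteq> (0,0,0)" "L = bline B e" by (auto simp: set_npts)
    have nz: "mv (cof B) (bv e) \<noteq> (0,0,0)" using e(1) by (simp add: mv_eq_0_iff[OF dC])
    then obtain s where s: "s \<noteq> 0" "L = vscale s (mv (cof B) (bv e))" unfolding e(2) bline_def using nrm_scale by metis
    have "cross3 (mv (oddm (to_ac \<circ> F)) (mv (cof B) (bv e))) (pw 2 (mv (cof B) (bv e))) = (0,0,0)"
      unfolding lf by (rule cross3_bv_self)
    hence "cross3 (mv (oddm (to_ac \<circ> F)) L) (pw 2 L) = (0,0,0)"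
      by (simp add: s mv_vscale cross3_vscale pw2_vscale vscale_eq_0_iff)
    moreover have "normalized_line L" unfolding e(2) bline_def by (rule nrm_normalized[OF nz])
    ultimately show "L \<in> bitangents F" by (simp add: bitangents_eq[OF hq])
  qed
qed

lemma framed_ordinary:
  fixes F :: "_ \<Rightarrow> 'a::{finite,field}"
  assumes hq: "\<exists>n. CARD('a) = 2 ^ n" and f: "framed F B w" and qF: "is_quartic_form F"
  shows "F \<in> ordinary_quartics"
proof -
  note c2 = two_eq_0[OF hq]
  have B: "mdet B \<noteq> 0" and w: "admissible w" and e: "\<And>x. evalF F (mv B x) = qf (nfc w) x" by (rule framedD[OF f])+
  have "card (bitangents F) = card (set npts)"
    unfolding framed_bitangents[OF hq f]
    by (intro card_image inj_onI) (metis (mono_tags, lifting) bline_inj[OF B] mem_Collect_eq set_npts)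
  hence "card (bitangents F) = 7" by (simp add: npts_def)
  moreover have "evalF F p \<noteq> 0" if "p \<noteq> (0,0,0)" "gradF F p = (0,0,0)" for p
  proof -
    define x where "x = mv (minv B) p"
    have p: "p = mv B x" by (simp add: x_def mv_minv B)
    have "cross3 x (pw 2 x) = (0,0,0)" using that(2) gradF_frame[OF c2 B framed_oddm[OF c2 f]] by (simp add: p)
    moreover have "x \<noteq> (0,0,0)" using that(1) p by auto
    ultimately obtain s e' where se: "s \<noteq> 0" "e' \<noteq> (0,0,0)" "x = vscale s (bv e')" using cross3_pw2_self by blast
    have "evalF F p = s^4 * w e'" using w by (simp add: p e se qf_vscale qf_nfc_bv[OF c2] admissible_def)
    thus ?thesis using se w by (auto simp: admissible_def)
  qed
  ultimately show ?thesis using qF unfolding ordinary_quartics_def nonsingular_quartic_def by blast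
qed

text \<open>A one-dimensional kernel of \<open>M\<close> contributes a single line and a larger one infinitely many, so at least
  six of the seven lines come from solutions of \<open>M l = l\<^sup>(\<^sup>2\<^sup>)\<close>, and solutions that are independent over \<open>\<bbbF>\<^sub>2\<close> are
  independent over the field.\<close>

lemma seven_lines_basis:
  fixes M :: "'b::alg_closed_field mat3"
  assumes c2: "(2::'b) = 0"
    and card7: "card {L. normalized_line L \<and> cross3 (mv M L) (pw 2 L) = (0,0,0)} = 7"
  obtains N where "mdet N \<noteq> 0" "mm M N = mpw 2 N"
proof -
  define S where "S = {l. l \<noteq> (0,0,0) \<and> mv M l = pw 2 l}"
  define R where "R = {L. normalized_line L \<and> mv M L = (0,0,0)}"
  define T where "T = {L. normalized_line L \<and> cross3 (mv M L) (pw 2 L) = (0,0,0)}"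
  have T7: "card T = 7" using card7 unfolding T_def .
  have finT: "finite T" by (rule card_ge_0_finite) (simp add: T7)
  have 0: "cross3 (0,0,0) v = (0,0,0)" for v :: "'b pt" by (cases v) simp
  have RT: "R \<subseteq> T" unfolding R_def T_def using 0 by auto
  have TS: "T \<subseteq> nrm ` S \<union> R"
  proof
    fix L assume "L \<in> T"
    hence L: "normalized_line L" "cross3 (mv M L) (pw 2 L) = (0,0,0)" unfolding T_def by blast+
    have L0: "L \<noteq> (0,0,0)" by (rule normalized_line_nonzero[OF L(1)])
    then obtain s where s: "mv M L = vscale s (pw 2 L)" using L(2) cross3_zero_iff[of "pw 2 L"] by (auto simp: pw_eq_0_iff)
    show "L \<in> nrm ` S \<union> R"
    proof (cases "s = 0")
      case True thus ?thesis using L(1) s by (cases L) (auto simp: R_def)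
    next
      case False
      \<comment> \<open>Rescaling absorbs the factor: if M L = s L^(2), then M (s L) = s^2
        L^(2).\<close>
      have "vscale s L \<in> S" using L0 False s
        by (simp add: S_def vscale_eq_0_iff mv_vscale pw2_vscale flip: power2_eq_square)
      moreover have "nrm (vscale s L) = L" using False L(1) by (simp add: nrm_vscale nrm_of_normalized)
      ultimately show ?thesis by (metis UnI1 imageI)
    qed
  qed
  \<comment> \<open>Two different lines in the kernel would span a pencil L1 + t L2 inside it, hence
    infinitely many members of \<open>T\<close>.\<close>
  have R1: "L1 = L2" if "L1 \<in> R" "L2 \<in> R" for L1 L2
  proof (rule ccontr)
    assume ne: "L1 \<noteq> L2"
    have n: "normalized_line L1" "normalized_line L2" "mv M L1 = (0,0,0)" "mv M L2 = (0,0,0)" using that by (auto simp: R_def)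
    have c0: "cross3 L1 L2 \<noteq> (0,0,0)"
    proof
      assume "cross3 L1 L2 = (0,0,0)"
      then obtain s where "L1 = vscale s L2" using cross3_zero_iff normalized_line_nonzero[OF n(2)] by blast
      moreover from this have "s \<noteq> 0" using normalized_line_nonzero[OF n(1)] by (cases L2) auto
      ultimately show False using ne n nrm_of_normalized nrm_vscale by metis
    qed
    define f where "f t = vadd L1 (vscale t L2)" for t
    have f0: "f t \<noteq> (0,0,0)" for t
    proof
      assume "f t = (0,0,0)"
      hence "cross3 (f t) L2 = (0,0,0)" by (cases L2) simp
      moreover have "cross3 (f t) L2 = cross3 L1 L2" by (cases L1; cases L2) (simp add: f_def algebra_simps)
      ultimately show False using c0 by simp
    qed
    have inj: "inj (\<lambda>t. nrm (f t))"
    proof (rule injI)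
      fix t t' assume "nrm (f t) = nrm (f t')"
      then obtain s s' where "s \<noteq> 0" "s' \<noteq> 0" "vscale s (f t) = vscale s' (f t')" using nrm_scale f0 by metis
      hence "vscale s (cross3 (f t) (f t')) = (0,0,0)" by (metis cross3_vscale(1) cross3_self vscale_eq_0_iff)
      hence "cross3 (f t) (f t') = (0,0,0)" using \<open>s \<noteq> 0\<close> by (simp add: vscale_eq_0_iff)
      moreover have "cross3 (f t) (f t') = vscale (t' - t) (cross3 L1 L2)"
        by (cases L1; cases L2) (simp add: f_def algebra_simps)
      ultimately show "t = t'" using c0 by (simp add: vscale_eq_0_iff)
    qed
    have "nrm (f t) \<in> T" for t
    proof -
      obtain s where s: "nrm (f t) = vscale s (f t)" using nrm_scale f0 by metis
      have "mv M (f t) = (0,0,0)" using n(3,4) by (simp add: f_def mv_vadd mv_vscale)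
      hence "mv M (nrm (f t)) = (0,0,0)" by (simp add: s mv_vscale)
      thus ?thesis using nrm_normalized[OF f0] 0 unfolding T_def by simp
    qed
    hence "finite (range (\<lambda>t. nrm (f t)))" using finT by (metis finite_subset image_subsetI)
    thus False using inj infinite_char2[OF c2] finite_imageD by blast
  qed
  have "card R \<le> 1" using R1 by (metis card_le_Suc0_iff_eq One_nat_def finite_subset[OF RT finT])
  hence c6: "\<not> card (T - R) \<le> 3" using T7 card_Diff_subset[OF finite_subset[OF RT finT] RT] by simp
  \<comment> \<open>Three is the number of nonzero vectors in the F_2-span of two solutions, so
    there is a solution outside that span.\<close>
  have notsub: "\<not> S \<subseteq> {a,b,c}" for a b c
  proof
    assume "S \<subseteq> {a,b,c}"
    hence "T - R \<subseteq> nrm ` {a,b,c}" using TS by blast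
    hence "card (T - R) \<le> card (nrm ` {a,b,c})" by (intro card_mono) auto
    also have "\<dots> \<le> card {a,b,c}" by (intro card_image_le) auto
    also have "\<dots> \<le> 3" by (simp add: card_insert_if)
    finally show False using c6 by simp
  qed
  obtain l1 where l1: "l1 \<in> S" using notsub by blast
  obtain l2 where l2: "l2 \<in> S" "l2 \<noteq> l1" using notsub[of l1 l1 l1] by blast
  obtain l3 where l3: "l3 \<in> S" "l3 \<notin> {l1, l2, vadd l1 l2}" using notsub[of l1 l2 "vadd l1 l2"] by blast
  have S0: "l1 \<noteq> (0,0,0)" "l2 \<noteq> (0,0,0)" "l3 \<noteq> (0,0,0)" and MS: "mv M l1 = pw 2 l1" "mv M l2 = pw 2 l2" "mv M l3 = pw 2 l3"
    using l1 l2 l3 by (auto simp: S_def)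
  have idem: "s = 0 \<or> s = 1" if "s = s^2" for s :: 'b using that by (auto simp: power2_eq_square)
  define n where "n = cross3 l1 l2"
  have n0: "n \<noteq> (0,0,0)"
  proof
    assume "n = (0,0,0)"
    then obtain s where s: "l1 = vscale s l2" using cross3_zero_iff S0(2) n_def by metis
    have "vscale s (pw 2 l2) = vscale (s^2) (pw 2 l2)" using MS by (simp add: s mv_vscale pw2_vscale)
    hence "s = s^2" using S0(2) by (cases l2) auto
    thus False using idem[of s] s S0(1) l2(2) by (cases l2) auto
  qed
  have n2: "cross3 (pw 2 l1) (pw 2 l2) \<noteq> (0,0,0)" using n0 by (simp add: cross3_pw2[OF c2] n_def pw_eq_0_iff)
  have "mdet (l1,l2,l3) \<noteq> 0"
  proof
    assume d0: "mdet (l1,l2,l3) = 0"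
    \<comment> \<open>The vector \<open>m\<close> completes l1, l2 to a basis of determinant 1, so
      Cramer's rule expresses the coordinates of l3 as determinants. Semilinearity makes each
      coordinate equal to its own square.\<close>
    obtain m where m: "dot3 n m = 1"
    proof -
      obtain a b c where nn: "n = (a,b,c)" by (metis prod_cases3)
      consider "a \<noteq> 0" | "b \<noteq> 0" | "c \<noteq> 0" using n0 nn by auto
      thus ?thesis
      proof cases
        case 1 thus ?thesis by (intro that[of "(inverse a,0,0)"]) (simp add: nn)
      next
        case 2 thus ?thesis by (intro that[of "(0,inverse b,0)"]) (simp add: nn)
      next
        case 3 thus ?thesis by (intro that[of "(0,0,inverse c)"]) (simp add: nn)
      qed
    qed
    define \<alpha> where "\<alpha> = mdet (l3,l2,m)"
    define \<beta> where "\<beta> = mdet (l1,l3,m)"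
    have "vadd (vscale (mdet (l3,l2,m)) l1) (vadd (vscale (mdet (l1,l3,m)) l2) (vscale (mdet (l1,l2,l3)) m))
        = vscale (dot3 (cross3 l1 l2) m) l3"
      by (cases l1; cases l2; cases l3; cases m) (simp add: algebra_simps)
    hence l3e: "l3 = vadd (vscale \<alpha> l1) (vscale \<beta> l2)" using m d0 unfolding \<alpha>_def[symmetric] \<beta>_def[symmetric] n_def[symmetric]
      by (cases l1; cases l2; cases m) simp
    have "vadd (vscale \<alpha> (pw 2 l1)) (vscale \<beta> (pw 2 l2)) = vadd (vscale (\<alpha>^2) (pw 2 l1)) (vscale (\<beta>^2) (pw 2 l2))"
      using MS by (simp add: l3e mv_vadd mv_vscale pw2_linear[OF c2])
    moreover have "cross3 (vadd (vscale a u) (vscale b v)) v = vscale a (cross3 u v)"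
        "cross3 u (vadd (vscale a u) (vscale b v)) = vscale b (cross3 u v)" for a b and u v :: "'b pt"
      by (cases u; cases v; simp add: algebra_simps)+
    ultimately have "vscale \<alpha> (cross3 (pw 2 l1) (pw 2 l2)) = vscale (\<alpha>^2) (cross3 (pw 2 l1) (pw 2 l2))"
        "vscale \<beta> (cross3 (pw 2 l1) (pw 2 l2)) = vscale (\<beta>^2) (cross3 (pw 2 l1) (pw 2 l2))" by metis+
    hence "\<alpha> = \<alpha>^2" "\<beta> = \<beta>^2" using n2 by (cases "cross3 (pw 2 l1) (pw 2 l2)"; auto)+
    hence "\<alpha> = 0 \<or> \<alpha> = 1" "\<beta> = 0 \<or> \<beta> = 1" using idem by blast+
    moreover have vz: "vadd (0,0,0) v = v" "vadd v (0,0,0) = v" "vscale 0 v = (0,0,0)" for v :: "'b pt" by (cases v; simp)+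
    ultimately have "l3 \<in> {(0,0,0), l1, l2, vadd l1 l2}" using l3e by (auto simp: vz)
    thus False using l3(2) S0(3) by blast
  qed
  moreover have "mm M (transp (l1,l2,l3)) = mpw 2 (transp (l1,l2,l3))"
    unfolding mm_columns mmap_transp by (simp add: MS)
  ultimately show ?thesis by (intro that[of "transp (l1,l2,l3)"]) simp_all
qed

lemma ordinary_framed:
  fixes F :: "_ \<Rightarrow> 'a::{finite,field}"
  assumes hq: "\<exists>n. CARD('a) = 2 ^ n" and F: "F \<in> ordinary_quartics"
  obtains B w where "framed F B w"
proof -
  note c2 = two_eq_0[OF hq] note sq = ring_map_sq[OF c2]
  let ?M = "oddm (to_ac \<circ> F)"
  have "card (bitangents F) = 7" and ns: "\<And>p. p \<noteq> (0,0,0) \<Longrightarrow> gradF F p = (0,0,0) \<Longrightarrow> evalF F p \<noteq> 0"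
    using F unfolding ordinary_quartics_def nonsingular_quartic_def by blast+
  then obtain N where N: "mdet N \<noteq> 0" "mm ?M N = mpw 2 N"
    using seven_lines_basis[OF c2, of ?M] bitangents_eq[OF hq, of F] by metis
  \<comment> \<open>With \<open>B\<close> a multiple of \<open>cof N\<close>, its cofactor matrix is
    a multiple of the solution matrix \<open>N\<close>. The transformed odd part is then
    \<open>k^4 * mdet N ^ 3\<close> times the identity, and \<open>k\<close> makes this factor
    1.\<close>
  obtain k where k: "k ^ 4 = inverse (mdet N ^ 3)" using nth_root_exists[of 4] by auto
  have k0: "k \<noteq> 0" using k N(1) by auto
  define B where "B = mscale k (cof N)"
  have B0: "mdet B \<noteq> 0" using k0 N(1) by (simp add: B_def mdet_mscale mdet_cof)
  have cB: "cof B = mscale (k^2 * mdet N) N" by (simp add: B_def cof_mscale cof_cof)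
  have tB: "transp (mpw 2 B) = mscale (k^2) (transp (cof (mpw 2 N)))"
    by (simp add: B_def mmap_mscale[OF sq] transp_mscale cof_mmap[OF sq])
  have "mm (transp (cof (mpw 2 N))) (mpw 2 N) = mscale (mdet N ^ 2) mI"
    using arg_cong[OF mm_transp_cof[of "mpw 2 N"], of transp] by (simp add: transp_mm transp_mscale mdet_mmap[OF sq])
  hence "mm (mm (transp (mpw 2 B)) ?M) (cof B) = mscale (k^2 * (k^2 * mdet N) * mdet N ^ 2) mI"
    unfolding tB cB by (simp add: mscale_mm mm_assoc N(2) mult_ac)
  also have "k^2 * (k^2 * mdet N) * mdet N ^ 2 = k^4 * mdet N ^ 3" by (simp add: eval_nat_numeral)
  also have "\<dots> = 1" using k N(1) by simp
  finally have BM: "mm (mm (transp (mpw 2 B)) ?M) (cof B) = mI" by (simp only: mscale_1)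
  obtain c where c: "\<And>x. qf (to_ac \<circ> F) (mv B x) = qf c x" and cM: "oddm c = mI"
    using quartic_with_comp[OF c2, of "to_ac \<circ> F" B] BM unfolding quartic_with_def by metis
  define w where "w = (\<lambda>v. qf c (bv v))"
  have w: "weight w" "\<And>x. qf (nfc w) x = qf c x" using nfc_of_odd[OF c2 cM] unfolding w_def by auto
  have "w v \<noteq> 0" if "v \<noteq> (0,0,0)" for v
  proof -
    have "gradF F (mv B (bv v)) = (0,0,0)" unfolding gradF_frame[OF c2 B0 BM] by (rule cross3_bv_self)
    moreover have "mv B (bv v) \<noteq> (0,0,0)" using that by (simp add: mv_eq_0_iff[OF B0])
    ultimately have "evalF F (mv B (bv v)) \<noteq> 0" by (intro ns)
    thus ?thesis by (simp add: evalF_qf c w_def)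
  qed
  hence "framed F B w" using B0 w c by (simp add: framed_def admissible_def evalF_qf)
  thus ?thesis by (rule that)
qed

section \<open>The Frobenius action on frames\<close>

lemma ring_map_frob:
  assumes hq: "\<exists>n. CARD('a::{finite,field}) = 2 ^ n"
  shows "ring_map (\<lambda>x::'a alg_closure. x ^ (CARD('a) ^ d))"
proof -
  obtain n where "CARD('a) = 2 ^ n" using hq by blast
  hence "CARD('a) ^ d = 2 ^ (n * d)" by (simp add: power_mult)
  thus ?thesis using ring_map_power2[OF two_eq_0[OF hq]] by simp
qed

lemma ring_map_frob1:
  assumes hq: "\<exists>n. CARD('a::{finite,field}) = 2 ^ n"
  shows "ring_map (\<lambda>x::'a alg_closure. x ^ CARD('a))"
  using ring_map_frob[OF hq, of 1] by simp

lemma frob_eq_pw: "frob d L = pw (CARD('a) ^ d) (L :: 'a::{finite,field} alg_closure pt)"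
  by (cases L) (simp add: frob_def)

lemma qf_power:
  assumes "ring_map (\<lambda>x::'b::field. x ^ N)"
  shows "qf c x ^ N = qf (\<lambda>m. c m ^ N) (pw N (x :: 'b pt))"
proof -
  have [simp]: "(x ^ m) ^ N = (x ^ N) ^ m" for x :: 'b and m by (simp flip: power_mult add: mult.commute)
  show ?thesis by (cases x) (simp add: qf.simps ring_mapD(1)[OF assms] power_mult_distrib)
qed

lemma pw_surj: assumes "N > 0" obtains x where "pw N x = (y :: 'b::alg_closed_field pt)"
proof -
  obtain a b c where y: "y = (a,b,c)" by (metis prod_cases3)
  obtain a' b' c' where "a' ^ N = a" "b' ^ N = b" "c' ^ N = c" using nth_root_exists[OF assms] by metis
  thus ?thesis by (intro that[of "(a',b',c')"]) (simp add: y)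
qed

lemma card_pos_field: "0 < CARD('a::{finite,field})" using card_gt_1_field[where ?'a='a] by simp

lemma evalF_frob:
  assumes hq: "\<exists>n. CARD('a::{finite,field}) = 2 ^ n"
  shows "evalF F (pw CARD('a) x) = (evalF (F :: _ \<Rightarrow> 'a) x) ^ CARD('a)"
proof -
  have "(\<lambda>m. (to_ac \<circ> F) m ^ CARD('a)) = to_ac \<circ> F"
    by (rule ext) (simp add: power_card_self flip: to_ac_power)
  thus ?thesis by (simp add: evalF_qf qf_power[OF ring_map_frob1[OF hq]])
qed

lemma ring_map_sum: "ring_map f \<Longrightarrow> f (sum g A) = sum (\<lambda>x. f (g x)) A"
  by (induction A rule: infinite_finite_induct) (auto simp: ring_mapD)

lemma nfc_power:
  assumes r: "ring_map (\<lambda>x::'b::field. x ^ N)" and N: "N > 0"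
  shows "(\<lambda>m. nfc w m ^ N) = nfc (\<lambda>v. (w v :: 'b) ^ N)"
  by (rule ext) (simp add: nfc_def ring_mapD(1)[OF r] zero_power[OF N])

lemma weight_power:
  assumes r: "ring_map (\<lambda>x::'b::field. x ^ N)" and N: "N > 0" and w: "weight w"
  shows "weight (\<lambda>v. (w v :: 'b) ^ N)"
  using w ring_map_sum[OF r, of w "set npts"] by (simp add: weight_def zero_power[OF N])

text \<open>The coefficients of \<open>F\<close> lie in k, so the entrywise q-th power of a frame is
  again a frame of \<open>F\<close>, with w^q as weight; two normal forms of one quartic differ by
  an element of GL_3(F_2).\<close>

lemma framed_frob:
  fixes F :: "_ \<Rightarrow> 'a::{finite,field}"
  assumes hq: "\<exists>n. CARD('a) = 2 ^ n" and f: "framed F B w"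
  obtains g where "mdet g = 1" "mpw CARD('a) B = mm B (bm g)" "\<And>v. w (mv g v) = w v ^ CARD('a)"
proof -
  note c2 = two_eq_0[OF hq] and r = ring_map_frob1[OF hq] and q0 = card_pos_field[where ?'a='a]
  note B = framedD(1)[OF f]
  have w: "weight w" using framedD(2)[OF f] by (simp add: admissible_def)
  define A where "A = mm (minv B) (mpw CARD('a) B)"
  have BA: "mm B A = mpw CARD('a) B" by (simp add: A_def mm_minv B flip: mm_assoc)
  have "qf (nfc (\<lambda>v. w v ^ CARD('a))) y = qf (nfc w) (mv A y)" for y
  proof -
    obtain x where x: "pw CARD('a) x = y" using pw_surj[OF q0] by blast
    have "qf (nfc (\<lambda>v. w v ^ CARD('a))) y = qf (nfc w) x ^ CARD('a)"
      by (simp add: qf_power[OF r] nfc_power[OF r q0] x)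
    also have "\<dots> = evalF F (pw CARD('a) (mv B x))" by (simp add: evalF_frob[OF hq] framedD(3)[OF f])
    also have "\<dots> = evalF F (mv B (mv A y))" by (simp add: pmap_mv[OF r] x BA flip: mv_mm)
    finally show ?thesis by (simp add: framedD(3)[OF f])
  qed
  then obtain g where g: "A = bm g" "mdet g = 1" "(\<lambda>v. w v ^ CARD('a)) = w \<circ> mv g"
    using nfc_transform[OF c2 w weight_power[OF r q0 w]] by blast
  show ?thesis using g BA by (intro that[of g]) (auto simp: fun_eq_iff)
qed

text \<open>\<open>g\<close> is the Frobenius cocycle of the frame. The relation between
  \<open>w\<close> and \<open>g\<close> is not demanded here; it follows in
  \<open>framedg_frob\<close>.\<close>

definition framedg :: "bit mat3 \<Rightarrow> 'a::{finite,field} quartic \<Rightarrow> 'a alg_closure mat3 \<Rightarrow> (bit pt \<Rightarrow> 'a alg_closure) \<Rightarrow> bool" where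
  "framedg g F B w \<longleftrightarrow> framed F B w \<and> mpw CARD('a) B = mm B (bm g)"

lemma mm_left_cancel: "mdet B \<noteq> 0 \<Longrightarrow> mm B U = mm B V \<Longrightarrow> U = V" for B :: "'b::field mat3"
  using mm_assoc[of "minv B" B U] mm_assoc[of "minv B" B V] by (simp add: mm_minv)

lemma framedg_frob:
  fixes F :: "_ \<Rightarrow> 'a::{finite,field}"
  assumes hq: "\<exists>n. CARD('a) = 2 ^ n" and f: "framedg g F B w"
  shows "mdet g = 1" "w (mv g v) = w v ^ CARD('a)"
proof -
  have fr: "framed F B w" and e: "mpw CARD('a) B = mm B (bm g)" using f by (simp_all add: framedg_def)
  obtain g' where g': "mdet g' = 1" "mpw CARD('a) B = mm B (bm g')" "\<And>v. w (mv g' v) = w v ^ CARD('a)"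
    using framed_frob[OF hq fr] by blast
  have "bm g' = (bm g :: 'a alg_closure mat3)" using mm_left_cancel[OF framedD(1)[OF fr]] e g'(2) by metis
  hence "g' = g" by simp
  thus "mdet g = 1" "w (mv g v) = w v ^ CARD('a)" using g' by simp_all
qed

lemma framed_change:
  fixes F :: "_ \<Rightarrow> 'a::{finite,field}"
  assumes hq: "\<exists>n. CARD('a) = 2 ^ n" and f: "framed F B w" and h: "mdet h = 1"
  shows "framed F (mm B (bm h)) (w \<circ> mv h)"
proof -
  note c2 = two_eq_0[OF hq]
  have w: "weight w" using framedD(2)[OF f] by (simp add: admissible_def)
  show ?thesis unfolding framed_def
    using framedD[OF f] h admissible_comp[OF c2 _ h] nfc_transform_conv(2)[OF c2 w h]
    by (simp add: mdet_mm mdet_mmap[OF ring_map_eb[OF c2]] mv_mm)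
qed

lemma framed_unique:
  fixes F :: "_ \<Rightarrow> 'a::{finite,field}"
  assumes hq: "\<exists>n. CARD('a) = 2 ^ n" and f: "framed F B w" and f': "framed F B' w'"
  obtains h where "mdet h = 1" "B' = mm B (bm h)" "w' = w \<circ> mv h"
proof -
  note c2 = two_eq_0[OF hq] note B = framedD(1)[OF f]
  define A where "A = mm (minv B) B'"
  have BA: "mm B A = B'" by (simp add: A_def mm_minv B flip: mm_assoc)
  have "qf (nfc w') x = qf (nfc w) (mv A x)" for x
    using framedD(3)[OF f, of "mv A x"] framedD(3)[OF f', of x] by (simp add: BA flip: mv_mm)
  moreover have "weight w" "weight w'" using framedD(2)[OF f] framedD(2)[OF f'] by (simp_all add: admissible_def)
  ultimately obtain h where "A = bm h" "mdet h = 1" "w' = w \<circ> mv h" using nfc_transform[OF c2] by metis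
  thus ?thesis using that BA by blast
qed

section \<open>Isomorphisms over k in terms of frames\<close>

definition mat_fn :: "'b mat3 \<Rightarrow> nat \<Rightarrow> nat \<Rightarrow> 'b" where
  "mat_fn A i j = (case (if i = 0 then fst A else if i = 1 then fst (snd A) else snd (snd A)) of
     (x,y,z) \<Rightarrow> if j = 0 then x else if j = 1 then y else z)"

lemma det3_mat_fn: "det3 (mat_fn A) = mdet A"
  by (cases A rule: mat3_cases) (simp add: mat_fn_def det3_def)

lemma applyA_mat_fn: "applyA (mat_fn A) p = mv (mmap to_ac A) p"
  by (cases A rule: mat3_cases; cases p) (simp add: mat_fn_def applyA_def)

definition fn_mat :: "(nat \<Rightarrow> nat \<Rightarrow> 'b) \<Rightarrow> 'b mat3" where
  "fn_mat A = ((A 0 0, A 0 1, A 0 2), (A 1 0, A 1 1, A 1 2), (A 2 0, A 2 1, A 2 2))"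

lemma mdet_fn_mat: "mdet (fn_mat A) = det3 A"
  by (simp add: fn_mat_def det3_def)

lemma mv_fn_mat: "mv (mmap to_ac (fn_mat A)) p = applyA A p"
  by (cases p) (simp add: fn_mat_def applyA_def)

lemma ring_map_to_ac: "ring_map to_ac" by (simp add: ring_map_def)

lemma mat_descend:
  assumes hq: "\<exists>n. CARD('a::{finite,field}) = 2 ^ n" and A: "mpw CARD('a) A = (A :: 'a alg_closure mat3)"
  obtains A0 :: "'a::{finite,field} mat3" where "A = mmap to_ac A0"
proof -
  have d: "to_ac (of_ac x) = (x :: 'a alg_closure)" if "x ^ CARD('a) = x" for x
    using range_to_ac[OF hq] that by (intro to_ac_of_ac) blast
  have "A = mmap to_ac (mmap of_ac A)" using A by (cases A rule: mat3_cases) (simp add: d)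
  thus ?thesis by (rule that)
qed

lemma minv_mmap: "ring_map f \<Longrightarrow> f 1 = 1 \<Longrightarrow> mdet A \<noteq> 0 \<Longrightarrow> mdet (mmap f A) \<noteq> 0 \<Longrightarrow> mmap f (minv A) = minv (mmap f A)"
  for A :: "'b::field mat3" and f :: "'b \<Rightarrow> 'c::field"
proof -
  assume f: "ring_map f" "f 1 = 1" and A: "mdet A \<noteq> 0" "mdet (mmap f A) \<noteq> 0"
  have "mm (mmap f A) (mmap f (minv A)) = mI" using f A by (simp add: mm_minv mmap_mI ring_mapD flip: mmap_mm)
  thus ?thesis using mm_left_cancel[OF A(2)] mm_minv(1)[OF A(2)] by metis
qed

text \<open>In B times the inverse of B' the factor \<open>g\<close> produced by Frobenius cancels.
  So this matrix is fixed by Frobenius and defined over k, and it relates the two quartics because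
  they share the normal form.\<close>

lemma framedg_isomorphic:
  fixes F :: "_ \<Rightarrow> 'a::{finite,field}"
  assumes hq: "\<exists>n. CARD('a) = 2 ^ n" and f: "framedg g F B w" and f': "framedg g F' B' w"
  shows "k_isomorphic F F'"
proof -
  note r = ring_map_frob1[OF hq]
  have fr: "framed F B w" "mpw CARD('a) B = mm B (bm g)" "framed F' B' w" "mpw CARD('a) B' = mm B' (bm g)"
    using f f' by (simp_all add: framedg_def)
  note B = framedD(1)[OF fr(1)] framedD(1)[OF fr(3)]
  define A where "A = mm B (minv B')"
  have AB: "mm A B' = B" by (simp add: A_def mm_assoc mm_minv B)
  have dA: "mdet A \<noteq> 0" using AB B mdet_mm[of A B'] by auto
  have "mm (mm (mpw CARD('a) A) B') (bm g) = mm (mm A B') (bm g)"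
    unfolding AB mm_assoc fr(4)[symmetric] mmap_mm[OF r, symmetric] by (simp add: AB fr(2))
  hence "mm (mm (mm (mpw CARD('a) A) B') (bm g)) (mm (minv (bm g)) (minv B')) = mm (mm (mm A B') (bm g)) (mm (minv (bm g)) (minv B'))" by simp
  moreover have "mdet (bm g :: 'a alg_closure mat3) \<noteq> 0"
    using framedg_frob(1)[OF hq f] by (simp add: mdet_mmap[OF ring_map_eb[OF two_eq_0[OF hq]]])
  moreover have "mm (mm (mm U B') G) (mm (minv G) (minv B')) = U" if "mdet G \<noteq> 0" for U G
    using that B by (metis mm_assoc mm_minv(1) mm_mI(1))
  ultimately have "mpw CARD('a) A = A" by metis
  then obtain A0 where A0: "A = mmap to_ac A0" using mat_descend[OF hq] by blast
  have "evalF F' p = to_ac 1 * evalF F (applyA (mat_fn A0) p)" for p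
  proof -
    define y where "y = mv (minv B') p"
    have p: "p = mv B' y" by (simp add: y_def mv_minv B)
    show ?thesis using framedD(3)[OF fr(1), of y] framedD(3)[OF fr(3), of y]
      by (simp add: applyA_mat_fn p AB flip: A0 mv_mm)
  qed
  moreover have "det3 (mat_fn A0) \<noteq> 0" using dA A0 mdet_mmap[OF ring_map_to_ac, of A0] by (simp add: det3_mat_fn)
  ultimately show ?thesis unfolding k_isomorphic_def by (metis one_neq_zero)
qed

text \<open>An isomorphism moves the frame by a matrix over k, which leaves \<open>g\<close>
  unchanged. Its scalar c is absorbed by a fourth root s of 1/c; s lies in k since c does and fourth
  powers are injective in characteristic 2.\<close>

lemma isomorphic_framedg:
  fixes F :: "_ \<Rightarrow> 'a::{finite,field}"
  assumes hq: "\<exists>n. CARD('a) = 2 ^ n" and f: "framedg g F B w" and i: "k_isomorphic F F'"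
  obtains B' where "framedg g F' B' w"
proof -
  note r = ring_map_frob1[OF hq]
  obtain A c where Ac: "det3 A \<noteq> 0" "c \<noteq> 0" "\<And>p. evalF F' p = to_ac c * evalF F (applyA A p)"
    using i unfolding k_isomorphic_def by blast
  define A1 where "A1 = (mmap to_ac (fn_mat A) :: 'a alg_closure mat3)"
  have d1: "mdet A1 \<noteq> 0" using Ac(1) by (simp add: A1_def mdet_mmap[OF ring_map_to_ac] mdet_fn_mat)
  have A1q: "mpw CARD('a) A1 = A1"
    by (simp add: A1_def fn_mat_def power_card_self flip: to_ac_power)
  obtain s where s: "s ^ 4 = inverse (to_ac c)" using nth_root_exists[of 4] by auto
  have s0: "s \<noteq> 0" using s Ac(2) by auto
  have "(s ^ CARD('a)) ^ (2^2) = s ^ (2^2)"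
  proof -
    have "(s ^ CARD('a)) ^ 4 = (s ^ 4) ^ CARD('a)" by (simp flip: power_mult add: mult.commute)
    also have "\<dots> = s ^ 4" unfolding s by (simp add: power_card_self flip: to_ac_inverse to_ac_power)
    finally show ?thesis by simp
  qed
  hence sq: "s ^ CARD('a) = s" by (rule char2_power_inj[OF two_eq_0[OF hq]])
  have fr: "framed F B w" "mpw CARD('a) B = mm B (bm g)" using f by (simp_all add: framedg_def)
  define B' where "B' = mscale s (mm (minv A1) B)"
  have "mdet B' \<noteq> 0" using s0 framedD(1)[OF fr(1)] mdet_minv[OF d1] by (simp add: B'_def mdet_mscale mdet_mm)
  moreover have "evalF F' (mv B' x) = qf (nfc w) x" for x
  proof -
    have "evalF F' (mv B' x) = to_ac c * evalF F (mv A1 (mv B' x))" by (simp add: Ac(3) A1_def mv_fn_mat)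
    also have "mv A1 (mv B' x) = vscale s (mv B x)"
      by (simp add: B'_def mv_mscale mv_vscale mv_mm mv_minv d1)
    also have "to_ac c * evalF F (vscale s (mv B x)) = to_ac c * s^4 * evalF F (mv B x)"
      by (simp add: evalF_qf qf_vscale)
    also have "to_ac c * s^4 = 1" using Ac(2) by (simp add: s)
    finally show ?thesis by (simp add: framedD(3)[OF fr(1)])
  qed
  moreover have "mpw CARD('a) B' = mm B' (bm g)"
  proof -
    have "mmap (\<lambda>x. x ^ CARD('a)) (minv A1) = minv A1"
      using minv_mmap[OF r _ d1] A1q d1 by simp
    thus ?thesis by (simp add: B'_def mmap_mscale[OF r] mmap_mm[OF r] fr(2) sq mscale_mm mm_assoc)
  qed
  ultimately have "framedg g F' B' w" unfolding framedg_def framed_def using framedD(2)[OF fr(1)] by blast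
  thus ?thesis by (rule that)
qed

subsection \<open>Twisted frames and Galois descent\<close>

fun vsum :: "(nat \<Rightarrow> 'b::comm_ring_1 pt) \<Rightarrow> nat \<Rightarrow> 'b pt" where
  "vsum f 0 = (0,0,0)" | "vsum f (Suc m) = vadd (vsum f m) (f m)"

lemma dot3_vadd: "dot3 L (vadd u v) = dot3 L u + dot3 L v" by (cases L; cases u; cases v) (simp add: algebra_simps)
lemma pmap_vadd: "ring_map f \<Longrightarrow> pmap f (vadd u v) = vadd (pmap f u) (pmap f v)" by (cases u; cases v) (simp add: ring_mapD)
lemma vadd_assoc: "vadd (vadd u v) w = vadd u (vadd v w)" by (cases u; cases v; cases w) (simp add: algebra_simps)
lemma vadd_comm: "vadd u v = vadd v u" by (cases u; cases v) (simp add: algebra_simps)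
lemma vadd_cancel: "vadd u v = vadd u w \<longleftrightarrow> v = w" by (cases u; cases v; cases w) simp

lemma dot3_vsum: "dot3 L (vsum f m) = (\<Sum>i<m. dot3 L (f i))"
  by (induction m) (cases L, simp, simp add: dot3_vadd)

lemma pmap_vsum: "ring_map \<phi> \<Longrightarrow> pmap \<phi> (vsum f m) = vsum (\<lambda>i. pmap \<phi> (f i)) m"
  by (induction m) (simp_all add: ring_mapD pmap_vadd)

lemma mv_vsum: "mv A (vsum f m) = vsum (\<lambda>i. mv A (f i)) m"
  by (induction m) (simp_all add: mv_vadd)

lemma vsum_shift: "vadd (f 0) (vsum (\<lambda>i. f (Suc i)) m) = vsum f (Suc m)"
proof (induction m)
  case 0 show ?case by (simp add: vadd_comm)
next
  case (Suc m) show ?case by (simp del: vsum.simps(2) add: vsum.simps(2)[of _ "Suc m"] vsum.simps(2)[of "\<lambda>i. f (Suc i)"] Suc[symmetric] vadd_assoc)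
qed

text \<open>This is why a trace along a finite orbit is invariant under the shift.\<close>

lemma vsum_cyclic: "f m = f 0 \<Longrightarrow> vsum (\<lambda>i. f (Suc i)) m = vsum f m"
  using vsum_shift[of f m] by (metis vadd_cancel vadd_comm vsum.simps(2))

text \<open>\<open>V\<close> is an arbitrary set: in \<open>lang\<close> it is only an F_q-subspace,
  and the question is whether it spans over the closure.\<close>

lemma basis_or_functional:
  fixes V :: "'b::field pt set"
  shows "(\<exists>u\<in>V. \<exists>v\<in>V. \<exists>w\<in>V. mdet (u,v,w) \<noteq> 0) \<or> (\<exists>f. f \<noteq> (0,0,0) \<and> (\<forall>v\<in>V. dot3 f v = 0))"
proof (cases "\<exists>u\<in>V. \<exists>v\<in>V. cross3 u v \<noteq> (0,0,0)")
  case True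
  then obtain u v where uv: "u \<in> V" "v \<in> V" "cross3 u v \<noteq> (0,0,0)" by blast
  have "mdet (u,v,w) = dot3 (cross3 u v) w" for w by (cases u; cases v; cases w) (simp add: algebra_simps)
  thus ?thesis using uv by metis
next
  case False
  show ?thesis
  proof (cases "\<forall>u\<in>V. u = (0,0,0)")
    case True thus ?thesis by (intro disjI2 exI[of _ "(1,0,0)"]) auto
  next
    case F2: False
    then obtain u where u: "u \<in> V" "u \<noteq> (0,0,0)" by blast
    have "\<exists>f. f \<noteq> (0,0,0) \<and> dot3 f u = 0"
    proof -
      obtain a b c where uu: "u = (a,b,c)" by (metis prod_cases3)
      show ?thesis
      proof (cases "a = 0 \<and> b = 0")
        case True thus ?thesis by (intro exI[of _ "(1,0,0)"]) (simp add: uu)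
      next
        case False thus ?thesis by (intro exI[of _ "(b,-a,0)"]) (auto simp: uu)
      qed
    qed
    then obtain f where f: "f \<noteq> (0,0,0)" "dot3 f u = 0" by blast
    have "dot3 f v = 0" if "v \<in> V" for v
    proof -
      have "cross3 v u = (0,0,0)" using False that u by blast
      then obtain s where "v = vscale s u" using cross3_zero_iff[OF u(2)] by blast
      moreover have "dot3 f (vscale s u) = s * dot3 f u" by (cases f; cases u) (simp add: algebra_simps)
      ultimately show ?thesis using f(2) by simp
    qed
    thus ?thesis using f(1) by blast
  qed
qed

lemma mm_rows: "mm (u,v,w) G = (mv (transp G) u, mv (transp G) v, mv (transp G) w)"
  by (cases G rule: mat3_cases; cases u; cases v; cases w) (simp add: algebra_simps)

text \<open>As a polynomial in c the sum has degree at most q^(m-1), too small for q^m roots, and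
  \<open>a 0\<close> is its linear coefficient.\<close>

lemma additive_poly_zero:
  fixes a :: "nat \<Rightarrow> 'b::alg_closed_field"
  assumes c2: "(2::'b) = 0" and q: "q = 2 ^ n" "n > 0" and m: "m > 0"
    and z: "\<And>c. c ^ (q ^ m) = c \<Longrightarrow> (\<Sum>i<m. c ^ (q ^ i) * a i) = 0"
  shows "a 0 = 0"
proof -
  define p where "p = (\<Sum>i<m. Polynomial.monom (a i) (q ^ i))"
  have q1: "q > 1" using q one_less_power[of "2::nat" n] by simp
  have "p = 0"
  proof (rule ccontr)
    assume p0: "p \<noteq> 0"
    have qm: "q ^ m = 2 ^ (n * m)" by (simp add: q power_mult)
    have "{c. c ^ (q ^ m) = c} \<subseteq> {c. poly p c = 0}"
      using z by (auto simp: p_def poly_sum poly_monom mult.commute)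
    hence "card {c::'b. c ^ (q ^ m) = c} \<le> card {c. poly p c = 0}"
      by (intro card_mono poly_roots_finite p0)
    also have "\<dots> \<le> Polynomial.degree p" by (rule card_poly_roots_bound[OF p0])
    also have "\<dots> \<le> q ^ (m - 1)" unfolding p_def
      by (intro degree_sum_le) (use q1 in \<open>auto intro!: order.trans[OF degree_monom_le] power_increasing\<close>)
    also have "\<dots> < q ^ m" using q1 m by (intro power_strict_increasing) auto
    finally show False using card_power_fixed[OF c2, of "n * m"] q m qm by simp
  qed
  have "Polynomial.coeff p 1 = (\<Sum>i<m. if i = 0 then a i else 0)"
    unfolding p_def coeff_sum using q1 by (intro sum.cong) (auto simp: power_eq_1_iff)
  also have "\<dots> = a 0" using m by simp
  finally show ?thesis using \<open>p = 0\<close> by simp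
qed

text \<open>The vectors fixed by \<open>\<phi>(v) = h v\<^sup>(\<^sup>q\<^sup>)\<close> span: a functional killing all traces \<open>\<Sum> \<phi>\<^sup>i(c e)\<close> would give an
  additive polynomial in \<open>c\<close> of degree below \<open>q\<^sup>m\<close> that vanishes on \<open>\<bbbF>\<^bsub>q^m\<^esub>\<close>.\<close>

lemma lang:
  assumes hq: "\<exists>n. CARD('a::{finite,field}) = 2 ^ n" and g: "mdet g = 1"
  obtains B :: "'a::{finite,field} alg_closure mat3" where "mdet B \<noteq> 0" "mpw CARD('a) B = mm B (bm g)"
proof -
  note c2 = two_eq_0[OF hq] and r = ring_map_frob1[OF hq] and rb = ring_map_eb[OF two_eq_0[OF hq]]
  let ?q = "CARD('a)"
  obtain n where n: "?q = 2 ^ n" using hq by blast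
  have n0: "n > 0" using card_gt_1_field[where ?'a='a] n by (cases n) auto
  \<comment> \<open>Row by row the equation wanted for \<open>B\<close> reads v^(q) = g^T v; with
    \<open>h\<close> the inverse transpose of \<open>g\<close> it becomes the fixed-point equation
    defining \<open>V\<close>.\<close>
  define h where "h = minv (transp g)"
  have hg: "mm h (transp g) = mI" "mm (transp g) h = mI" using g by (simp_all add: h_def mm_minv)
  have "bij (mv h)"
    by (rule o_bij[of "mv (transp g)"]) (auto simp: fun_eq_iff hg simp flip: mv_mm)
  hence "permutation (mv h)" unfolding permutation using finite_bit_pt by (metis finite_subset subset_UNIV)
  then obtain m where m: "mv h ^^ m = id" "m > 0" using permutation_is_nilpotent by blast
  define V where "V = {v :: 'a alg_closure pt. mv (bm h) (pw ?q v) = v}"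
  \<comment> \<open>A trace: \<open>m\<close> is a period of \<open>h\<close>, so the semilinear map
    shifts the summands cyclically.\<close>
  define T where "T c e = vsum (\<lambda>i. vscale (c ^ (?q ^ i)) (bv ((mv h ^^ i) e))) m" for c :: "'a alg_closure" and e
  have TV: "T c e \<in> V" if "c ^ (?q ^ m) = c" for c e
  proof -
    have "mv (bm h) (pw ?q (T c e)) = vsum (\<lambda>i. vscale (c ^ (?q ^ Suc i)) (bv ((mv h ^^ Suc i) e))) m"
      unfolding T_def pmap_vsum[OF r] mv_vsum
      by (simp add: pmap_vscale[OF r] mv_vscale card_pos_field pmap_mv[OF rb] flip: power_mult, simp add: mult.commute)
    also have "\<dots> = T c e" unfolding T_def
      by (rule vsum_cyclic) (simp add: m that)
    finally show ?thesis by (simp add: V_def)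
  qed
  have "\<not> (\<exists>f. f \<noteq> (0,0,0) \<and> (\<forall>v\<in>V. dot3 f v = 0))"
  proof (rule notI, elim exE conjE)
    fix f assume nz: "f \<noteq> (0,0,0)" and f: "\<forall>v\<in>V. dot3 f v = 0"
    obtain f0 f1 f2 where ff: "f = (f0,f1,f2)" by (metis prod_cases3)
    note nz = nz[unfolded ff] and f = f[unfolded ff]
    have "dot3 (f0,f1,f2) (bv ((mv h ^^ 0) e)) = 0" for e
    proof (rule additive_poly_zero[OF c2 n n0 m(2)])
      fix c :: "'a alg_closure" assume "c ^ (?q ^ m) = c"
      hence "dot3 (f0,f1,f2) (T c e) = 0" using f TV by blast
      moreover have "dot3 f (vscale s v) = s * dot3 f v" for s f and v :: "'a alg_closure pt"
        by (cases f; cases v) (simp add: algebra_simps)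
      ultimately show "(\<Sum>i<m. c ^ (?q ^ i) * dot3 (f0,f1,f2) (bv ((mv h ^^ i) e))) = 0"
        by (simp add: T_def dot3_vsum)
    qed
    from this[of "(1,0,0)"] this[of "(0,1,0)"] this[of "(0,0,1)"] have "f0 = 0" "f1 = 0" "f2 = 0" by simp_all
    thus False using nz by simp
  qed
  then obtain u v w where uvw: "u \<in> V" "v \<in> V" "w \<in> V" "mdet (u,v,w) \<noteq> 0" using basis_or_functional[of V] by blast
  have V: "pw ?q v = mv (transp (bm g)) v" if "v \<in> V" for v
  proof -
    have "mv (transp (bm g)) (mv (bm h) (pw ?q v)) = mv (transp (bm g)) v" using that by (simp add: V_def)
    moreover have "mm (transp (bm g)) (bm h) = (mI :: 'a alg_closure mat3)"
      using arg_cong[OF hg(2), of "bm :: _ \<Rightarrow> 'a alg_closure mat3"] by (simp add: mmap_mm[OF rb] mmap_transp mmap_mI)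
    ultimately show ?thesis by (simp flip: mv_mm)
  qed
  show ?thesis
    by (rule that[OF uvw(4)]) (simp add: mm_rows V uvw)
qed

lemma qf_cong: "(\<And>m. m \<in> mon4 \<Longrightarrow> c m = c' m) \<Longrightarrow> qf c x = qf c' x"
  by (cases x) (simp add: qf.simps mon4_eq)

text \<open>The normal form is transported back by the matrix \<open>B\<close> from
  \<open>lang\<close>. The twist of \<open>B\<close> by \<open>g\<close> is compensated by the
  condition on \<open>w\<close>, so the coefficients are fixed by Frobenius and lie in k.\<close>

lemma framedg_exists:
  assumes hq: "\<exists>n. CARD('a::{finite,field}) = 2 ^ n" and g: "mdet g = 1"
    and w: "admissible w" "\<And>v. w (mv g v) = w v ^ CARD('a)"
  obtains F :: "_ \<Rightarrow> 'a::{finite,field}" and B where "is_quartic_form F" "framedg g F B w"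
proof -
  note c2 = two_eq_0[OF hq] and r = ring_map_frob1[OF hq] and q0 = card_pos_field[where ?'a='a]
  let ?q = "CARD('a)"
  obtain B :: "'a alg_closure mat3" where B: "mdet B \<noteq> 0" "mpw ?q B = mm B (bm g)" using lang[OF hq g] by blast
  have wt: "weight w" using w by (simp add: admissible_def)
  obtain c where c: "\<And>x. qf (nfc w) (mv (minv B) x) = qf c x"
    using quartic_with_comp[OF c2, of "nfc w" "minv B"] unfolding quartic_with_def by metis
  have "qf (\<lambda>m. c m ^ ?q) y = qf c y" for y
  proof -
    obtain x where x: "pw ?q x = y" using pw_surj[OF q0] by blast
    define z where "z = mv (minv B) x"
    have "mv B z = x" by (simp add: z_def mv_minv B)
    hence "mv (mm B (bm g)) (pw ?q z) = y" unfolding x[symmetric] by (simp add: pmap_mv[OF r, symmetric] flip: B(2))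
    hence "mv (minv B) y = mv (bm g) (pw ?q z)" by (metis mv_mm mv_minv(2)[OF B(1)])
    hence "qf c y = qf (nfc w) (mv (bm g) (pw ?q z))" by (simp flip: c)
    also have "\<dots> = qf (nfc (w \<circ> mv g)) (pw ?q z)" by (rule nfc_transform_conv(2)[OF c2 wt g])
    also have "w \<circ> mv g = (\<lambda>v. w v ^ ?q)" using w(2) by auto
    also have "qf (nfc (\<lambda>v. w v ^ ?q)) (pw ?q z) = qf (nfc w) z ^ ?q" by (simp add: qf_power[OF r] nfc_power[OF r q0])
    also have "\<dots> = qf c x ^ ?q" by (simp add: z_def c)
    finally show ?thesis by (simp add: qf_power[OF r] x)
  qed
  hence cq: "c m ^ ?q = c m" if "m \<in> mon4" for m
    using qf_unique[OF infinite_char2[OF c2], of "\<lambda>m. c m ^ ?q" c m] that by blast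
  define F :: "_ \<Rightarrow> 'a" where "F m = (if m \<in> mon4 then of_ac (c m) else 0)" for m
  have "to_ac (F m) = c m" if "m \<in> mon4" for m
    using cq[OF that] that range_to_ac[OF hq] by (simp add: F_def to_ac_of_ac)
  hence "evalF F x = qf c x" for x unfolding evalF_qf by (intro qf_cong) simp
  hence "evalF F (mv B x) = qf (nfc w) x" for x by (simp add: mv_minv B flip: c)
  hence "framedg g F B w" using B w(1) by (simp add: framedg_def framed_def)
  moreover have "is_quartic_form F" by (simp add: is_quartic_form_def F_def)
  ultimately show ?thesis using that by blast
qed


subsection \<open>Frobenius on the bitangents and the orbit correspondence\<close>

lemma pw_nrm: "N > 0 \<Longrightarrow> pw N (nrm v) = nrm (pw N v)" for v :: "'b::field pt"
  by (cases v) (auto simp: power_mult_distrib power_inverse)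

text \<open>Labels are F_2-vectors and hence fixed by Frobenius; taking cofactors in the twist of
  \<open>B\<close> by \<open>g\<close> leaves \<open>cof g\<close> acting on them.\<close>

lemma frob_bline:
  fixes F :: "_ \<Rightarrow> 'a::{finite,field}"
  assumes hq: "\<exists>n. CARD('a) = 2 ^ n" and f: "framedg g F B w"
  shows "frob d (bline B e) = bline B ((mv (cof g) ^^ d) e)"
proof (induction d)
  case 0 show ?case by (simp add: frob_def case_prod_beta)
next
  case (Suc d)
  note r = ring_map_frob1[OF hq] and rb = ring_map_eb[OF two_eq_0[OF hq]]
  have e: "mpw CARD('a) B = mm B (bm g)" using f by (simp add: framedg_def)
  have step: "pw CARD('a) (bline B e') = bline B (mv (cof g) e')" for e'
    by (simp add: bline_def pw_nrm card_pos_field pmap_mv[OF r] cof_mmap[OF r, symmetric] e cof_mm mv_mm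
        cof_mmap[OF rb] flip: pmap_mv[OF rb])
  have "frob (Suc d) (bline B e) = pw CARD('a) (frob d (bline B e))"
    unfolding frob_eq_pw by (cases "bline B e") (simp add: mult.commute flip: power_mult)
  thus ?case by (simp add: Suc step)
qed

definition gdeg :: "bit mat3 \<Rightarrow> nat" where
  "gdeg g = (LEAST d. d \<ge> 1 \<and> (\<forall>e. (mv (cof g) ^^ d) e = e))"

lemma bitangent_degree_eq:
  fixes F :: "_ \<Rightarrow> 'a::{finite,field}"
  assumes hq: "\<exists>n. CARD('a) = 2 ^ n" and f: "framedg g F B w"
  shows "bitangent_degree F = gdeg g"
proof -
  have fr: "framed F B w" using f by (simp add: framedg_def)
  have g: "mdet (cof g) = 1" using framedg_frob(1)[OF hq f] by (simp add: mdet_cof)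
  have nz: "(mv (cof g) ^^ d) e = (0,0,0) \<longleftrightarrow> e = (0,0,0)" for d e
    by (induction d) (simp_all add: bit_mv_eq_0[OF g])
  have "(\<forall>L\<in>bitangents F. frob d L = L) \<longleftrightarrow> (\<forall>e. (mv (cof g) ^^ d) e = e)" for d
  proof -
    have "(\<forall>L\<in>bitangents F. frob d L = L) \<longleftrightarrow> (\<forall>e. e \<noteq> (0,0,0) \<longrightarrow> bline B ((mv (cof g) ^^ d) e) = bline B e)"
      unfolding framed_bitangents[OF hq fr] by (simp add: frob_bline[OF hq f] set_npts)
    also have "\<dots> \<longleftrightarrow> (\<forall>e. e \<noteq> (0,0,0) \<longrightarrow> (mv (cof g) ^^ d) e = e)"
      using bline_inj[OF framedD(1)[OF fr]] nz by metis
    also have "\<dots> \<longleftrightarrow> (\<forall>e. (mv (cof g) ^^ d) e = e)" using nz by metis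
    finally show ?thesis .
  qed
  thus ?thesis unfolding bitangent_degree_def gdeg_def by simp
qed

definition gconc :: "nat \<Rightarrow> nat \<Rightarrow> bit mat3 \<Rightarrow> bool" where
  "gconc i j g \<longleftrightarrow> (\<exists>e. e \<noteq> (0,0,0) \<and> mdet (e, (mv (cof g) ^^ i) e, (mv (cof g) ^^ j) e) = 0)"

text \<open>Passing from lines to labels changes the determinant by nonzero factors only, so
  concurrence becomes linear dependence over F_2.\<close>

lemma bitangent_concurrent_eq:
  fixes F :: "_ \<Rightarrow> 'a::{finite,field}"
  assumes hq: "\<exists>n. CARD('a) = 2 ^ n" and f: "framedg g F B w"
  shows "(\<exists>L\<in>bitangents F. concurrent3 L (frob i L) (frob j L)) \<longleftrightarrow> gconc i j g"
proof -
  note rb = ring_map_eb[OF two_eq_0[OF hq]]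
  have fr: "framed F B w" using f by (simp add: framedg_def)
  have g: "mdet (cof g) = 1" using framedg_frob(1)[OF hq f] by (simp add: mdet_cof)
  have dC: "mdet (cof B) \<noteq> 0" using framedD(1)[OF fr] by (simp add: mdet_cof)
  have nz: "(mv (cof g) ^^ d) e = (0,0,0) \<longleftrightarrow> e = (0,0,0)" for d e
    by (induction d) (simp_all add: bit_mv_eq_0[OF g])
  have sc: "\<exists>s. s \<noteq> 0 \<and> bline B e = vscale s (mv (cof B) (bv e))" if "e \<noteq> (0,0,0)" for e
    unfolding bline_def by (rule nrm_scale) (simp add: mv_eq_0_iff[OF dC] that)
  have md: "mdet (vscale a u, vscale b v, vscale c x) = a * b * c * mdet (u,v,x)" for a b c and u v x :: "'a alg_closure pt"
    by (cases u; cases v; cases x) (simp add: algebra_simps)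
  have conc: "concurrent3 (bline B e1) (bline B e2) (bline B e3) \<longleftrightarrow> mdet (e1,e2,e3) = 0"
    if e: "e1 \<noteq> (0,0,0)" "e2 \<noteq> (0,0,0)" "e3 \<noteq> (0,0,0)" for e1 e2 e3
  proof -
    obtain s1 where s1: "s1 \<noteq> 0" "bline B e1 = vscale s1 (mv (cof B) (bv e1))" using sc[OF e(1)] by blast
    obtain s2 where s2: "s2 \<noteq> 0" "bline B e2 = vscale s2 (mv (cof B) (bv e2))" using sc[OF e(2)] by blast
    obtain s3 where s3: "s3 \<noteq> 0" "bline B e3 = vscale s3 (mv (cof B) (bv e3))" using sc[OF e(3)] by blast
    have "concurrent3 (bline B e1) (bline B e2) (bline B e3) \<longleftrightarrow> mdet (bline B e1, bline B e2, bline B e3) = 0"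
      by (simp only: concurrent3_def mdet_rows)
    also have "\<dots> \<longleftrightarrow> mdet (mv (cof B) (bv e1), mv (cof B) (bv e2), mv (cof B) (bv e3)) = 0"
      unfolding s1 s2 s3 md using s1 s2 s3 by simp
    also have "(mv (cof B) (bv e1), mv (cof B) (bv e2), mv (cof B) (bv e3)) = mm (bv e1, bv e2, bv e3) (transp (cof B))"
      by (simp add: mm_rows)
    also have "mdet \<dots> = mdet (bm (e1,e2,e3)) * mdet (cof B)" by (simp add: mdet_mm)
    also have "\<dots> = 0 \<longleftrightarrow> mdet (e1,e2,e3) = 0" using dC by (simp only: mdet_mmap[OF rb]) simp
    finally show ?thesis .
  qed
  have "(\<exists>L\<in>bitangents F. concurrent3 L (frob i L) (frob j L)) \<longleftrightarrow>
     (\<exists>e. e \<noteq> (0,0,0) \<and> concurrent3 (bline B e) (bline B ((mv (cof g) ^^ i) e)) (bline B ((mv (cof g) ^^ j) e)))"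
    unfolding framed_bitangents[OF hq fr] by (simp add: frob_bline[OF hq f] set_npts)
  also have "\<dots> \<longleftrightarrow> gconc i j g" unfolding gconc_def using conc nz by metis
  finally show ?thesis .
qed

lemma ordinary_framedg:
  fixes F :: "_ \<Rightarrow> 'a::{finite,field}"
  assumes hq: "\<exists>n. CARD('a) = 2 ^ n" and F: "F \<in> ordinary_quartics"
  obtains g B w where "framedg g F B w"
proof -
  obtain B w where f: "framed F B w" using ordinary_framed[OF hq F] by blast
  thus ?thesis using framed_frob[OF hq f] that unfolding framedg_def by metis
qed

section \<open>Isomorphism classes as orbits of centralisers\<close>

abbreviation iso_rel :: "('a::{finite,field} quartic \<times> _) set" where
  "iso_rel \<equiv> {(F, G). F \<in> ordinary_quartics \<and> G \<in> ordinary_quartics \<and> k_isomorphic F G}"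

text \<open>Isomorphic quartics have frames with the same \<open>g\<close> and \<open>w\<close>, and
  quartics with such frames are isomorphic; the laws of an equivalence follow without composing or
  inverting isomorphisms.\<close>

lemma equiv_iso_rel:
  assumes hq: "\<exists>n. CARD('a::{finite,field}) = 2 ^ n"
  shows "equiv (ordinary_quartics :: 'a quartic set) iso_rel"
proof (rule equivI)
  show "iso_rel \<subseteq> (ordinary_quartics :: 'a quartic set) \<times> ordinary_quartics" by auto
  show "refl_on (ordinary_quartics :: 'a quartic set) iso_rel"
  proof (rule refl_onI)
    fix F :: "'a quartic" assume F: "F \<in> ordinary_quartics"
    then obtain g B w where "framedg g F B w" using ordinary_framedg[OF hq] by blast
    thus "(F, F) \<in> iso_rel" using F framedg_isomorphic[OF hq] by blast
  qed
  show "sym (iso_rel :: ('a quartic \<times> _) set)"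
  proof (rule symI)
    fix F G :: "'a quartic" assume FG: "(F, G) \<in> iso_rel"
    then obtain g B w where f: "framedg g F B w" using ordinary_framedg[OF hq] by blast
    then obtain B' where "framedg g G B' w" using isomorphic_framedg[OF hq f] FG by blast
    thus "(G, F) \<in> iso_rel" using FG f framedg_isomorphic[OF hq] by blast
  qed
  show "trans (iso_rel :: ('a quartic \<times> _) set)"
  proof (rule transI)
    fix F G H :: "'a quartic" assume FG: "(F, G) \<in> iso_rel" and GH: "(G, H) \<in> iso_rel"
    then obtain g B w where f: "framedg g F B w" using ordinary_framedg[OF hq] by blast
    then obtain B' where f': "framedg g G B' w" using isomorphic_framedg[OF hq f] FG by blast
    then obtain B'' where "framedg g H B'' w" using isomorphic_framedg[OF hq f'] GH by blast
    thus "(F, H) \<in> iso_rel" using FG GH f framedg_isomorphic[OF hq] by blast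
  qed
qed

definition wset :: "nat \<Rightarrow> bit mat3 \<Rightarrow> (bit pt \<Rightarrow> 'b::field) set" where
  "wset q g = {w. admissible w \<and> (\<forall>v. w (mv g v) = w v ^ q)}"

definition cent :: "bit mat3 \<Rightarrow> bit mat3 set" where
  "cent g = {h. mdet h = 1 \<and> mm h g = mm g h}"

definition typed_classes :: "bit mat3 \<Rightarrow> 'a::{finite,field} quartic set set" where
  "typed_classes g = {Cl \<in> iso_classes. \<exists>F\<in>Cl. \<exists>B w. framedg g F B w}"

lemma framedg_change:
  fixes F :: "_ \<Rightarrow> 'a::{finite,field}"
  assumes hq: "\<exists>n. CARD('a) = 2 ^ n" and f: "framedg g F B w" and h: "mdet h = 1" and c: "mm g h = mm h g'"
  shows "framedg g' F (mm B (bm h)) (w \<circ> mv h)"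
proof -
  note r = ring_map_frob1[OF hq] and rb = ring_map_eb[OF two_eq_0[OF hq]]
  have fr: "framed F B w" "mpw CARD('a) B = mm B (bm g)" using f by (simp_all add: framedg_def)
  have "mpw CARD('a) (mm B (bm h)) = mm B (bm (mm g h))"
    by (simp add: mmap_mm[OF r] fr card_pos_field mmap_mm[OF rb] mm_assoc)
  also have "\<dots> = mm (mm B (bm h)) (bm g')" by (simp add: c mmap_mm[OF rb] mm_assoc)
  finally show ?thesis using framed_change[OF hq fr(1) h] by (simp add: framedg_def)
qed

lemma framedg_unique:
  fixes F :: "_ \<Rightarrow> 'a::{finite,field}"
  assumes hq: "\<exists>n. CARD('a) = 2 ^ n" and f: "framedg g F B w" and f': "framedg g F B' w'"
  obtains h where "h \<in> cent g" "w' = w \<circ> mv h"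
proof -
  note r = ring_map_frob1[OF hq] and rb = ring_map_eb[OF two_eq_0[OF hq]]
  have fr: "framed F B w" "mpw CARD('a) B = mm B (bm g)" "framed F B' w'" "mpw CARD('a) B' = mm B' (bm g)"
    using f f' by (simp_all add: framedg_def)
  obtain h where h: "mdet h = 1" "B' = mm B (bm h)" "w' = w \<circ> mv h" using framed_unique[OF hq fr(1,3)] by blast
  have "mm B (bm (mm g h)) = mpw CARD('a) B'"
    by (simp add: h mmap_mm[OF r] fr card_pos_field mmap_mm[OF rb] mm_assoc)
  also have "\<dots> = mm B (bm (mm h g))" by (simp add: fr(4)) (simp add: h mmap_mm[OF rb] mm_assoc)
  finally have "bm (mm g h) = (bm (mm h g) :: 'a alg_closure mat3)" by (rule mm_left_cancel[OF framedD(1)[OF fr(1)]])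
  hence "mm g h = mm h g" by (simp only: bm_eq_iff)
  hence "h \<in> cent g" using h(1) by (simp add: cent_def)
  thus ?thesis using h(3) by (rule that)
qed

lemma framedg_wset:
  fixes F :: "_ \<Rightarrow> 'a::{finite,field}"
  assumes hq: "\<exists>n. CARD('a) = 2 ^ n" and f: "framedg g F B w"
  shows "w \<in> wset CARD('a) g"
  using framedg_frob(2)[OF hq f] f framedD(2) unfolding wset_def framedg_def by blast

definition worbits :: "nat \<Rightarrow> bit mat3 \<Rightarrow> (bit pt \<Rightarrow> 'b::field) set set" where
  "worbits q g = (\<lambda>w. {w \<circ> mv h |h. h \<in> cent g}) ` wset q g"

text \<open>A class is sent to the weights of all frames of type \<open>g\<close> of its members. By
  \<open>framedg_unique\<close> and \<open>framedg_change\<close> these form one orbit of the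
  centraliser; injectivity is \<open>framedg_isomorphic\<close>, surjectivity is
  \<open>framedg_exists\<close>.\<close>

lemma card_typed_classes:
  assumes hq: "\<exists>n. CARD('a::{finite,field}) = 2 ^ n" and g: "mdet g = 1"
  shows "card (typed_classes g :: 'a quartic set set)
       = card (worbits CARD('a) g :: (bit pt \<Rightarrow> 'a alg_closure) set set)"
proof -
  define \<Phi> where "\<Phi> Cl = {w. \<exists>F\<in>Cl. \<exists>B. framedg g F B w}" for Cl :: "'a quartic set"
  note eqv = equiv_iso_rel[OF hq]
  have Phi: "\<Phi> Cl = {w0 \<circ> mv h |h. h \<in> cent g}"
    if Cl: "Cl \<in> iso_classes" "F0 \<in> Cl" "framedg g F0 B0 w0" for Cl F0 B0 w0
  proof (intro equalityI subsetI)
    fix w assume "w \<in> \<Phi> Cl"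
    then obtain F B where F: "F \<in> Cl" "framedg g F B w" unfolding \<Phi>_def by blast
    have "(F0, F) \<in> iso_rel" using quotient_eq_iff[OF eqv _ _ Cl(2) F(1)] Cl(1) unfolding iso_classes_def by blast
    then obtain B' where "framedg g F B' w0" using isomorphic_framedg[OF hq Cl(3)] by blast
    then obtain h where "h \<in> cent g" "w = w0 \<circ> mv h" using framedg_unique[OF hq _ F(2)] by blast
    thus "w \<in> {w0 \<circ> mv h |h. h \<in> cent g}" by blast
  next
    fix w assume "w \<in> {w0 \<circ> mv h |h. h \<in> cent g}"
    then obtain h where h: "h \<in> cent g" "w = w0 \<circ> mv h" by blast
    have "framedg g F0 (mm B0 (bm h)) w" unfolding h(2)
      by (rule framedg_change[OF hq Cl(3)]) (use h(1) in \<open>simp_all add: cent_def\<close>)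
    thus "w \<in> \<Phi> Cl" using Cl(2) unfolding \<Phi>_def by blast
  qed
  have mem: "mI \<in> cent g" by (simp add: cent_def)
  have "bij_betw \<Phi> (typed_classes g) (worbits CARD('a) g)"
  proof (rule bij_betw_imageI)
    show "inj_on \<Phi> (typed_classes g)"
    proof (rule inj_onI)
      fix Cl Cl' assume C: "Cl \<in> typed_classes g" "Cl' \<in> typed_classes g" and e: "\<Phi> Cl = \<Phi> Cl'"
      then obtain F B w where F: "F \<in> Cl" "framedg g F B w" unfolding typed_classes_def by blast
      hence "w \<in> \<Phi> Cl" unfolding \<Phi>_def by blast
      hence "w \<in> \<Phi> Cl'" unfolding e .
      then obtain F' B' where F': "F' \<in> Cl'" "framedg g F' B' w" unfolding \<Phi>_def by blast
      have i: "k_isomorphic F F'" by (rule framedg_isomorphic[OF hq F(2) F'(2)])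
      have Q: "Cl \<in> ordinary_quartics // iso_rel" "Cl' \<in> ordinary_quartics // iso_rel"
        using C unfolding typed_classes_def iso_classes_def by blast+
      have "F \<in> ordinary_quartics" "F' \<in> ordinary_quartics" using Q F(1) F'(1) eqv in_quotient_imp_subset by blast+
      hence "(F, F') \<in> iso_rel" using i by blast
      thus "Cl = Cl'" using quotient_eqI[OF eqv Q F(1) F'(1)] by blast
    qed
    show "\<Phi> ` typed_classes g = worbits CARD('a) g"
    proof (intro equalityI subsetI)
      fix S assume "S \<in> \<Phi> ` typed_classes g"
      then obtain Cl F B w where "S = \<Phi> Cl" "Cl \<in> iso_classes" "F \<in> Cl" and f: "framedg g F B w" unfolding typed_classes_def by blast
      hence "S = {w \<circ> mv h |h. h \<in> cent g}" using Phi by blast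
      thus "S \<in> worbits CARD('a) g" using framedg_wset[OF hq f] unfolding worbits_def by blast
    next
      fix S :: "(bit pt \<Rightarrow> 'a alg_closure) set" assume "S \<in> worbits CARD('a) g"
      then obtain w where w: "w \<in> wset CARD('a) g" "S = {w \<circ> mv h |h. h \<in> cent g}" unfolding worbits_def by blast
      obtain F :: "_ \<Rightarrow> 'a" and B where F: "is_quartic_form F" "framedg g F B w"
        using framedg_exists[OF hq g, of w] w(1) unfolding wset_def by blast
      have o: "F \<in> ordinary_quartics" using framed_ordinary[OF hq _ F(1)] F(2) unfolding framedg_def by blast
      define Cl where "Cl = iso_rel `` {F}"
      have "Cl \<in> iso_classes" unfolding iso_classes_def Cl_def using o by (rule quotientI)
      moreover have "F \<in> Cl" unfolding Cl_def using equiv_class_self[OF eqv o] .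
      ultimately have "Cl \<in> typed_classes g" "\<Phi> Cl = S" using Phi F(2) w(2) unfolding typed_classes_def by blast+
      thus "S \<in> \<Phi> ` typed_classes g" by blast
    qed
  qed
  thus ?thesis by (rule bij_betw_same_card)
qed

section \<open>Orbit counting by Burnside's lemma\<close>

lemma finite_bit_mat: "finite (UNIV :: bit mat3 set)"
  using finite_bit_pt by (simp add: finite_prod)

lemma mm_right_inverse_bit: "mdet g = 1 \<Longrightarrow> mm g (minv g) = mI" "mdet g = 1 \<Longrightarrow> mm (minv g) g = mI" for g :: "bit mat3"
  by (simp_all add: mm_minv)

text \<open>\<open>g\<close> has a finite period m on the points, so all values lie in the field
  with q^m elements.\<close>

lemma finite_wset:
  assumes c2: "(2::'b::alg_closed_field) = 0" and q: "q = 2 ^ n" "n > 0" and g: "mdet g = 1"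
  shows "finite (wset q g :: (bit pt \<Rightarrow> 'b) set)"
proof -
  have "bij (mv g)"
    by (rule o_bij[of "mv (minv g)"]) (auto simp: fun_eq_iff mm_right_inverse_bit[OF g] simp flip: mv_mm)
  hence "permutation (mv g)" unfolding permutation using finite_bit_pt by (metis finite_subset subset_UNIV)
  then obtain m where m: "mv g ^^ m = id" "m > 0" using permutation_is_nilpotent by blast
  define S where "S = {c::'b. c ^ (q ^ m) = c}"
  have "card S = q ^ m" unfolding S_def q power_mult[symmetric] using card_power_fixed[OF c2, of "n * m"] q m by simp
  hence finS: "finite S" using q by (intro card_ge_0_finite) simp
  have "wset q g \<subseteq> {w. \<forall>v. w v \<in> S}"
  proof (intro subsetI CollectI allI)
    fix w :: "bit pt \<Rightarrow> 'b" and v assume w: "w \<in> wset q g"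
    have "w ((mv g ^^ i) v) = w v ^ (q ^ i)" for i
      using w by (induction i) (simp_all add: wset_def mult.commute flip: power_mult)
    from this[of m] show "w v \<in> S" by (simp add: m S_def)
  qed
  moreover have "finite {w :: bit pt \<Rightarrow> 'b. \<forall>v. w v \<in> S}"
    using finite_PiE[OF finite_bit_pt, of "\<lambda>_. S"] finS by (simp add: PiE_def Pi_def)
  ultimately show ?thesis by (rule finite_subset)
qed

lemma wset_comp:
  assumes c2: "(2::'b::field) = 0" and w: "(w :: _ \<Rightarrow> 'b) \<in> wset q g" and h: "h \<in> cent g"
  shows "w \<circ> mv h \<in> wset q g"
proof -
  have "admissible (w \<circ> mv h)" using admissible_comp[OF c2] w h by (simp add: wset_def cent_def)
  moreover have "w (mv h (mv g v)) = w (mv h v) ^ q" for v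
    using w h by (simp add: wset_def cent_def flip: mv_mm) (simp add: mv_mm)
  ultimately show ?thesis by (simp add: wset_def)
qed

lemma card_worbits:
  assumes c2: "(2::'b::alg_closed_field) = 0" and q: "q = 2 ^ n" "n > 0" and g: "mdet g = 1"
  shows "card (worbits q g :: (bit pt \<Rightarrow> 'b) set set) * card (cent g)
     = (\<Sum>h\<in>cent g. card {w :: bit pt \<Rightarrow> 'b. w \<in> wset q g \<and> w \<circ> mv h = w})"
proof -
  \<comment> \<open>Composition with \<open>mv h\<close> acts from the right, so the product is
    reversed. The maps are restricted to \<open>W\<close> below because the elements of
    \<open>BijGroup W\<close> are extensional.\<close>
  define G :: "bit mat3 monoid" where "G = \<lparr>carrier = cent g, monoid.mult = (\<lambda>h k. mm k h), one = mI\<rparr>"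
  define W where "W = (wset q g :: (bit pt \<Rightarrow> 'b) set)"
  define \<phi> where "\<phi> h = restrict (\<lambda>w. w \<circ> mv h) W" for h
  have cl: "mm k h \<in> cent g" if "h \<in> cent g" "k \<in> cent g" for h k
    using that unfolding cent_def by (simp add: mdet_mm) (metis mm_assoc)
  have inv: "minv h \<in> cent g" if "h \<in> cent g" for h
  proof -
    have h: "mdet h = 1" "mm h g = mm g h" using that by (simp_all add: cent_def)
    have "mdet (minv h) = 1" using mdet_minv[of h] h by simp
    moreover have "mm (minv h) g = mm g (minv h)"
    proof -
      have "mm (minv h) (mm (mm h g) (minv h)) = mm (minv h) (mm (mm g h) (minv h))" by (simp only: h)
      thus ?thesis using mm_right_inverse_bit[OF h(1)] by (metis mm_assoc mm_mI)
    qed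
    ultimately show ?thesis by (simp add: cent_def)
  qed
  have grp: "group G"
  proof (rule groupI)
    show "\<exists>y\<in>carrier G. y \<otimes>\<^bsub>G\<^esub> x = \<one>\<^bsub>G\<^esub>" if "x \<in> carrier G" for x
      using inv[of x] that mm_right_inverse_bit(1)[of x] by (intro bexI[of _ "minv x"]) (auto simp: G_def cent_def)
    show "\<one>\<^bsub>G\<^esub> \<in> carrier G" by (simp add: G_def cent_def)
    show "x \<otimes>\<^bsub>G\<^esub> y \<in> carrier G" if "x \<in> carrier G" "y \<in> carrier G" for x y using that cl by (simp add: G_def)
    show "x \<otimes>\<^bsub>G\<^esub> y \<otimes>\<^bsub>G\<^esub> z = x \<otimes>\<^bsub>G\<^esub> (y \<otimes>\<^bsub>G\<^esub> z)" for x y z by (simp add: G_def mm_assoc)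
    show "\<one>\<^bsub>G\<^esub> \<otimes>\<^bsub>G\<^esub> x = x" for x by (simp add: G_def)
  qed
  have act: "w \<circ> mv h \<in> W" if "w \<in> W" "h \<in> cent g" for w h
    using wset_comp[OF c2] that by (simp add: W_def)
  have comp: "(w \<circ> mv k) \<circ> mv h = w \<circ> mv (mm k h)" for w :: "bit pt \<Rightarrow> 'b" and h k by (simp add: fun_eq_iff mv_mm)
  have bij: "bij_betw (\<phi> h) W W" if h: "h \<in> cent g" for h
  proof (rule bij_betw_byWitness[where f' = "\<phi> (minv h)"])
    have 1: "mdet h = 1" using h by (simp add: cent_def)
    show "\<forall>a\<in>W. \<phi> (minv h) (\<phi> h a) = a" "\<forall>a'\<in>W. \<phi> h (\<phi> (minv h) a') = a'"
      using act h inv[OF h] by (simp_all add: \<phi>_def comp mm_right_inverse_bit[OF 1] fun_eq_iff)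
    show "\<phi> h ` W \<subseteq> W" "\<phi> (minv h) ` W \<subseteq> W" using h inv[OF h] by (auto simp: \<phi>_def intro!: act)
  qed
  have "group_hom G (BijGroup W) \<phi>"
  proof (intro group_hom.intro group_hom_axioms.intro grp group_BijGroup homI)
    show "\<phi> h \<in> carrier (BijGroup W)" if "h \<in> carrier G" for h
      using bij[of h] that by (simp add: BijGroup_def Bij_def \<phi>_def G_def extensional_def)
    show "\<phi> (h \<otimes>\<^bsub>G\<^esub> k) = \<phi> h \<otimes>\<^bsub>BijGroup W\<^esub> \<phi> k" if "h \<in> carrier G" "k \<in> carrier G" for h k
      using bij[of h] bij[of k] that act
      by (simp add: BijGroup_def Bij_def G_def restrict_def fun_eq_iff compose_def \<phi>_def extensional_def mv_mm)
  qed
  then interpret group_action G W \<phi> by (simp add: group_action_def)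
  have orb: "orbits G W \<phi> = worbits q g"
    unfolding orbits_def orbit_def worbits_def by (auto simp: \<phi>_def W_def G_def)
  have "card (orbits G W \<phi>) * Coset.order G = (\<Sum>h\<in>carrier G. card (invariants W \<phi> h))"
  proof (rule burnside)
    show "finite (carrier G)" using finite_bit_mat by (metis finite_subset subset_UNIV)
    show "finite W" unfolding W_def by (rule finite_wset[OF c2 q g])
  qed
  moreover have "invariants W \<phi> h = {w. w \<in> W \<and> w \<circ> mv h = w}" for h
    by (auto simp: invariants_def \<phi>_def)
  ultimately show ?thesis unfolding orb by (simp add: Coset.order_def G_def W_def)
qed


subsection \<open>Counting equivariant weights\<close>

text \<open>On \<open>fset q d\<close>, the field with q^d elements, this is the trace to
  F_q.\<close>

definition trq :: "nat \<Rightarrow> nat \<Rightarrow> 'b::field \<Rightarrow> 'b" where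
  "trq q d x = (\<Sum>e<d. x ^ (q ^ e))"

definition fset :: "nat \<Rightarrow> nat \<Rightarrow> 'b::field set" where
  "fset q d = {x. x ^ (q ^ d) = x}"

text \<open>Functions are 0 outside \<open>U\<close>, so that those on disjoint sets can be added
  pointwise.\<close>

definition eqv :: "nat \<Rightarrow> bit mat3 \<Rightarrow> bit mat3 \<Rightarrow> bit pt set \<Rightarrow> (bit pt \<Rightarrow> 'b::field) set" where
  "eqv q g h U = {w. (\<forall>v. v \<notin> U \<longrightarrow> w v = 0) \<and> (\<forall>v\<in>U. w v \<noteq> 0 \<and> w (mv h v) = w v \<and> w (mv g v) = w v ^ q)}"

lemma eqvD:
  assumes "w \<in> eqv q g h U" "v \<in> U"
  shows "w v \<noteq> 0" "w (mv h v) = w v" "w (mv g v) = w v ^ q"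
  using assms unfolding eqv_def by blast+

definition eqv_sum :: "nat \<Rightarrow> bit mat3 \<Rightarrow> bit mat3 \<Rightarrow> bit pt set \<Rightarrow> 'b::field \<Rightarrow> (bit pt \<Rightarrow> 'b) set" where
  "eqv_sum q g h U s = {w \<in> eqv q g h U. sum w U = s}"

text \<open>Only s = 0 is exceptional: on one orbit the sums are either equidistributed, apart from
  the excluded zero function, or identically 0.\<close>

definition eqv_type :: "'b::field itself \<Rightarrow> nat \<Rightarrow> bit mat3 \<Rightarrow> bit mat3 \<Rightarrow> bit pt set \<Rightarrow> real \<Rightarrow> real \<Rightarrow> bool" where
  "eqv_type T q g h U \<alpha> \<beta> \<longleftrightarrow> finite (eqv q g h U :: (bit pt \<Rightarrow> 'b) set) \<and> (\<forall>s::'b. s ^ q = s \<longrightarrow> real (card (eqv_sum q g h U s)) = \<alpha> + (if s = 0 then \<beta> else 0))"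

text \<open>An orbit of two commuting matrices: each block is a cycle of \<open>h\<close>, and \<open>g\<close> permutes the blocks cyclically.\<close>

definition orbit_ok :: "bit mat3 \<Rightarrow> bit mat3 \<Rightarrow> bit pt list list \<Rightarrow> bool" where
  "orbit_ok g h bs \<longleftrightarrow> bs \<noteq> [] \<and> hd bs \<noteq> [] \<and> distinct (concat bs) \<and>
     list_all (\<lambda>b. length b = length (hd bs) \<and> map (mv h) b = rotate1 b) bs \<and>
     list_all2 (\<lambda>b b'. list_all (\<lambda>v. mv g v \<in> set b') b) bs (rotate1 bs)"

lemma bex_set_nth: "(\<exists>b\<in>set bs. P b) \<longleftrightarrow> (\<exists>e<length bs. P (bs ! e))"
  by (metis in_set_conv_nth)

lemma distinct_concat_nth_disjoint:
  "distinct (concat bs) \<Longrightarrow> i < length bs \<Longrightarrow> j < length bs \<Longrightarrow> i \<noteq> j \<Longrightarrow> set (bs ! i) \<inter> set (bs ! j) = {}"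
proof (induction bs arbitrary: i j)
  case (Cons b bs)
  show ?case
  proof (cases i; cases j)
    fix j' assume "i = 0" "j = Suc j'"
    thus ?thesis using Cons.prems by (fastforce dest: nth_mem)
  next
    fix i' assume "i = Suc i'" "j = 0"
    thus ?thesis using Cons.prems by (fastforce dest: nth_mem)
  qed (use Cons in auto)
qed simp

text \<open>The number of equivariant functions with sum \<open>s\<close> is \<open>\<alpha> + \<beta>[s = 0]\<close>. For an orbit of \<open>d\<close> blocks of size \<open>m\<close>
  the sum is \<open>m\<close> times a trace from \<open>\<bbbF>\<^bsub>q^d\<^esub>\<close>; for disjoint unions these counts are convolved over \<open>\<bbbF>\<^sub>q\<close>.\<close>

definition orbit_ab :: "nat \<Rightarrow> nat \<Rightarrow> nat \<Rightarrow> real \<times> real" where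
  "orbit_ab q d m = (if odd m then (real q ^ (d - 1), -1) else (0, real q ^ d - 1))"

text \<open>The pair \<open>(0, 1)\<close> counts the empty function, whose sum is 0, and is the
  unit of convolution.\<close>

fun conv_ab :: "nat \<Rightarrow> (nat \<times> nat) list \<Rightarrow> real \<times> real" where
  "conv_ab q [] = (0, 1)"
| "conv_ab q ((d, m) # xs) = (case orbit_ab q d m of (a1, b1) \<Rightarrow> case conv_ab q xs of (a2, b2) \<Rightarrow>
     (real q * a1 * a2 + a1 * b2 + b1 * a2, b1 * b2))"

definition orbit_shape :: "'x list list \<Rightarrow> nat \<times> nat" where
  "orbit_shape bs = (length bs, length (hd bs))"

context
  fixes q n :: nat and T :: "'b::alg_closed_field itself"
  assumes c2: "(2::'b) = 0" and q: "q = 2 ^ n" and n: "n > 0"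
begin

lemma q1: "q > 1" using q n one_less_power[of "2::nat" n] by simp

lemma frob_ring: "ring_map (\<lambda>x::'b. x ^ (q ^ d))"
  using ring_map_power2[OF c2, of "n * d"] by (simp add: q power_mult)

lemma frob_ring1: "ring_map (\<lambda>x::'b. x ^ q)" using frob_ring[of 1] by simp

lemma card_fset: "d > 0 \<Longrightarrow> card (fset q d :: 'b set) = q ^ d"
  unfolding fset_def using card_power_fixed[OF c2, of "n * d"] n by (simp add: q power_mult)

lemma finite_fset: "d > 0 \<Longrightarrow> finite (fset q d :: 'b set)"
  using card_fset q1 by (metis card.infinite power_not_zero not_one_less_zero)

lemma card_k: "card {s::'b. s ^ q = s} = q"
  using card_fset[of 1] by (simp add: fset_def)

lemma finite_k: "finite {s::'b. s ^ q = s}"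
  using finite_fset[of 1] by (simp add: fset_def)

lemma trq_in_k: assumes "x \<in> fset q d" shows "trq q d x ^ q = (trq q d x :: 'b)"
proof (cases d)
  case 0 thus ?thesis using q1 by (simp add: trq_def)
next
  case (Suc d')
  have "trq q d x ^ q = (\<Sum>e<d. x ^ (q ^ Suc e))"
    unfolding trq_def ring_map_sum[OF frob_ring1] by (simp add: mult.commute flip: power_mult)
  also have "\<dots> = (\<Sum>e<d'. x ^ (q ^ Suc e)) + x" using assms by (simp add: Suc fset_def)
  also have "\<dots> = trq q d x" unfolding trq_def Suc sum.lessThan_Suc_shift by simp
  finally show ?thesis .
qed

text \<open>Each fibre lies in the root set of a polynomial of degree at most q^(d-1), and the q
  fibres over F_q cover all q^d elements, so none can be smaller.\<close>

lemma card_trace_fibre: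
  assumes d: "d > 0" and s: "s ^ q = (s::'b)"
  shows "card {x \<in> fset q d. trq q d x = s} = q ^ (d - 1)"
proof -
  define f where "f s = card {x \<in> fset q d. trq q d x = (s::'b)}" for s
  have le: "f s \<le> q ^ (d - 1)" for s
  proof -
    define p where "p = (\<Sum>i<d. Polynomial.monom 1 (q ^ i)) - [:s:]"
    have "Polynomial.coeff (\<Sum>i<d. Polynomial.monom (1::'b) (q ^ i)) 1 = (\<Sum>i<d. if i = 0 then 1 else 0)"
      unfolding coeff_sum using q1 by (intro sum.cong) (auto simp: power_eq_1_iff)
    also have "\<dots> = 1" using d by simp
    finally have "Polynomial.coeff p 1 = 1" by (simp add: p_def)
    hence p0: "p \<noteq> 0" by auto
    have "{x \<in> fset q d. trq q d x = s} \<subseteq> {x. poly p x = 0}"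
      by (auto simp: p_def poly_sum poly_monom trq_def)
    hence "f s \<le> card {x. poly p x = 0}" unfolding f_def by (intro card_mono poly_roots_finite p0)
    also have "\<dots> \<le> Polynomial.degree p" by (rule card_poly_roots_bound[OF p0])
    also have "\<dots> \<le> q ^ (d - 1)" unfolding p_def
      by (intro degree_diff_le degree_sum_le) (use q1 in \<open>auto intro!: order.trans[OF degree_monom_le] power_increasing\<close>)
    finally show ?thesis .
  qed
  have "(\<Sum>s\<in>{s::'b. s ^ q = s}. f s) = card (\<Union>s\<in>{s::'b. s ^ q = s}. {x \<in> fset q d. trq q d x = s})"
    unfolding f_def by (intro card_UN_disjoint[symmetric] finite_k ballI impI) (use finite_fset[OF d] in auto)
  also have "(\<Union>s\<in>{s::'b. s ^ q = s}. {x \<in> fset q d. trq q d x = s}) = fset q d" using trq_in_k by auto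
  also have "card (fset q d :: 'b set) = (\<Sum>s\<in>{s::'b. s ^ q = s}. q ^ (d - 1))"
    using d by (cases d) (simp_all add: card_fset card_k)
  finally have "(\<Sum>s\<in>{s::'b. s ^ q = s}. f s) = (\<Sum>s\<in>{s::'b. s ^ q = s}. q ^ (d - 1))" .
  hence "f s = q ^ (d - 1)" using le s finite_k
    by (metis (mono_tags, lifting) mem_Collect_eq sum_mono_inv)
  thus ?thesis by (simp add: f_def)
qed

text \<open>Invariance under \<open>h\<close> makes w constant on blocks, and \<open>g\<close>
  raises it to the q-th power from one block to the next. So w is determined by one value x, and
  returning after d blocks imposes x^(q^d) = x. Every block contributes m equal summands, whence m
  times the trace.\<close>

lemma eqv_orbit:
  assumes ok: "orbit_ok g h bs"
  defines "U \<equiv> set (concat bs)" and "d \<equiv> length bs" and "m \<equiv> length (hd bs)"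
  shows "bij_betw (\<lambda>w. w (hd (hd bs))) (eqv q g h U :: (bit pt \<Rightarrow> 'b) set) (fset q d - {0})"
    and "w \<in> eqv q g h U \<Longrightarrow> sum w U = of_nat m * trq q d (w (hd (hd bs)) :: 'b)"
    and "v \<in> U \<Longrightarrow> mv g v \<in> U" and "v \<in> U \<Longrightarrow> mv h v \<in> U" and "d > 0"
proof -
  let ?r = "hd (hd bs)"
  have bs0: "bs \<noteq> []" "hd bs \<noteq> []" and dist: "distinct (concat bs)"
    and L: "list_all (\<lambda>b. length b = m \<and> map (mv h) b = rotate1 b) bs"
    and g2: "list_all2 (\<lambda>b b'. list_all (\<lambda>v. mv g v \<in> set b') b) bs (rotate1 bs)"
    using ok unfolding orbit_ok_def m_def by simp_all
  have len: "\<And>b. b \<in> set bs \<Longrightarrow> length b = m" and hrot: "\<And>b. b \<in> set bs \<Longrightarrow> map (mv h) b = rotate1 b"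
    using L by (simp_all add: list_all_iff)
  show d0: "d > 0" using bs0 by (simp add: d_def)
  have m0: "m > 0" using bs0 by (simp add: m_def)
  have gb: "mv g v \<in> set (bs ! (Suc e mod d))" if "e < d" "v \<in> set (bs ! e)" for e v
    using list_all2_nthD[OF g2, of e] that by (simp add: d_def nth_rotate1 list_all_iff)
  have hb: "mv h v \<in> set (bs ! e)" if "e < d" "v \<in> set (bs ! e)" for e v
  proof -
    have "mv h v \<in> set (map (mv h) (bs ! e))" using that(2) by simp
    also have "map (mv h) (bs ! e) = rotate1 (bs ! e)" using that(1) by (intro hrot) (simp add: d_def)
    finally show ?thesis by simp
  qed
  have U: "v \<in> U \<longleftrightarrow> (\<exists>e<d. v \<in> set (bs ! e))" for v
    unfolding U_def d_def set_concat UN_iff by (rule bex_set_nth)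
  have uniq: "e = e'" if "e < d" "e' < d" "v \<in> set (bs ! e)" "v \<in> set (bs ! e')" for e e' v
  proof (rule ccontr)
    assume "e \<noteq> e'"
    hence "set (bs ! e) \<inter> set (bs ! e') = {}"
      using distinct_concat_nth_disjoint[OF dist] that(1,2) by (simp add: d_def)
    thus False using that by blast
  qed
  show "v \<in> U \<Longrightarrow> mv g v \<in> U" unfolding U using gb d0 mod_less_divisor by blast
  show "v \<in> U \<Longrightarrow> mv h v \<in> U" unfolding U using hb by blast
  have r: "?r \<in> set (bs ! 0)" using bs0 by (simp add: hd_conv_nth)
  have const: "w v = w u" if w: "w \<in> eqv q g h U" and e: "e < d" "v \<in> set (bs ! e)" "u \<in> set (bs ! e)" for w :: "bit pt \<Rightarrow> 'b" and e v u
  proof -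
    let ?b = "bs ! e"
    have b: "?b \<in> set bs" using e(1) by (simp add: d_def)
    have "w (?b ! i) = w (?b ! 0)" if "i < length ?b" for i
      using that
    proof (induction i)
      case (Suc i)
      have "?b ! Suc i = rotate1 ?b ! i" using Suc.prems by (simp add: nth_rotate1)
      also have "\<dots> = mv h (?b ! i)" using Suc.prems by (simp flip: hrot[OF b])
      moreover have "?b ! i \<in> U" unfolding U using e(1) Suc.prems by (intro exI[of _ e]) simp
      ultimately have "w (?b ! Suc i) = w (?b ! i)" using eqvD(2)[OF w] by simp
      thus ?case using Suc by simp
    qed simp
    thus ?thesis using e(2,3) by (metis in_set_conv_nth)
  qed
  have val: "w v = w ?r ^ (q ^ e)" if w: "w \<in> eqv q g h U" and e: "e < d" "v \<in> set (bs ! e)" for w :: "bit pt \<Rightarrow> 'b" and e v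
    using e
  proof (induction e arbitrary: v)
    case 0 show ?case using const[OF w 0 r] by simp
  next
    case (Suc e)
    have "bs ! e \<noteq> []" using len[of "bs ! e"] Suc.prems m0 by (auto simp: d_def)
    then obtain u where u: "u \<in> set (bs ! e)" by (metis list.set_intros(1) neq_Nil_conv)
    have "mv g u \<in> set (bs ! Suc e)" using gb[of e u] u Suc.prems by simp
    hence "w v = w (mv g u)" by (rule const[OF w Suc.prems])
    also have "\<dots> = w u ^ q" by (rule eqvD(3)[OF w]) (use u U Suc.prems in \<open>metis Suc_lessD\<close>)
    also have "w u = w ?r ^ (q ^ e)" using Suc u by simp
    finally show ?case by (simp add: mult.commute flip: power_mult)
  qed
  have fixd: "w ?r \<in> fset q d - {0}" if w: "w \<in> eqv q g h U" for w :: "bit pt \<Rightarrow> 'b"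
  proof -
    have "bs ! (d - 1) \<noteq> []" using len[of "bs ! (d - 1)"] d0 m0 by (auto simp: d_def)
    then obtain u where u: "u \<in> set (bs ! (d - 1))" by (metis list.set_intros(1) neq_Nil_conv)
    have "mv g u \<in> set (bs ! 0)" using gb[of "d - 1" u] u d0 by simp
    hence "w ?r = w (mv g u)" by (rule const[OF w d0 r])
    also have "\<dots> = w u ^ q" by (rule eqvD(3)[OF w]) (use u U d0 in \<open>metis diff_less zero_less_one\<close>)
    also have "w u = w ?r ^ (q ^ (d - 1))" using val[OF w _ u] d0 by simp
    also have "(w ?r ^ (q ^ (d - 1))) ^ q = w ?r ^ (q ^ d)" using d0
      by (metis One_nat_def Suc_pred power_Suc2 power_mult)
    finally have "w ?r \<in> fset q d" by (simp add: fset_def)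
    moreover have "w ?r \<noteq> 0" using eqvD(1)[OF w] U r d0 by metis
    ultimately show ?thesis by simp
  qed
  \<comment> \<open>The inverse map; the blocks are disjoint, so at most one summand is
    nonzero.\<close>
  define wt where "wt t = (\<lambda>v. \<Sum>e<d. if v \<in> set (bs ! e) then t ^ (q ^ e) else 0)" for t :: 'b
  have wt: "wt t v = t ^ (q ^ e)" if "e < d" "v \<in> set (bs ! e)" for t e v
  proof -
    have "wt t v = (\<Sum>e'<d. if e' = e then t ^ (q ^ e) else 0)" unfolding wt_def
      using uniq that by (intro sum.cong) auto
    thus ?thesis using that(1) by simp
  qed
  have wt0: "wt t v = 0" if "v \<notin> U" for t v using that U by (auto simp: wt_def intro!: sum.neutral)
  have wt_in: "wt t \<in> eqv q g h U" if t: "t \<in> fset q d - {0}" for t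
  proof -
    have "wt t v \<noteq> 0 \<and> wt t (mv h v) = wt t v \<and> wt t (mv g v) = wt t v ^ q" if "v \<in> U" for v
    proof -
      from that[unfolded U] obtain e where e: "e < d" "v \<in> set (bs ! e)" by blast
      have "wt t (mv g v) = wt t v ^ q"
      proof (cases "Suc e < d")
        case True
        hence m: "mv g v \<in> set (bs ! Suc e)" using gb[OF e] by simp
        show ?thesis unfolding wt[OF True m] wt[OF e] by (simp add: mult.commute flip: power_mult)
      next
        case False
        hence d: "d = Suc e" using e by simp
        hence m: "mv g v \<in> set (bs ! 0)" using gb[OF e] by simp
        have "wt t (mv g v) = t" unfolding wt[OF d0 m] by simp
        also have "\<dots> = t ^ (q ^ d)" using t by (simp add: fset_def)
        also have "\<dots> = wt t v ^ q" unfolding wt[OF e] d by (simp add: mult.commute flip: power_mult)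
        finally show ?thesis .
      qed
      moreover have "wt t (mv h v) = wt t v" unfolding wt[OF e] wt[OF e(1) hb[OF e]] ..
      moreover have "wt t v \<noteq> 0" unfolding wt[OF e] using t by simp
      ultimately show ?thesis by blast
    qed
    thus ?thesis using wt0 unfolding eqv_def by blast
  qed
  show "bij_betw (\<lambda>w. w ?r) (eqv q g h U :: (bit pt \<Rightarrow> 'b) set) (fset q d - {0})"
  proof (rule bij_betw_byWitness[where f' = wt])
    show "\<forall>w\<in>eqv q g h U. wt (w ?r) = w"
    proof (intro ballI ext)
      fix w :: "bit pt \<Rightarrow> 'b" and v assume w: "w \<in> eqv q g h U"
      show "wt (w ?r) v = w v"
      proof (cases "v \<in> U")
        case True
        from True[unfolded U] obtain e where e: "e < d" "v \<in> set (bs ! e)" by blast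
        show ?thesis unfolding wt[OF e] val[OF w e] ..
      next
        case False
        thus ?thesis using wt0[OF False] w unfolding eqv_def by simp
      qed
    qed
    show "\<forall>t\<in>fset q d - {0}. wt t ?r = t" using wt[OF d0 r] by simp
    show "(\<lambda>w. w ?r) ` eqv q g h U \<subseteq> fset q d - {0 :: 'b}"
      by (rule image_subsetI, erule fixd)
    show "wt ` (fset q d - {0}) \<subseteq> eqv q g h U" by (intro image_subsetI wt_in)
  qed
  show "sum w U = of_nat m * trq q d (w ?r)" if w: "w \<in> eqv q g h U" for w :: "bit pt \<Rightarrow> 'b"
  proof -
    have "sum w U = sum_list (map w (concat bs))" unfolding U_def by (rule sum_list_distinct_conv_sum_set[OF dist, symmetric])
    also have "\<dots> = sum_list (map (\<lambda>b. sum_list (map w b)) bs)" by (induction bs) auto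
    also have "\<dots> = (\<Sum>e<d. sum_list (map w (bs ! e)))"
      by (simp add: sum_list_sum_nth d_def atLeast0LessThan)
    also have "\<dots> = (\<Sum>e<d. of_nat m * w ?r ^ (q ^ e))"
    proof (rule sum.cong)
      fix e assume e: "e \<in> {..<d}"
      hence "map w (bs ! e) = replicate m (w ?r ^ (q ^ e))"
        using val[OF w] len[of "bs ! e"] by (intro replicate_eqI) (auto simp: d_def)
      thus "sum_list (map w (bs ! e)) = of_nat m * w ?r ^ (q ^ e)" by (simp add: sum_list_replicate)
    qed simp
    finally show ?thesis by (simp add: trq_def sum_distrib_left)
  qed
qed

lemma of_nat_char2: "(of_nat m :: 'b) = (if odd m then 1 else 0)"
  by (induction m) (use c2 in auto)

text \<open>For odd block size the sum is the trace itself: fibres have q^(d-1) elements, and the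
  one over 0 loses the zero function. For even block size every sum is 0, and all q^d - 1 nonzero
  values contribute to s = 0.\<close>

lemma eqv_type_orbit:
  assumes ok: "orbit_ok g h bs"
  shows "eqv_type T q g h (set (concat bs)) (fst (orbit_ab q (length bs) (length (hd bs)))) (snd (orbit_ab q (length bs) (length (hd bs))))"
  unfolding eqv_type_def
proof (intro conjI allI impI)
  show "finite (eqv q g h (set (concat bs)) :: (bit pt \<Rightarrow> 'b) set)"
    using bij_betw_finite[OF eqv_orbit(1)[OF ok]] finite_fset[OF eqv_orbit(5)[OF ok]] by simp
next
  fix s :: 'b assume s: "s ^ q = s"
  let ?U = "set (concat bs)" and ?d = "length bs" and ?m = "length (hd bs)" and ?r = "hd (hd bs)"
  note o = eqv_orbit[OF ok]
  have d0: "?d > 0" by (rule o(5))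
  let ?T = "{t \<in> fset q ?d - {0}. of_nat ?m * trq q ?d t = s}"
  have "bij_betw (\<lambda>w. w ?r) (eqv_sum q g h ?U s) ?T"
  proof (rule bij_betw_subset[OF o(1)])
    show "eqv_sum q g h ?U s \<subseteq> eqv q g h ?U" by (auto simp: eqv_sum_def)
    show "(\<lambda>w. w ?r) ` (eqv_sum q g h ?U s :: (bit pt \<Rightarrow> 'b) set) = ?T"
    proof -
      have im: "(\<lambda>w. w ?r) ` eqv q g h ?U = fset q ?d - {0 :: 'b}" using o(1) by (simp add: bij_betw_def)
      show ?thesis
      proof (intro equalityI subsetI)
        fix t assume "t \<in> (\<lambda>w. w ?r) ` (eqv_sum q g h ?U s :: (bit pt \<Rightarrow> 'b) set)"
        then obtain w where w: "w \<in> eqv q g h ?U" "sum w ?U = s" "t = w ?r" unfolding eqv_sum_def by auto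
        have "t \<in> fset q ?d - {0}" unfolding w(3) im[symmetric] using w(1) by (rule imageI)
        thus "t \<in> ?T" using o(2)[OF w(1)] w(2,3) by simp
      next
        fix t assume t: "t \<in> ?T"
        hence "t \<in> (\<lambda>w. w ?r) ` eqv q g h ?U" unfolding im by simp
        then obtain w where w: "w \<in> eqv q g h ?U" "t = w ?r" by auto
        hence "sum w ?U = s" using o(2)[OF w(1)] t by simp
        thus "t \<in> (\<lambda>w. w ?r) ` (eqv_sum q g h ?U s :: (bit pt \<Rightarrow> 'b) set)" using w unfolding eqv_sum_def by simp
      qed
    qed
  qed
  hence card: "card (eqv_sum q g h ?U s) = card ?T" by (rule bij_betw_same_card)
  show "real (card (eqv_sum q g h ?U s)) = fst (orbit_ab q ?d ?m) + (if s = 0 then snd (orbit_ab q ?d ?m) else 0)"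
  proof (cases "odd ?m")
    case True
    hence "(of_nat ?m :: 'b) = 1" by (simp add: of_nat_char2)
    hence T: "?T = {t \<in> fset q ?d. trq q ?d t = s} - {0}" by auto
    have z: "(0::'b) \<in> fset q ?d" "trq q ?d (0::'b) = 0" using q1 by (simp_all add: fset_def trq_def zero_power)
    have "real (card ?T) = real (q ^ (?d - 1)) - (if s = 0 then 1 else 0)"
    proof (cases "s = 0")
      case True
      have "card ?T = q ^ (?d - 1) - 1" unfolding T using z True finite_fset[OF d0] card_trace_fibre[OF d0 s]
        by (subst card_Diff_singleton) auto
      thus ?thesis using True q1 by (simp add: of_nat_diff)
    next
      case False
      have "{t \<in> fset q ?d. trq q ?d t = s} - {0} = {t \<in> fset q ?d. trq q ?d t = s}" using z False by auto
      thus ?thesis unfolding T using False by (simp add: card_trace_fibre[OF d0 s])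
    qed
    thus ?thesis unfolding card using True by (simp add: orbit_ab_def)
  next
    case False
    hence "(of_nat ?m :: 'b) = 0" by (simp add: of_nat_char2)
    hence T: "?T = (if s = 0 then fset q ?d - {0} else {})" by auto
    have "card (fset q ?d - {0::'b}) = q ^ ?d - 1"
    proof -
      have "(0::'b) \<in> fset q ?d" using q1 by (simp add: fset_def zero_power)
      thus ?thesis using card_fset[OF d0] by (simp add: card_Diff_singleton)
    qed
    thus ?thesis unfolding card T using False q1 by (simp add: orbit_ab_def of_nat_diff)
  qed
qed

lemma sum_in_k:
  assumes w: "w \<in> eqv q g h U" and g: "mdet g = 1" and inv: "\<And>v. v \<in> U \<Longrightarrow> mv g v \<in> U"
  shows "(sum w U :: 'b) ^ q = sum w U"
proof -
  have fin: "finite U" using finite_bit_pt by (metis finite_subset subset_UNIV)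
  have inj: "inj_on (mv g) U" using g by (intro inj_onI) (rule mv_inj[of g], simp_all)
  have "mv g ` U = U" using inv by (intro card_subset_eq fin) (auto simp: card_image[OF inj])
  hence "sum w U = (\<Sum>v\<in>U. w (mv g v))" using sum.reindex[OF inj, of w] by simp
  also have "\<dots> = (\<Sum>v\<in>U. w v ^ q)" using w by (intro sum.cong) (auto simp: eqv_def)
  also have "\<dots> = sum w U ^ q" by (rule ring_map_sum[OF frob_ring1, symmetric])
  finally show ?thesis by simp
qed

text \<open>Restriction to the two parts splits w uniquely, and its sum over \<open>U1\<close> lies
  in F_q by \<open>sum_in_k\<close>. So the count is a convolution over u in F_q, in which only u =
  0 and u = s are exceptional.\<close>

lemma eqv_type_union:
  assumes t1: "eqv_type T q g h U1 \<alpha>1 \<beta>1" and t2: "eqv_type T q g h U2 \<alpha>2 \<beta>2" and g: "mdet g = 1"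
    and i1: "\<And>v. v \<in> U1 \<Longrightarrow> mv g v \<in> U1" "\<And>v. v \<in> U1 \<Longrightarrow> mv h v \<in> U1"
    and i2: "\<And>v. v \<in> U2 \<Longrightarrow> mv g v \<in> U2" "\<And>v. v \<in> U2 \<Longrightarrow> mv h v \<in> U2"
    and disj: "U1 \<inter> U2 = {}"
  shows "eqv_type T q g h (U1 \<union> U2) (real q * \<alpha>1 * \<alpha>2 + \<alpha>1 * \<beta>2 + \<beta>1 * \<alpha>2) (\<beta>1 * \<beta>2)"
  unfolding eqv_type_def
proof (intro conjI allI impI)
  show "finite (eqv q g h (U1 \<union> U2) :: (bit pt \<Rightarrow> 'b) set)"
  proof (rule finite_subset)
    show "eqv q g h (U1 \<union> U2) \<subseteq> (\<lambda>(w1, w2) v. w1 v + w2 v :: 'b) ` (eqv q g h U1 \<times> eqv q g h U2)"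
    proof
      fix w :: "bit pt \<Rightarrow> 'b" assume w: "w \<in> eqv q g h (U1 \<union> U2)"
      define w1 where "w1 = (\<lambda>v. if v \<in> U1 then w v else 0)"
      define w2 where "w2 = (\<lambda>v. if v \<in> U2 then w v else 0)"
      have "w1 \<in> eqv q g h U1" using w i1 unfolding eqv_def w1_def by simp
      moreover have "w2 \<in> eqv q g h U2" using w i2 unfolding eqv_def w2_def by simp
      moreover have "w = (\<lambda>v. w1 v + w2 v)" using w disj unfolding eqv_def w1_def w2_def by (intro ext) auto
      ultimately show "w \<in> (\<lambda>(w1, w2) v. w1 v + w2 v) ` (eqv q g h U1 \<times> eqv q g h U2)" by force
    qed
    show "finite ((\<lambda>(w1, w2) v. w1 v + w2 v :: 'b) ` (eqv q g h U1 \<times> eqv q g h U2))"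
      using t1 t2 unfolding eqv_type_def by blast
  qed
next
  fix s :: 'b assume s: "s ^ q = s"
  let ?k = "{u::'b. u ^ q = u}"
  have fin: "finite U" for U :: "bit pt set" using finite_bit_pt by (metis finite_subset subset_UNIV)
  define J where "J p = (\<lambda>v. (fst p :: bit pt \<Rightarrow> 'b) v + snd p v)" for p
  define S where "S = (SIGMA u:?k. eqv_sum q g h U1 u \<times> eqv_sum q g h U2 (s - u))"
  have D: "v \<in> U1 \<Longrightarrow> v \<notin> U2" for v using disj by blast
  have "bij_betw (\<lambda>p. J (snd p)) S (eqv_sum q g h (U1 \<union> U2) s)"
  proof (rule bij_betw_byWitness[where f' = "\<lambda>w. (sum w U1, (\<lambda>v. if v \<in> U1 then w v else 0), (\<lambda>v. if v \<in> U2 then w v else 0))"])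
    have J1: "J (w1,w2) v = w1 v" if "w2 \<in> eqv q g h U2" "v \<in> U1" for w1 w2 v
      using that D[of v] unfolding eqv_def J_def by simp
    have J2: "J (w1,w2) v = w2 v" if "w1 \<in> eqv q g h U1" "v \<in> U2" for w1 w2 v
      using that D[of v] unfolding eqv_def J_def by auto
    show "\<forall>a\<in>S. (sum (J (snd a)) U1, (\<lambda>v. if v \<in> U1 then J (snd a) v else 0), (\<lambda>v. if v \<in> U2 then J (snd a) v else 0)) = a"
    proof
      fix a assume "a \<in> S"
      then obtain u w1 w2 where a: "a = (u,w1,w2)" "w1 \<in> eqv q g h U1" "sum w1 U1 = u" "w2 \<in> eqv q g h U2"
        unfolding S_def eqv_sum_def by blast
      have "sum (J (w1,w2)) U1 = u" using a J1 by (metis (no_types, lifting) sum.cong)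
      moreover have "(\<lambda>v. if v \<in> U1 then J (w1,w2) v else 0) = w1" using J1[OF a(4), of _ w1] a(2) unfolding eqv_def by (intro ext) simp
      moreover have "(\<lambda>v. if v \<in> U2 then J (w1,w2) v else 0) = w2" using J2[OF a(2), of _ w2] a(4) unfolding eqv_def by (intro ext) simp
      ultimately show "(sum (J (snd a)) U1, (\<lambda>v. if v \<in> U1 then J (snd a) v else 0), (\<lambda>v. if v \<in> U2 then J (snd a) v else 0)) = a"
        unfolding a(1) snd_conv by simp
    qed
    show "\<forall>w\<in>eqv_sum q g h (U1 \<union> U2) s. J (snd (sum w U1, (\<lambda>v. if v \<in> U1 then w v else 0), (\<lambda>v. if v \<in> U2 then w v else 0))) = w"
    proof (intro ballI ext)
      fix w :: "bit pt \<Rightarrow> 'b" and v assume "w \<in> eqv_sum q g h (U1 \<union> U2) s"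
      thus "J (snd (sum w U1, (\<lambda>v. if v \<in> U1 then w v else 0), (\<lambda>v. if v \<in> U2 then w v else 0))) v = w v"
        using D[of v] unfolding J_def eqv_sum_def eqv_def by simp
    qed
    show "(\<lambda>p. J (snd p)) ` S \<subseteq> eqv_sum q g h (U1 \<union> U2) s"
    proof (intro image_subsetI)
      fix a assume "a \<in> S"
      then obtain u w1 w2 where a: "a = (u,w1,w2)" "w1 \<in> eqv q g h U1" "sum w1 U1 = u" "w2 \<in> eqv q g h U2" "sum w2 U2 = s - u"
        unfolding S_def eqv_sum_def by blast
      have "sum (J (w1,w2)) (U1 \<union> U2) = sum (J (w1,w2)) U1 + sum (J (w1,w2)) U2" by (rule sum.union_disjoint[OF fin fin disj])
      also have "\<dots> = sum w1 U1 + sum w2 U2" using J1[OF a(4)] J2[OF a(2)] by (metis (no_types, lifting) sum.cong)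
      finally have "sum (J (w1,w2)) (U1 \<union> U2) = s" using a by simp
      moreover have "J (w1,w2) \<in> eqv q g h (U1 \<union> U2)"
      proof -
        have "J (w1,w2) v = 0" if "v \<notin> U1 \<union> U2" for v using that a(2,4) unfolding eqv_def J_def by simp
        moreover have "J (w1,w2) v \<noteq> 0 \<and> J (w1,w2) (mv h v) = J (w1,w2) v \<and> J (w1,w2) (mv g v) = J (w1,w2) v ^ q" if "v \<in> U1 \<union> U2" for v
        proof (cases "v \<in> U1")
          case True
          show ?thesis using J1[OF a(4) True] J1[OF a(4) i1(1)[OF True]] J1[OF a(4) i1(2)[OF True]] eqvD[OF a(2) True] by simp
        next
          case False
          hence True: "v \<in> U2" using that by blast
          show ?thesis using J2[OF a(2) True] J2[OF a(2) i2(1)[OF True]] J2[OF a(2) i2(2)[OF True]] eqvD[OF a(4) True] by simp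
        qed
        ultimately show ?thesis unfolding eqv_def by blast
      qed
      ultimately show "J (snd a) \<in> eqv_sum q g h (U1 \<union> U2) s" by (simp add: a(1) eqv_sum_def)
    qed
    show "(\<lambda>w. (sum w U1, (\<lambda>v. if v \<in> U1 then w v else 0), (\<lambda>v. if v \<in> U2 then w v else 0))) ` eqv_sum q g h (U1 \<union> U2) s \<subseteq> S"
    proof (intro image_subsetI)
      fix w assume "w \<in> eqv_sum q g h (U1 \<union> U2) s"
      hence w: "w \<in> eqv q g h (U1 \<union> U2)" "sum w (U1 \<union> U2) = s" by (auto simp: eqv_sum_def)
      define w1 where "w1 = (\<lambda>v. if v \<in> U1 then w v else 0)"
      define w2 where "w2 = (\<lambda>v. if v \<in> U2 then w v else 0)"
      have e1: "w1 \<in> eqv q g h U1" using w(1) i1 unfolding eqv_def w1_def by simp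
      have e2: "w2 \<in> eqv q g h U2" using w(1) i2 unfolding eqv_def w2_def by simp
      have s1: "sum w1 U1 = sum w U1" "sum w2 U2 = sum w U2" by (simp_all add: w1_def w2_def)
      have "s = sum w U1 + sum w U2" using w(2) sum.union_disjoint[OF fin fin disj, of w] by simp
      hence "sum w2 U2 = s - sum w U1" using s1 by simp
      moreover have "sum w U1 ^ q = sum w U1" using sum_in_k[OF e1 g i1(1)] s1 by simp
      ultimately show "(sum w U1, (\<lambda>v. if v \<in> U1 then w v else 0), (\<lambda>v. if v \<in> U2 then w v else 0)) \<in> S"
        using e1 e2 s1 unfolding S_def eqv_sum_def w1_def[symmetric] w2_def[symmetric] by simp
    qed
  qed
  hence "card (eqv_sum q g h (U1 \<union> U2) s) = card S" by (metis bij_betw_same_card)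
  also have "card S = (\<Sum>u\<in>?k. card (eqv_sum q g h U1 u) * card (eqv_sum q g h U2 (s - u)))"
  proof -
    have "finite (eqv_sum q g h U1 u :: (bit pt \<Rightarrow> 'b) set)" "finite (eqv_sum q g h U2 u :: (bit pt \<Rightarrow> 'b) set)" for u
      using t1 t2 unfolding eqv_type_def eqv_sum_def by simp_all
    thus ?thesis unfolding S_def by (subst card_SigmaI[OF finite_k]) (simp_all add: card_cartesian_product)
  qed
  finally have "real (card (eqv_sum q g h (U1 \<union> U2) s)) = (\<Sum>u\<in>?k. real (card (eqv_sum q g h U1 u)) * real (card (eqv_sum q g h U2 (s - u))))"
    by simp
  also have "\<dots> = (\<Sum>u\<in>?k. (\<alpha>1 + (if u = 0 then \<beta>1 else 0)) * (\<alpha>2 + (if u = s then \<beta>2 else 0)))"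
  proof (rule sum.cong)
    fix u assume "u \<in> ?k"
    hence u: "u ^ q = u" "(s - u) ^ q = s - u" using s ring_mapD(3)[OF frob_ring1, of s u] by auto
    show "real (card (eqv_sum q g h U1 u)) * real (card (eqv_sum q g h U2 (s - u))) = (\<alpha>1 + (if u = 0 then \<beta>1 else 0)) * (\<alpha>2 + (if u = s then \<beta>2 else 0))"
      using t1 t2 u unfolding eqv_type_def by auto
  qed simp
  also have "\<dots> = (\<Sum>u\<in>?k. \<alpha>1 * \<alpha>2 + (if u = 0 then \<beta>1 * \<alpha>2 else 0) + (if u = s then \<alpha>1 * \<beta>2 else 0) + (if u = 0 then (if s = 0 then \<beta>1 * \<beta>2 else 0) else 0))"
    by (intro sum.cong) (auto simp: algebra_simps)
  also have "\<dots> = real q * (\<alpha>1 * \<alpha>2) + \<beta>1 * \<alpha>2 + \<alpha>1 * \<beta>2 + (if s = 0 then \<beta>1 * \<beta>2 else 0)"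
    using s q1 finite_k by (simp add: sum.distrib card_k)
  finally show "real (card (eqv_sum q g h (U1 \<union> U2) s)) = real q * \<alpha>1 * \<alpha>2 + \<alpha>1 * \<beta>2 + \<beta>1 * \<alpha>2 + (if s = 0 then \<beta>1 * \<beta>2 else 0)"
    by simp
qed

lemma eqv_type_orbits:
  assumes "list_all (orbit_ok g h) os" "distinct (concat (concat os))" "mdet g = 1"
  shows "eqv_type T q g h (set (concat (concat os))) (fst (conv_ab q (map orbit_shape os))) (snd (conv_ab q (map orbit_shape os)))
    \<and> (\<forall>v\<in>set (concat (concat os)). mv g v \<in> set (concat (concat os)) \<and> mv h v \<in> set (concat (concat os)))"
  using assms
proof (induction os)
  case Nil
  have "eqv q g h {} = {\<lambda>_. 0 :: 'b}" by (auto simp: eqv_def)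
  thus ?case by (auto simp: eqv_type_def eqv_sum_def)
next
  case (Cons bs os)
  let ?U1 = "set (concat bs)" and ?U2 = "set (concat (concat os))"
  have ok: "orbit_ok g h bs" using Cons.prems by simp
  have IH: "eqv_type T q g h ?U2 (fst (conv_ab q (map orbit_shape os))) (snd (conv_ab q (map orbit_shape os)))"
    "\<And>v. v \<in> ?U2 \<Longrightarrow> mv g v \<in> ?U2" "\<And>v. v \<in> ?U2 \<Longrightarrow> mv h v \<in> ?U2"
  proof -
    have "eqv_type T q g h ?U2 (fst (conv_ab q (map orbit_shape os))) (snd (conv_ab q (map orbit_shape os)))
      \<and> (\<forall>v\<in>?U2. mv g v \<in> ?U2 \<and> mv h v \<in> ?U2)"
      by (rule Cons.IH) (use Cons.prems in simp_all)
    thus "eqv_type T q g h ?U2 (fst (conv_ab q (map orbit_shape os))) (snd (conv_ab q (map orbit_shape os)))"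
      "\<And>v. v \<in> ?U2 \<Longrightarrow> mv g v \<in> ?U2" "\<And>v. v \<in> ?U2 \<Longrightarrow> mv h v \<in> ?U2" by blast+
  qed
  have disj: "?U1 \<inter> ?U2 = {}" using Cons.prems(2) by simp
  have U: "set (concat (concat (bs # os))) = ?U1 \<union> ?U2" by simp
  obtain a1 b1 a2 b2 where ab: "orbit_ab q (length bs) (length (hd bs)) = (a1,b1)" "conv_ab q (map orbit_shape os) = (a2,b2)"
    by (metis prod.exhaust)
  have "eqv_type T q g h (?U1 \<union> ?U2) (real q * a1 * a2 + a1 * b2 + b1 * a2) (b1 * b2)"
    using eqv_type_union[OF eqv_type_orbit[OF ok] IH(1) Cons.prems(3) eqv_orbit(3,4)[OF ok] IH(2,3) disj] by (simp only: ab fst_conv snd_conv)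
  moreover have "\<forall>v\<in>?U1 \<union> ?U2. mv g v \<in> ?U1 \<union> ?U2 \<and> mv h v \<in> ?U1 \<union> ?U2"
    using eqv_orbit(3,4)[OF ok] IH(2,3) by blast
  ultimately show ?case unfolding U by (simp only: list.map orbit_shape_def[of bs] conv_ab.simps ab fst_conv snd_conv prod.case simp_thms)
qed

text \<open>The total is prescribed to be 1, not 0, so the second component matters only during the
  convolution.\<close>

lemma card_fixed_weights:
  assumes ok: "list_all (orbit_ok g h) os" "distinct (concat (concat os))" "set (concat (concat os)) = set npts"
    and g: "mdet g = 1"
  shows "real (card {w :: bit pt \<Rightarrow> 'b. w \<in> wset q g \<and> w \<circ> mv h = w}) = fst (conv_ab q (map orbit_shape os))"
proof -
  have t: "eqv_type T q g h (set npts) (fst (conv_ab q (map orbit_shape os))) (snd (conv_ab q (map orbit_shape os)))"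
    using eqv_type_orbits[OF ok(1,2) g] unfolding ok(3) by blast
  have e: "{w :: bit pt \<Rightarrow> 'b. w \<in> wset q g \<and> w \<circ> mv h = w} = eqv_sum q g h (set npts) 1"
  proof (intro equalityI subsetI)
    fix w :: "bit pt \<Rightarrow> 'b" assume "w \<in> {w. w \<in> wset q g \<and> w \<circ> mv h = w}"
    thus "w \<in> eqv_sum q g h (set npts) 1"
      unfolding wset_def admissible_def weight_def eqv_sum_def eqv_def set_npts by (simp add: fun_eq_iff)
  next
    fix w :: "bit pt \<Rightarrow> 'b" assume "w \<in> eqv_sum q g h (set npts) 1"
    hence w: "sum w (set npts) = 1" "w (0,0,0) = 0" "\<And>v. v \<noteq> (0,0,0) \<Longrightarrow> w v \<noteq> 0 \<and> w (mv h v) = w v \<and> w (mv g v) = w v ^ q"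
      unfolding eqv_sum_def eqv_def set_npts by simp_all
    have "w (mv h v) = w v" "w (mv g v) = w v ^ q" for v
      using w(2) w(3)[of v] q1 by (cases "v = (0,0,0)"; simp add: zero_power)+
    thus "w \<in> {w. w \<in> wset q g \<and> w \<circ> mv h = w}"
      using w unfolding wset_def admissible_def weight_def by (simp add: fun_eq_iff)
  qed
  show ?thesis unfolding e using t[unfolded eqv_type_def, THEN conjunct2, rule_format, of 1] by simp
qed

end

subsection \<open>The group of 168 matrices\<close>

lemma bit_arith_code [code]:
  "(0::bit) + b = b" "(1::bit) + 0 = 1" "(1::bit) + 1 = 0" "0 * b = (0::bit)" "1 * b = (b::bit)"
  "a - b = a + (b::bit)" "- b = (b::bit)"
  by auto

lemma bit_equal_code [code]:
  "HOL.equal (0::bit) 0 \<longleftrightarrow> True" "HOL.equal (0::bit) 1 \<longleftrightarrow> False"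
  "HOL.equal (1::bit) 0 \<longleftrightarrow> False" "HOL.equal (1::bit) 1 \<longleftrightarrow> True"
  by (simp_all add: equal)

definition gl :: "bit mat3 list" where
  "gl = filter (\<lambda>g. mdet g = 1) (List.product npts (List.product npts npts))"

fun iterates :: "nat \<Rightarrow> ('x \<Rightarrow> 'x) \<Rightarrow> 'x \<Rightarrow> 'x list" where
  "iterates 0 f x = []" | "iterates (Suc n) f x = x # iterates n f (f x)"

text \<open>The return to the first block is tested on the head alone, since commuting matrices
  permute each other's cycles.\<close>

fun blocks :: "nat \<Rightarrow> bit mat3 \<Rightarrow> bit pt list \<Rightarrow> bit pt list \<Rightarrow> bit pt list list" where
  "blocks 0 g b0 b = [b]"
| "blocks (Suc n) g b0 b = (let b' = map (mv g) b in if hd b' \<in> set b0 then [b] else b # blocks n g b0 b')"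

text \<open>\<open>remdups\<close> keeps last occurrences, so applied to seven iterates it yields a rotation of the cycle of \<open>v\<close>.\<close>

fun orbit_lists :: "nat \<Rightarrow> bit mat3 \<Rightarrow> bit mat3 \<Rightarrow> bit pt list \<Rightarrow> bit pt list list list" where
  "orbit_lists 0 g h vs = []"
| "orbit_lists (Suc n) g h vs = (case vs of [] \<Rightarrow> [] | v # _ \<Rightarrow>
     (let b = remdups (iterates 7 (mv h) v); bs = blocks 7 g b b
      in bs # orbit_lists n g h (filter (\<lambda>u. u \<notin> set (concat bs)) vs)))"

definition orbs :: "bit mat3 \<Rightarrow> bit mat3 \<Rightarrow> bit pt list list list" where
  "orbs g h = orbit_lists 7 g h npts"

text \<open>A certificate: the counting relies on this check of each computed list, not on a general
  proof that \<open>orbs\<close> enumerates orbits.\<close>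

definition orbits_ok :: "bit mat3 \<Rightarrow> bit mat3 \<Rightarrow> bit pt list list list \<Rightarrow> bool" where
  "orbits_ok g h os \<longleftrightarrow> list_all (orbit_ok g h) os \<and> (let vs = concat (concat os) in
     distinct vs \<and> list_all (\<lambda>v. v \<in> set vs) npts \<and> list_all (\<lambda>v. v \<in> set npts) vs)"

definition centl :: "bit mat3 \<Rightarrow> bit mat3 list" where
  "centl g = filter (\<lambda>h. mm h g = mm g h) gl"

definition orbit_data :: "bit mat3 \<Rightarrow> bit mat3 \<Rightarrow> bool \<times> (nat \<times> nat) list" where
  "orbit_data g h = (let os = orbs g h in (orbits_ok g h os, map orbit_shape os))"

text \<open>Representatives of the nontrivial conjugacy classes: a transvection, a cyclic
  permutation, a single Jordan block, and the companion matrices of x^3 + x + 1 (\<open>g7\<close>)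
  and x^3 + x^2 + 1 (\<open>g7'\<close>). The cofactor matrix is the inverse transpose and has the
  reciprocal polynomial: C = \<open>cof g7'\<close> satisfies C^3 = C + 1, whence concurrence of
  type (1, 3), and C = \<open>cof g7\<close> satisfies C^3 = C^2 + 1, whence type (2, 3).\<close>

definition "g2 = (((1,1,0),(0,1,0),(0,0,1)) :: bit mat3)"
definition "g3 = (((0,1,0),(0,0,1),(1,0,0)) :: bit mat3)"
definition "g4 = (((1,1,0),(0,1,1),(0,0,1)) :: bit mat3)"
definition "g7 = (((0,0,1),(1,0,1),(0,1,0)) :: bit mat3)"
definition "g7' = (((0,0,1),(1,0,0),(0,1,1)) :: bit mat3)"

primrec mpow :: "bit mat3 \<Rightarrow> nat \<Rightarrow> bit mat3" where
  "mpow A 0 = mI" | "mpow A (Suc d) = mm A (mpow A d)"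

text \<open>The value 0 signals exhausted fuel; \<open>gl_orders\<close> shows that this does not
  happen in the group when \<open>gordc\<close> allows seven trials.\<close>

fun order_from :: "nat \<Rightarrow> bit mat3 \<Rightarrow> bit mat3 \<Rightarrow> nat \<Rightarrow> nat" where
  "order_from 0 A P d = 0"
| "order_from (Suc n) A P d = (if P = mI then d else order_from n A (mm A P) (Suc d))"

definition gordc :: "bit mat3 \<Rightarrow> nat" where "gordc g = order_from 7 (cof g) (cof g) 1"

definition gconcc :: "nat \<Rightarrow> nat \<Rightarrow> bit mat3 \<Rightarrow> bool" where
  "gconcc i j g \<longleftrightarrow> list_ex (\<lambda>e. mdet (e, (mv (cof g) ^^ i) e, (mv (cof g) ^^ j) e) = 0) npts"

lemma set_gl: "set gl = {g. mdet g = 1}"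
proof -
  have "g \<in> set npts \<times> set npts \<times> set npts" if g: "mdet g = 1" for g :: "bit mat3"
  proof -
    obtain a b c d e f r s t where gg: "g = ((a,b,c),(d,e,f),(r,s,t))" by (cases g rule: mat3_cases)
    have "(a,b,c) \<noteq> (0,0,0)" "(d,e,f) \<noteq> (0,0,0)" "(r,s,t) \<noteq> (0,0,0)"
      using g by (auto simp: gg simp del: minus_bit_def)
    thus ?thesis by (simp add: gg set_npts)
  qed
  thus ?thesis by (auto simp: gl_def simp del: mdet.simps)
qed

lemma set_centl: "set (centl g) = cent g"
  by (auto simp: centl_def cent_def set_gl simp del: mdet.simps mm.simps)

lemma distinct_centl: "distinct (centl g)"
proof -
  have "distinct npts" by (simp add: npts_def)
  thus ?thesis unfolding centl_def gl_def by (intro distinct_filter distinct_product)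
qed

lemma mv_mpow: "mv (mpow A d) v = (mv A ^^ d) v"
  by (induction d) (simp_all add: mv_mm)

lemma order_from:
  "order_from n A (mpow A d) d = r \<Longrightarrow> r \<noteq> 0 \<Longrightarrow> mpow A r = mI \<and> d \<le> r \<and> (\<forall>d'. d \<le> d' \<and> d' < r \<longrightarrow> mpow A d' \<noteq> mI)"
proof (induction n arbitrary: d)
  case (Suc n)
  show ?case
  proof (cases "mpow A d = mI")
    case False
    hence "order_from n A (mpow A (Suc d)) (Suc d) = r" using Suc.prems by simp
    from Suc.IH[OF this Suc.prems(2)] show ?thesis using False
      by (metis Suc_leD Suc_leI le_neq_implies_less)
  qed (use Suc.prems in auto)
qed simp

lemma gdeg_eq:
  assumes "gordc g \<noteq> 0" shows "gdeg g = gordc g"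
proof -
  have iff: "(\<forall>e. (mv (cof g) ^^ d) e = e) \<longleftrightarrow> mpow (cof g) d = mI" for d
    by (metis mat3_eqI mv_mI mv_mpow)
  have "mpow (cof g) (gordc g) = mI \<and> 1 \<le> gordc g \<and> (\<forall>d'. 1 \<le> d' \<and> d' < gordc g \<longrightarrow> mpow (cof g) d' \<noteq> mI)"
    using order_from[of 7 "cof g" 1 "gordc g"] assms by (simp add: gordc_def)
  thus ?thesis unfolding gdeg_def iff by (intro Least_equality) (auto simp: not_le[symmetric])
qed

lemma gconc_iff: "gconc i j g \<longleftrightarrow> gconcc i j g"
  unfolding gconc_def gconcc_def list_ex_iff set_npts by blast

text \<open>The class is read off from the order and, for order 7, from the concurrence pattern;
  \<open>gl_conj\<close> confirms the choice for each matrix.\<close>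

definition rep :: "bit mat3 \<Rightarrow> bit mat3" where
  "rep g = (let d = gordc g in if d = 1 then mI else if d = 2 then g2 else if d = 3 then g3
     else if d = 4 then g4 else if gconcc 1 3 g then g7' else g7)"

definition order_ok :: "bit mat3 \<Rightarrow> nat \<Rightarrow> bool" where
  "order_ok g d \<longleftrightarrow> d \<in> set [1,2,3,4,7] \<and> (d = 7 \<longrightarrow> gconcc 1 3 g = (\<not> gconcc 2 3 g))"

definition conj_to :: "bit mat3 list \<Rightarrow> bit mat3 \<Rightarrow> bit mat3 \<Rightarrow> bool" where
  "conj_to hs g r \<longleftrightarrow> list_ex (\<lambda>h. mm g h = mm h r) hs"

definition conj_rep :: "bit mat3 list \<Rightarrow> bit mat3 \<Rightarrow> bool" where
  "conj_rep hs g \<longleftrightarrow> conj_to hs g (rep g)"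

section \<open>Evaluation over the group\<close>

lemma gl_orders: "list_all (\<lambda>g. order_ok g (gordc g)) gl"
  by code_simp

lemma gl_conj: "list_all (conj_rep gl) gl"
  by code_simp

lemma reps: "map (\<lambda>g. (mdet g, gordc g, gconcc 1 3 g, gconcc 2 3 g)) [mI, g2, g3, g4, g7', g7] =
   [(1, 1, True, True), (1, 2, True, True), (1, 3, True, True), (1, 4, True, True), (1, 7, True, False), (1, 7, False, True)]"
  by code_simp

text \<open>For the identity each orbit is a single cycle of \<open>h\<close>, so these are cycle
  types; one element per conjugacy class suffices for \<open>card_worbits_mI\<close>.\<close>

lemma orbit_data_mI: "map (orbit_data mI) [mI, g2, g3, g4, g7', g7] = map (Pair True)
   [[(1,1),(1,1),(1,1),(1,1),(1,1),(1,1),(1,1)], [(1,1),(1,2),(1,1),(1,1),(1,2)], [(1,3),(1,3),(1,1)],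
    [(1,1),(1,2),(1,4)], [(1,7)], [(1,7)]]"
  by code_simp

text \<open>One list for each centraliser element, in the order of \<open>centl\<close>. A pair (d,
  m) stands for d cycles of \<open>h\<close> of length m that are permuted cyclically by
  \<open>g2\<close>.\<close>

lemma orbit_data_g2: "map (orbit_data g2) (centl g2) = map (Pair True)
   [[(1,1),(2,1),(1,1),(1,1),(2,1)], [(1,1),(2,2),(1,1),(1,1)], [(1,1),(1,2),(1,1),(1,1),(1,2)],
    [(1,1),(2,2),(1,1),(1,1)], [(1,1),(2,1),(1,2),(1,2)], [(1,1),(1,4),(1,2)], [(1,1),(1,2),(1,2),(2,1)],
    [(1,1),(1,4),(1,2)]]"
  by code_simp

lemma orbit_data_g3: "map (orbit_data g3) (centl g3) = map (Pair True)
   [[(3,1),(3,1),(1,1)], [(1,3),(1,3),(1,1)], [(1,3),(1,3),(1,1)]]"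
  by code_simp

lemma orbit_data_g4: "map (orbit_data g4) (centl g4) = map (Pair True)
   [[(1,1),(2,1),(4,1)], [(1,1),(1,2),(1,4)], [(1,1),(2,1),(2,2)], [(1,1),(1,2),(1,4)]]"
  by code_simp

lemma orbit_data_g7: "map (orbit_data g7) (centl g7) = map (Pair True)
   [[(7,1)], [(1,7)], [(1,7)], [(1,7)], [(1,7)], [(1,7)], [(1,7)]]"
  by code_simp

lemma orbit_data_g7': "map (orbit_data g7') (centl g7') = map (Pair True)
   [[(7,1)], [(1,7)], [(1,7)], [(1,7)], [(1,7)], [(1,7)], [(1,7)]]"
  by code_simp

text \<open>The sizes of the six conjugacy classes, used as multiplicities in the Burnside sum for
  the identity.\<close>

lemma count_reps: "map (count_list (map rep gl)) [mI, g2, g3, g4, g7', g7] = [1, 21, 56, 42, 24, 24]"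
  by code_simp

lemma length_gl: "length gl = 168"
  by code_simp

lemma distinct_reps: "distinct [mI, g2, g3, g4, g7', g7]"
  by code_simp


subsection \<open>The numbers of isomorphism classes\<close>

lemma card_fixed_data:
  assumes c2: "(2::'b::alg_closed_field) = 0" and q: "q = 2 ^ n" "n > 0" and g: "mdet g = 1"
    and d: "orbit_data g h = (True, s)"
  shows "real (card {w :: bit pt \<Rightarrow> 'b. w \<in> wset q g \<and> w \<circ> mv h = w}) = fst (conv_ab q s)"
proof -
  have s: "s = map orbit_shape (orbs g h)" and ok: "orbits_ok g h (orbs g h)"
    using d by (simp_all add: orbit_data_def Let_def)
  have "list_all (orbit_ok g h) (orbs g h)" "distinct (concat (concat (orbs g h)))" "set (concat (concat (orbs g h))) = set npts"
    using ok unfolding orbits_ok_def Let_def list_all_iff by blast+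
  from card_fixed_weights[OF c2 q this g] show ?thesis unfolding s .
qed

lemma card_worbits_data:
  assumes c2: "(2::'b::alg_closed_field) = 0" and q: "q = 2 ^ n" "n > 0" and g: "mdet g = 1"
    and d: "map (orbit_data g) (centl g) = map (Pair True) ss"
  shows "real (card (worbits q g :: (bit pt \<Rightarrow> 'b) set set)) * real (length ss) = (\<Sum>s\<leftarrow>ss. fst (conv_ab q s))"
proof -
  let ?f = "\<lambda>h. card {w :: bit pt \<Rightarrow> 'b. w \<in> wset q g \<and> w \<circ> mv h = w}"
  have "length (centl g) = length ss" using arg_cong[OF d, of length] by simp
  hence len: "card (cent g) = length ss" using distinct_card[OF distinct_centl[of g]] by (simp add: set_centl)
  have "real (card (worbits q g :: (bit pt \<Rightarrow> 'b) set set)) * real (length ss) = real (\<Sum>h\<in>cent g. ?f h)"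
    unfolding card_worbits[OF c2 q g, symmetric] len by simp
  also have "\<dots> = (\<Sum>h\<leftarrow>centl g. real (?f h))"
    by (simp add: sum_list_distinct_conv_sum_set[OF distinct_centl] set_centl)
  also have "map (\<lambda>h. real (?f h)) (centl g) = map (\<lambda>h. fst (conv_ab q (snd (orbit_data g h)))) (centl g)"
  proof (rule map_cong[OF refl])
    fix h assume "h \<in> set (centl g)"
    hence "orbit_data g h \<in> set (map (Pair True) ss)" unfolding d[symmetric] by simp
    hence "orbit_data g h = (True, snd (orbit_data g h))" by auto
    thus "real (?f h) = fst (conv_ab q (snd (orbit_data g h)))" by (rule card_fixed_data[OF c2 q g])
  qed
  also have "\<dots> = map (\<lambda>s. fst (conv_ab q s)) ss"
    using arg_cong[OF d, of "map (\<lambda>p. fst (conv_ab q (snd p)))"] by (simp add: comp_def)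
  finally show ?thesis .
qed

lemma sum_list_tally:
  fixes f :: "'x \<Rightarrow> real"
  assumes "distinct ys" "set xs \<subseteq> set ys"
  shows "(\<Sum>x\<leftarrow>xs. f x) = (\<Sum>y\<leftarrow>ys. real (count_list xs y) * f y)"
proof -
  have "(\<Sum>x\<leftarrow>xs. f x) = (\<Sum>y\<in>set ys. real (count_list xs y) * f y)" using assms(2)
  proof (induction xs)
    case (Cons x xs)
    have "(\<Sum>y\<in>set ys. real (count_list (x # xs) y) * f y) = (\<Sum>y\<in>set ys. (if y = x then f y else 0) + real (count_list xs y) * f y)"
      by (intro sum.cong) (auto simp: algebra_simps)
    also have "\<dots> = f x + (\<Sum>y\<in>set ys. real (count_list xs y) * f y)" using Cons.prems by (simp add: sum.distrib)
    finally show ?case using Cons by simp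
  qed simp
  thus ?thesis by (simp add: sum_list_distinct_conv_sum_set[OF assms(1)])
qed

lemma rep_conj: assumes "mdet g = 1" obtains h where "mdet h = 1" "mm g h = mm h (rep g)"
proof -
  have "g \<in> set gl" using assms by (simp add: set_gl del: mdet.simps)
  hence "conj_to gl g (rep g)" using gl_conj unfolding list_all_iff conj_rep_def by blast
  then obtain h where "h \<in> set gl" "mm g h = mm h (rep g)" unfolding conj_to_def list_ex_iff by blast
  thus ?thesis using that unfolding set_gl by blast
qed

lemma gl_gdeg:
  assumes "mdet g = 1"
  shows "gdeg g = gordc g" "gordc g \<in> {1,2,3,4,7}" "gordc g = 7 \<Longrightarrow> gconcc 1 3 g \<longleftrightarrow> \<not> gconcc 2 3 g"
proof -
  have "g \<in> set gl" using assms by (simp add: set_gl del: mdet.simps)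
  hence ok: "order_ok g (gordc g)" using gl_orders unfolding list_all_iff by blast
  thus o: "gordc g \<in> {1,2,3,4,7}" "gordc g = 7 \<Longrightarrow> gconcc 1 3 g \<longleftrightarrow> \<not> gconcc 2 3 g"
    unfolding order_ok_def by simp_all
  have "gordc g \<noteq> 0" using o(1) by auto
  thus "gdeg g = gordc g" by (rule gdeg_eq)
qed

lemma rep_mem: "rep g \<in> set [mI, g2, g3, g4, g7', g7]" by (simp add: rep_def Let_def)

lemma rep_data:
  "mdet (mI :: bit mat3) = 1" "mdet g2 = 1" "mdet g3 = 1" "mdet g4 = 1" "mdet g7' = 1" "mdet g7 = 1"
  "gordc mI = 1" "gordc g2 = 2" "gordc g3 = 3" "gordc g4 = 4" "gordc g7' = 7" "gordc g7 = 7"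
  "gconcc 1 3 g7'" "\<not> gconcc 1 3 g7" "gconcc 2 3 g7"
  using reps by (simp_all only: list.map list.inject prod.inject) simp_all

text \<open>The centraliser of the identity is the whole group, and conjugate elements fix equally
  many weights. So Burnside's sum needs the six representatives only; 48 combines the two classes of
  order 7.\<close>

lemma card_worbits_mI:
  assumes c2: "(2::'b::alg_closed_field) = 0" and q: "q = 2 ^ n" "n > 0"
  shows "real (card (worbits q mI :: (bit pt \<Rightarrow> 'b) set set)) * 168 =
     fst (conv_ab q [(1,1),(1,1),(1,1),(1,1),(1,1),(1,1),(1,1)]) + 21 * fst (conv_ab q [(1,1),(1,2),(1,1),(1,1),(1,2)])
     + 56 * fst (conv_ab q [(1,3),(1,3),(1,1)]) + 42 * fst (conv_ab q [(1,1),(1,2),(1,4)]) + 48 * fst (conv_ab q [(1,7)])"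
proof -
  let ?f = "\<lambda>h. real (card {w :: bit pt \<Rightarrow> 'b. w \<in> wset q mI \<and> w \<circ> mv h = w})"
  have c: "centl mI = gl" by (simp add: centl_def)
  have conj: "?f h = ?f (rep h)" if h: "mdet h = 1" for h
  proof -
    obtain k where k: "mdet k = 1" "mm h k = mm k (rep h)" using rep_conj[OF h] .
    have kc: "k \<in> cent mI" "minv k \<in> cent mI"
      using k(1) mdet_minv[of k] by (simp_all add: cent_def)
    note ki = mm_right_inverse_bit[OF k(1)]
    have "mm (minv k) h = mm (rep h) (minv k)"
    proof -
      have "mm (minv k) (mm (mm h k) (minv k)) = mm (minv k) (mm (mm k (rep h)) (minv k))" by (simp only: k)
      thus ?thesis by (metis ki mm_assoc mm_mI)
    qed
    note kh = this
    have comp: "(w \<circ> mv a) \<circ> mv b = w \<circ> mv (mm a b)" for w :: "bit pt \<Rightarrow> 'b" and a b by (simp add: fun_eq_iff mv_mm)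
    have "bij_betw (\<lambda>w. w \<circ> mv k) {w :: bit pt \<Rightarrow> 'b. w \<in> wset q mI \<and> w \<circ> mv h = w} {w. w \<in> wset q mI \<and> w \<circ> mv (rep h) = w}"
    proof (rule bij_betw_byWitness[where f' = "\<lambda>w. w \<circ> mv (minv k)"])
      have id: "w \<circ> mv mI = w" for w :: "bit pt \<Rightarrow> 'b" by (simp add: fun_eq_iff)
      show "\<forall>w\<in>{w :: bit pt \<Rightarrow> 'b. w \<in> wset q mI \<and> w \<circ> mv h = w}. w \<circ> mv k \<circ> mv (minv k) = w"
        "\<forall>w\<in>{w :: bit pt \<Rightarrow> 'b. w \<in> wset q mI \<and> w \<circ> mv (rep h) = w}. w \<circ> mv (minv k) \<circ> mv k = w"
        unfolding comp ki id by simp_all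
      show "(\<lambda>w. w \<circ> mv k) ` {w :: bit pt \<Rightarrow> 'b. w \<in> wset q mI \<and> w \<circ> mv h = w} \<subseteq> {w. w \<in> wset q mI \<and> w \<circ> mv (rep h) = w}"
      proof (rule image_subsetI)
        fix w :: "bit pt \<Rightarrow> 'b" assume w: "w \<in> {w. w \<in> wset q mI \<and> w \<circ> mv h = w}"
        have "w \<circ> mv k \<circ> mv (rep h) = (w \<circ> mv h) \<circ> mv k" unfolding comp k(2) ..
        also have "\<dots> = w \<circ> mv k" using w by simp
        finally show "w \<circ> mv k \<in> {w. w \<in> wset q mI \<and> w \<circ> mv (rep h) = w}" using w wset_comp[OF c2 _ kc(1)] by blast
      qed
      show "(\<lambda>w. w \<circ> mv (minv k)) ` {w :: bit pt \<Rightarrow> 'b. w \<in> wset q mI \<and> w \<circ> mv (rep h) = w} \<subseteq> {w. w \<in> wset q mI \<and> w \<circ> mv h = w}"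
      proof (rule image_subsetI)
        fix w :: "bit pt \<Rightarrow> 'b" assume w: "w \<in> {w. w \<in> wset q mI \<and> w \<circ> mv (rep h) = w}"
        have "w \<circ> mv (minv k) \<circ> mv h = (w \<circ> mv (rep h)) \<circ> mv (minv k)" unfolding comp kh ..
        also have "\<dots> = w \<circ> mv (minv k)" using w by simp
        finally show "w \<circ> mv (minv k) \<in> {w. w \<in> wset q mI \<and> w \<circ> mv h = w}" using w wset_comp[OF c2 _ kc(2)] by blast
      qed
    qed
    from bij_betw_same_card[OF this] show ?thesis by (rule arg_cong)
  qed
  have len: "card (cent mI) = 168" using distinct_card[OF distinct_centl[of mI]] by (simp add: set_centl[symmetric] c length_gl)
  have "real (card (worbits q mI :: (bit pt \<Rightarrow> 'b) set set)) * 168 = (\<Sum>h\<in>cent mI. ?f h)"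
  proof -
    have "card (worbits q mI :: (bit pt \<Rightarrow> 'b) set set) * 168 = (\<Sum>h\<in>cent mI. card {w :: bit pt \<Rightarrow> 'b. w \<in> wset q mI \<and> w \<circ> mv h = w})"
      unfolding card_worbits[OF c2 q rep_data(1), symmetric] len ..
    from arg_cong[OF this, of real] show ?thesis by simp
  qed
  also have "\<dots> = (\<Sum>h\<leftarrow>gl. ?f h)"
    unfolding c[symmetric] by (simp add: sum_list_distinct_conv_sum_set[OF distinct_centl] set_centl)
  also have "map ?f gl = map ?f (map rep gl)" using conj set_gl by (simp add: comp_def del: mdet.simps)
  also have "sum_list (map ?f (map rep gl)) = (\<Sum>y\<leftarrow>[mI, g2, g3, g4, g7', g7]. real (count_list (map rep gl) y) * ?f y)"
    by (rule sum_list_tally[OF distinct_reps]) (unfold set_map, rule image_subsetI, rule rep_mem)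
  also have "\<dots> = ?f mI + 21 * ?f g2 + 56 * ?f g3 + 42 * ?f g4 + 24 * ?f g7' + 24 * ?f g7"
    using count_reps by (simp only: list.map list.inject) simp
  also have "\<dots> = fst (conv_ab q [(1,1),(1,1),(1,1),(1,1),(1,1),(1,1),(1,1)]) + 21 * fst (conv_ab q [(1,1),(1,2),(1,1),(1,1),(1,2)])
     + 56 * fst (conv_ab q [(1,3),(1,3),(1,1)]) + 42 * fst (conv_ab q [(1,1),(1,2),(1,4)]) + 24 * fst (conv_ab q [(1,7)]) + 24 * fst (conv_ab q [(1,7)])"
  proof -
    have "orbit_data mI mI = (True, [(1,1),(1,1),(1,1),(1,1),(1,1),(1,1),(1,1)])" "orbit_data mI g2 = (True, [(1,1),(1,2),(1,1),(1,1),(1,2)])"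
      "orbit_data mI g3 = (True, [(1,3),(1,3),(1,1)])" "orbit_data mI g4 = (True, [(1,1),(1,2),(1,4)])"
      "orbit_data mI g7' = (True, [(1,7)])" "orbit_data mI g7 = (True, [(1,7)])"
      using orbit_data_mI by (simp_all only: list.map list.inject simp_thms)
    thus ?thesis by (simp only: card_fixed_data[OF c2 q rep_data(1)])
  qed
  finally show ?thesis by simp
qed

section \<open>Sorting isomorphism classes by the type of Frobenius\<close>

lemma finite_iso_classes: "finite (iso_classes :: 'a::{finite,field} quartic set set)"
proof -
  have "finite mon4" by (simp add: mon4_eq)
  hence "finite {F :: nat \<times> nat \<times> nat \<Rightarrow> 'a. \<forall>m. (m \<in> mon4 \<longrightarrow> F m \<in> UNIV) \<and> (m \<notin> mon4 \<longrightarrow> F m = 0)}"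
    by (rule finite_set_of_finite_funs) simp
  moreover have "(ordinary_quartics :: 'a quartic set) \<subseteq> {F. \<forall>m. (m \<in> mon4 \<longrightarrow> F m \<in> UNIV) \<and> (m \<notin> mon4 \<longrightarrow> F m = 0)}"
    unfolding ordinary_quartics_def nonsingular_quartic_def is_quartic_form_def by blast
  ultimately have "finite (ordinary_quartics :: 'a quartic set)" by (rule rev_finite_subset)
  thus ?thesis unfolding iso_classes_def by (rule finite_quotient) blast
qed

lemma iso_class_ordinary:
  assumes "Cl \<in> iso_classes" "F \<in> Cl" shows "F \<in> ordinary_quartics"
  using assms unfolding iso_classes_def quotient_def by blast

lemma iso_class_isomorphic:
  assumes hq: "\<exists>n. CARD('a::{finite,field}) = 2 ^ n"
    and Cl: "Cl \<in> iso_classes" "F \<in> Cl" "F' \<in> Cl"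
  shows "k_isomorphic F (F' :: _ \<Rightarrow> 'a)"
  using quotient_eq_iff[OF equiv_iso_rel[OF hq] _ _ Cl(2,3)] Cl(1) unfolding iso_classes_def by blast

lemma framedg_rep:
  fixes F :: "_ \<Rightarrow> 'a::{finite,field}"
  assumes hq: "\<exists>n. CARD('a) = 2 ^ n" and f: "framedg g F B w"
  shows "\<exists>B' w'. framedg (rep g) F B' w'"
proof -
  obtain h where "mdet h = 1" "mm g h = mm h (rep g)" using rep_conj[OF framedg_frob(1)[OF hq f]] .
  thus ?thesis using framedg_change[OF hq f] by blast
qed

text \<open>Translates a property \<open>T\<close> of quartics into a property \<open>P\<close> of
  \<open>g\<close>. Conjugating the frame replaces \<open>g\<close> by \<open>rep g\<close>, so a
  property that pins down the representative selects exactly one type.\<close>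

lemma typed_classes_eq:
  assumes hq: "\<exists>n. CARD('a::{finite,field}) = 2 ^ n"
    and T: "\<And>g (F :: _ \<Rightarrow> 'a) B w. framedg g F B w \<Longrightarrow> T F \<longleftrightarrow> P g"
    and P: "\<And>g. mdet g = 1 \<Longrightarrow> P g \<Longrightarrow> rep g = g0" "P g0"
  shows "{Cl. Cl \<in> iso_classes \<and> (\<exists>F\<in>Cl. T F)} = typed_classes g0"
proof (intro equalityI subsetI)
  fix Cl assume "Cl \<in> {Cl. Cl \<in> iso_classes \<and> (\<exists>F\<in>Cl. T F)}"
  then obtain F where F: "Cl \<in> iso_classes" "F \<in> Cl" "T F" by blast
  obtain g B w where f: "framedg g F B w" using ordinary_framedg[OF hq iso_class_ordinary[OF F(1,2)]] .
  have "rep g = g0" using P(1) framedg_frob(1)[OF hq f] T[OF f] F(3) by blast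
  thus "Cl \<in> typed_classes g0" using F framedg_rep[OF hq f] unfolding typed_classes_def by blast
next
  fix Cl :: "(_ \<Rightarrow> 'a) set" assume "Cl \<in> typed_classes g0"
  thus "Cl \<in> {Cl. Cl \<in> iso_classes \<and> (\<exists>F\<in>Cl. T F)}" using T P(2) unfolding typed_classes_def by blast
qed

lemma distinct_keys: "distinct (map (\<lambda>r. (gordc r, gconcc 1 3 r)) [mI, g2, g3, g4, g7', g7])"
  by code_simp

text \<open>Every class has a frame whose type is a representative. The types do not overlap, since
  degree and concurrence are properties of the curve and by \<open>distinct_keys\<close> separate
  the six representatives.\<close>

lemma card_iso_classes:
  assumes hq: "\<exists>n. CARD('a::{finite,field}) = 2 ^ n"
  shows "card (iso_classes :: 'a quartic set set) =
     (\<Sum>r\<leftarrow>[mI, g2, g3, g4, g7', g7]. card (typed_classes r :: 'a quartic set set))"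
proof -
  let ?R = "set [mI, g2, g3, g4, g7', g7]"
  have U: "(iso_classes :: 'a quartic set set) = (\<Union>r\<in>?R. typed_classes r)"
  proof (intro equalityI subsetI)
    fix Cl :: "'a quartic set" assume Cl: "Cl \<in> iso_classes"
    have "Cl \<noteq> {}" using in_quotient_imp_non_empty[OF equiv_iso_rel[OF hq]] Cl unfolding iso_classes_def by blast
    then obtain F where F: "F \<in> Cl" by blast
    obtain g B w where f: "framedg g F B w" using ordinary_framedg[OF hq iso_class_ordinary[OF Cl F]] .
    have "Cl \<in> typed_classes (rep g)" using Cl F framedg_rep[OF hq f] unfolding typed_classes_def by blast
    thus "Cl \<in> (\<Union>r\<in>?R. typed_classes r)" using rep_mem by blast
  next
    fix Cl :: "'a quartic set" assume "Cl \<in> (\<Union>r\<in>?R. typed_classes r)"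
    thus "Cl \<in> iso_classes" unfolding typed_classes_def by blast
  qed
  have dis: "typed_classes r \<inter> (typed_classes r' :: 'a quartic set set) = {}"
    if r: "r \<in> ?R" "r' \<in> ?R" "r \<noteq> r'" for r r'
  proof (rule ccontr)
    assume "typed_classes r \<inter> (typed_classes r' :: 'a quartic set set) \<noteq> {}"
    then obtain Cl F B w F' B' w' where Cl: "(Cl :: 'a quartic set) \<in> iso_classes" "F \<in> Cl" "F' \<in> Cl"
      and f: "framedg r F B w" "framedg r' F' B' w'" unfolding typed_classes_def by blast
    \<comment> \<open>The first frame is carried to F', so that both types are compared on one
      curve.\<close>
    obtain B'' where f'': "framedg r F' B'' w" using isomorphic_framedg[OF hq f(1) iso_class_isomorphic[OF hq Cl]] .
    have "gdeg r = gdeg r'" using bitangent_degree_eq[OF hq f''] bitangent_degree_eq[OF hq f(2)] by simp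
    hence "gordc r = gordc r'" using gl_gdeg(1) framedg_frob(1)[OF hq f(2)] framedg_frob(1)[OF hq f''] by simp
    moreover have "gconcc 1 3 r \<longleftrightarrow> gconcc 1 3 r'"
      using bitangent_concurrent_eq[OF hq f''] bitangent_concurrent_eq[OF hq f(2)] unfolding gconc_iff by blast
    ultimately have "r = r'"
      using inj_onD[OF distinct_keys[unfolded distinct_map, THEN conjunct2] _ r(1,2)] by simp
    thus False using r(3) by simp
  qed
  have "card (iso_classes :: 'a quartic set set) = (\<Sum>r\<in>?R. card (typed_classes r :: 'a quartic set set))"
    unfolding U
  proof (rule card_UN_disjoint)
    show "\<forall>r\<in>?R. finite (typed_classes r :: 'a quartic set set)"
    proof
      fix r :: "bit mat3"
      have "(typed_classes r :: 'a quartic set set) \<subseteq> iso_classes" unfolding typed_classes_def by blast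
      thus "finite (typed_classes r :: 'a quartic set set)" by (rule finite_subset[OF _ finite_iso_classes])
    qed
    show "finite ?R" by (rule finite_set)
    show "\<forall>r\<in>?R. \<forall>r'\<in>?R. r \<noteq> r' \<longrightarrow> typed_classes r \<inter> (typed_classes r' :: 'a quartic set set) = {}"
      using dis by blast
  qed
  thus ?thesis by (simp only: sum_list_distinct_conv_sum_set[OF distinct_reps])
qed

theorem theorem1p8:
  assumes "\<exists>n. CARD('a::{finite,field}) = 2 ^ n"
  defines "q \<equiv> real CARD('a)"
  shows "(real (card (iso_classes :: (nat \<times> nat \<times> nat \<Rightarrow> 'a) set set))
           = q^6 - q^5 + q^4 - 3*q^3 + 5*q^2 - 6*q + 7)
    \<and> (real (card (C_deg 1 :: (nat \<times> nat \<times> nat \<Rightarrow> 'a) set set))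
           = (q^6 - 7*q^5 + 42*q^4 - 140*q^3 + 343*q^2 - 462*q + 328) / 168)
    \<and> (real (card (C_deg 2 :: (nat \<times> nat \<times> nat \<Rightarrow> 'a) set set))
           = (q^6 - 3*q^5 + 6*q^4 - 12*q^3 + 15*q^2 - 6*q) / 8)
    \<and> (real (card (C_deg 3 :: (nat \<times> nat \<times> nat \<Rightarrow> 'a) set set))
           = (q^6 - q^5 - 2*q^3 + 4*q^2 - 6*q + 7) / 3)
    \<and> (real (card (C_deg 4 :: (nat \<times> nat \<times> nat \<Rightarrow> 'a) set set))
           = (q^6 - q^5 - q^2 - 2*q + 4) / 4)
    \<and> (real (card (C_7_0 :: (nat \<times> nat \<times> nat \<Rightarrow> 'a) set set)) = (q^6 + 6) / 7)
    \<and> (real (card (C_7_1 :: (nat \<times> nat \<times> nat \<Rightarrow> 'a) set set)) = (q^6 + 6) / 7)"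
proof -
  note hq = assms(1) and c2 = two_eq_0[OF assms(1)]
  obtain n where n: "CARD('a) = 2 ^ n" using hq by blast
  have n0: "n > 0" using card_gt_1_field[where ?'a='a] n by (cases n) auto
  let ?t = "\<lambda>r. real (card (typed_classes r :: 'a quartic set set))"
  \<comment> \<open>Numbers of fixed functions with sum 1. For seven points fixed by both matrices
    this is ((q-1)^7 + 1)/q; (1,7) leaves only the constant 1, and (7,1) counts the elements of
    trace 1 in the field with q^7 elements.\<close>
  have vals:
    "fst (conv_ab CARD('a) [(1,1),(1,1),(1,1),(1,1),(1,1),(1,1),(1,1)]) = q^6 - 7*q^5 + 21*q^4 - 35*q^3 + 35*q^2 - 21*q + 7"
    "fst (conv_ab CARD('a) [(1,1),(1,2),(1,1),(1,1),(1,2)]) = q^4 - 5*q^3 + 10*q^2 - 9*q + 3"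
    "fst (conv_ab CARD('a) [(1,3),(1,3),(1,1)]) = q^2 - 3*q + 3"
    "fst (conv_ab CARD('a) [(1,1),(1,2),(1,4)]) = q^2 - 2*q + 1"
    "fst (conv_ab CARD('a) [(1,1),(1,4),(1,2)]) = q^2 - 2*q + 1"
    "fst (conv_ab CARD('a) [(1,7)]) = 1"
    "fst (conv_ab CARD('a) [(1,1),(2,1),(1,1),(1,1),(2,1)]) = q^6 - 3*q^5 + q^4 + 5*q^3 - 5*q^2 - q + 3"
    "fst (conv_ab CARD('a) [(1,1),(2,2),(1,1),(1,1)]) = q^4 - 3*q^3 + 2*q^2 + 3*q - 3"
    "fst (conv_ab CARD('a) [(1,1),(2,1),(1,2),(1,2)]) = q^4 - 3*q^3 + 2*q^2 + q - 1"
    "fst (conv_ab CARD('a) [(1,1),(1,2),(1,2),(2,1)]) = q^4 - 3*q^3 + 2*q^2 + q - 1"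
    "fst (conv_ab CARD('a) [(3,1),(3,1),(1,1)]) = q^6 - q^5 - 2*q^3 + 2*q^2 + 1"
    "fst (conv_ab CARD('a) [(1,1),(2,1),(4,1)]) = q^6 - q^5 - q^4 + q^3 - q^2 + q + 1"
    "fst (conv_ab CARD('a) [(1,1),(2,1),(2,2)]) = q^4 - q^3 - 2*q^2 + q + 1"
    "fst (conv_ab CARD('a) [(7,1)]) = q^6"
    by (simp_all add: orbit_ab_def flip: q_def) (simp_all add: algebra_simps eval_nat_numeral)
  have tI: "?t mI = (q^6 - 7*q^5 + 42*q^4 - 140*q^3 + 343*q^2 - 462*q + 328) / 168"
    using card_worbits_mI[OF c2 n n0] unfolding card_typed_classes[OF hq rep_data(1)]
    by (simp add: vals del: conv_ab.simps One_nat_def)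
  have t2: "?t g2 = (q^6 - 3*q^5 + 6*q^4 - 12*q^3 + 15*q^2 - 6*q) / 8"
    using card_worbits_data[OF c2 n n0 rep_data(2) orbit_data_g2] unfolding card_typed_classes[OF hq rep_data(2)]
    by (simp add: vals del: conv_ab.simps One_nat_def)
  have t3: "?t g3 = (q^6 - q^5 - 2*q^3 + 4*q^2 - 6*q + 7) / 3"
    using card_worbits_data[OF c2 n n0 rep_data(3) orbit_data_g3] unfolding card_typed_classes[OF hq rep_data(3)]
    by (simp add: vals del: conv_ab.simps One_nat_def)
  have t4: "?t g4 = (q^6 - q^5 - q^2 - 2*q + 4) / 4"
    using card_worbits_data[OF c2 n n0 rep_data(4) orbit_data_g4] unfolding card_typed_classes[OF hq rep_data(4)]
    by (simp add: vals del: conv_ab.simps One_nat_def)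
  have t7': "?t g7' = (q^6 + 6) / 7"
    using card_worbits_data[OF c2 n n0 rep_data(5) orbit_data_g7'] unfolding card_typed_classes[OF hq rep_data(5)]
    by (simp add: vals del: conv_ab.simps One_nat_def)
  have t7: "?t g7 = (q^6 + 6) / 7"
    using card_worbits_data[OF c2 n n0 rep_data(6) orbit_data_g7] unfolding card_typed_classes[OF hq rep_data(6)]
    by (simp add: vals del: conv_ab.simps One_nat_def)
  \<comment> \<open>Up to degree 4 the order alone fixes the conjugacy class; degree 7 needs the
    concurrence condition as well.\<close>
  have deg: "(C_deg d :: 'a quartic set set) = typed_classes r"
    if r: "\<And>g. mdet g = 1 \<Longrightarrow> gordc g = d \<Longrightarrow> rep g = r" "mdet r = 1" "gordc r = d" for d r
    unfolding C_deg_def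
  proof (rule typed_classes_eq[OF hq, where P = "\<lambda>g. gdeg g = d"])
    show "bitangent_degree F = d \<longleftrightarrow> gdeg g = d" if "framedg g F B w" for g and F :: "_ \<Rightarrow> 'a" and B w
      using bitangent_degree_eq[OF hq that] by simp
    show "rep g = r" if "mdet g = 1" "gdeg g = d" for g
      using r(1)[OF that(1)] gl_gdeg(1)[OF that(1)] that(2) by simp
    show "gdeg r = d" using gl_gdeg(1)[OF r(2)] r(3) by simp
  qed
  have C1: "(C_deg 1 :: 'a quartic set set) = typed_classes mI" by (rule deg) (simp_all add: rep_def rep_data del: mdet.simps)
  have C2: "(C_deg 2 :: 'a quartic set set) = typed_classes g2" by (rule deg) (simp_all add: rep_def rep_data del: mdet.simps)
  have C3: "(C_deg 3 :: 'a quartic set set) = typed_classes g3" by (rule deg) (simp_all add: rep_def rep_data del: mdet.simps)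
  have C4: "(C_deg 4 :: 'a quartic set set) = typed_classes g4" by (rule deg) (simp_all add: rep_def rep_data del: mdet.simps)
  have C70: "(C_7_0 :: 'a quartic set set) = typed_classes g7'" unfolding C_7_0_def
  proof (rule typed_classes_eq[OF hq, where P = "\<lambda>g. gdeg g = 7 \<and> gconc 1 3 g"])
    show "(bitangent_degree F = 7 \<and> (\<exists>L\<in>bitangents F. concurrent3 L (frob 1 L) (frob 3 L))) \<longleftrightarrow> gdeg g = 7 \<and> gconc 1 3 g"
      if "framedg g F B w" for g and F :: "_ \<Rightarrow> 'a" and B w
      using bitangent_degree_eq[OF hq that] bitangent_concurrent_eq[OF hq that] by simp
    show "rep g = g7'" if "mdet g = 1" "gdeg g = 7 \<and> gconc 1 3 g" for g
      using that(2) gl_gdeg[OF that(1)] by (simp add: rep_def gconc_iff)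
    show "gdeg g7' = 7 \<and> gconc 1 3 g7'" using gl_gdeg(1)[OF rep_data(5)] by (simp add: rep_data gconc_iff del: One_nat_def)
  qed
  have C71: "(C_7_1 :: 'a quartic set set) = typed_classes g7" unfolding C_7_1_def
  proof (rule typed_classes_eq[OF hq, where P = "\<lambda>g. gdeg g = 7 \<and> gconc 2 3 g"])
    show "(bitangent_degree F = 7 \<and> (\<exists>L\<in>bitangents F. concurrent3 L (frob 2 L) (frob 3 L))) \<longleftrightarrow> gdeg g = 7 \<and> gconc 2 3 g"
      if "framedg g F B w" for g and F :: "_ \<Rightarrow> 'a" and B w
      using bitangent_degree_eq[OF hq that] bitangent_concurrent_eq[OF hq that] by simp
    \<comment> \<open>Concurrence of type (2, 3) excludes type (1, 3) by the third part of
      \<open>gl_gdeg\<close>, so \<open>rep\<close> takes its last branch.\<close>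
    show "rep g = g7" if "mdet g = 1" "gdeg g = 7 \<and> gconc 2 3 g" for g
      using that(2) gl_gdeg[OF that(1)] by (simp add: rep_def gconc_iff)
    show "gdeg g7 = 7 \<and> gconc 2 3 g7" using gl_gdeg(1)[OF rep_data(6)] by (simp add: rep_data gconc_iff del: One_nat_def)
  qed
  have "real (card (iso_classes :: 'a quartic set set)) = ?t mI + ?t g2 + ?t g3 + ?t g4 + ?t g7' + ?t g7"
    unfolding card_iso_classes[OF hq] by simp
  also have "\<dots> = q^6 - q^5 + q^4 - 3*q^3 + 5*q^2 - 6*q + 7"
    unfolding tI t2 t3 t4 t7 t7' by (simp add: field_simps)
  finally show ?thesis unfolding C1 C2 C3 C4 C70 C71 using tI t2 t3 t4 t7 t7' by blast
qed

end
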